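(* Let $\left((A_i)_{1\le i\le p},(B_{i,j})_{1\le i\le p,\,1\le j\le n_i},U\right)$ be a family of control systems as described in the context, i.e. the control system $$\frac{d\psi_{i,j}}{dt}(t)=A_i(\psi_{i,j}(t))+u(t)B_{i,j}(\psi_{i,j}(t)),\qquad 1\le i\le p,\ 1\le j\le n_i,$$ driven by one common scalar control $u$ with values in $U$. Assume that: (i) the concatenation of the spectra (families of eigenvalues) of $A_1,A_2,\dots,A_p$ is a $\mathbf{Q}$-linearly independent family; (ii) for every $1\le i_0\le p$ and every $1\le j_0\le n_{i_0}$, there exists a connectedness chain $S$ of $(A_{i_0},B_{i_0,j_0})$ such that for every $s\in S$ and every $j\in\{1,\dots,n_{i_0}\}\setminus\{j_0\}$, $|b_{i_0,j_0}(s)|\neq|b_{i_0,j}(s)|$; (iii) $U$ contains a neighborhood of $0$ in $\mathbf{R}$. Let $T>0$ and let $c=\prod_{i=1}^p\prod_{j=1}^{n_i}c_{i,j}:[0,T]\to\prod_{i=1}^p L(H_i,H_i)^{n_i}$ be a continuous curve such that $c(0)=\mathrm{Id}_H$ and such that for every $1\le i\le p$, $1\le j\le n_i$ and every $t\in[0,T]$, $c_{i,j}(t):H_i\to H_i$ is unitary. Let $N$ be a positive integer. Then for every $\epsilon>0$ there exist $T_u>T$ and a piecewise constant control $u:[0,T_u]\to U$ such that the corresponding propagators $\Phi_{i,j}$ satisfy: (a) for every $t\in[0,T_u]$ there exists $s\in[0,T]$ such that $$\Big|\,|\langle\Phi_{i,j}(t,\phi_i^l),\phi_i^k\rangle|-|\langle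 c_{i,j}(s)(\phi_i^l),\phi_i^k\rangle|\,\Big|<\epsilon$$ for every $k\in\mathbf{N}$, $1\le i\le p$, $1\le j\le n_i$, $1\le l\le N$; and (b) $\|\Phi_{i,j}(T_u,\phi_i^l)-c_{i,j}(T)(\phi_i^l)\|<\epsilon$ for every $1\le i\le p$, $1\le j\le n_i$, $1\le l\le N$.
   Context: Setting. $U\subset\mathbf{R}$; $p\ge1$ is an integer; for $1\le i\le p$, $H_i$ is a complex Hilbert space, $n_i\geq 1$ is an integer, $A_i:D(A_i)\subset H_i\to H_i$ and $B_{i,j}:D(B_{i,j})\subset H_i\to H_i$ ($1\le j\le n_i$) are densely defined, not necessarily bounded, linear operators. Standing assumptions: - all $A_i$ and $B_{i,j}$ are skew-adjoint; - for each $i$ there is an orthonormal (Hilbert) basis $(\phi_i^k)_{k\ge1}$ of $H_i$ made of eigenvectors of $A_i$, all associated with simple eigenvalues; - $\phi_i^k\in D(B_{i,j})$ for all $i$, all $j\in\{1,\dots,n_i\}$ and all $k\ge1$; - for every $u\in U$ and every $i,j$, $A_i+uB_{i,j}$ has a skew-adjoint extension on a dense domain of $H_i$ and so generates a group of unitary transformations of $H_i$, denoted $e^{t(A_i+uB_{i,j})}$. Write $H=\prod_{i=1}^pH_i^{n_i}$, and $L(H_i,H_i)$ for the space of bounded linear operators of $H_i$ (with the operator norm). Propagators. Given a piecewise constant $u:[0,T_u]\to U$ taking successively the values $u_1,\dots,u_L$ on consecutive intervals of lengths $t_1,\dots,t_L$, the propagator $\Phi_{i,j}$ is defined, for $\psi^0\in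 H_i$ and $\sum_{l=1}^{k-1}t_l\le t\leq\sum_{l=1}^kt_l$, by $$\Phi_{i,j}(t,\psi^0)=e^{(t-\sum_{l=1}^{k-1}t_l)(A_i+u_kB_{i,j})}\circ e^{t_{k-1}(A_i+u_{k-1}B_{i,j})}\circ\cdots\circ e^{t_1(A_i+u_1B_{i,j})}(\psi^0).$$ The same control $u$ is used for all $(i,j)$. Matrix coefficients. For $k,l\in\mathbf{N}=\{1,2,\dots\}$, $b_{i,j}(k,l)=\langle B_{i,j}\phi_i^k,\phi_i^l\rangle$; for $s=(k,l)\in\mathbf{N}^2$, $b_{i,j}(s)=b_{i,j}(k,l)$. Connectedness chains. A finite sequence $(k_1,\dots,k_l)$ of positive integers connects $k$ and $k'$ for $(A_i,B_{i,j})$ if $k_1=k$, $k_l=k'$ and $\prod_{q=1}^{l-1}b_{i,j}(k_q,k_{q+1})\neq0$. A subset $S\subset\mathbf{N}^2$ is a connectedness chain of $(A_i,B_{i,j})$ if for arbitrarily large $N'$, for all $1\le k,k'\le N'$ there is a finite sequence $(q_1,\dots,q_l)$ in $\{1,\dots,N'\}$ that connects $k$ and $k'$ for $(A_i,B_{i,j})$ and such that $(q_r,q_{r+1})\in S$ for every $1\le r\le l-1$. *)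

theory Defs
  imports "HOL-Analysis.Analysis"
begin

section \<open>Complex Hilbert spaces\<close>

text \<open>
  A complex inner product is layered on top of the real inner product of the library, which is
  its real part, so that the norm and the topology are the library ones.  The complex inner
  product is linear in the first argument.
\<close>

class complex_inner = real_inner +
  fixes scaleC :: "complex \<Rightarrow> 'a \<Rightarrow> 'a"  (infixr "*\<^sub>C" 75)
    and cinner :: "'a \<Rightarrow> 'a \<Rightarrow> complex"
  assumes scaleC_add_right: "a *\<^sub>C (x + y) = a *\<^sub>C x + a *\<^sub>C y"
    and scaleC_add_left: "(a + b) *\<^sub>C x = a *\<^sub>C x + b *\<^sub>C x"
    and scaleC_scaleC: "a *\<^sub>C (b *\<^sub>C x) = (a * b) *\<^sub>C x"
    and scaleC_of_real: "complex_of_real r *\<^sub>C x = r *\<^sub>R x"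
    and cinner_commute: "cinner x y = cnj (cinner y x)"
    and cinner_add_left: "cinner (x + y) z = cinner x z + cinner y z"
    and cinner_scaleC_left: "cinner (a *\<^sub>C x) y = a * cinner x y"
    and Re_cinner: "Re (cinner x y) = inner x y"

lemma scaleC_one: "1 *\<^sub>C x = (x :: 'a :: complex_inner)"
  using scaleC_of_real[of 1 x] by simp

global_interpretation complex_vector: vector_space "scaleC :: complex \<Rightarrow> 'a \<Rightarrow> 'a :: complex_inner"
  by unfold_locales
    (auto simp: scaleC_add_right scaleC_add_left scaleC_scaleC scaleC_one)

text \<open>
  In order to have a family of different Hilbert spaces inside one type, a Hilbert space is a
  complete complex subspace of an arbitrary ambient complex inner product space, which is itself
  not assumed to be complete.  The members of a family may overlap or coincide.
\<close>

definition hilbert_space :: "'h::complex_inner set \<Rightarrow> bool" where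
  "hilbert_space H \<longleftrightarrow> complex_vector.subspace H \<and> complete H"

text \<open>The index set of a Hilbert basis is \<open>{1, 2, 3, \<dots>}\<close>; the value of \<open>\<phi>\<close> at \<open>0\<close> is irrelevant.\<close>

definition hilbert_basis :: "'h::complex_inner set \<Rightarrow> (nat \<Rightarrow> 'h) \<Rightarrow> bool" where
  "hilbert_basis H \<phi> \<longleftrightarrow>
     \<phi> ` {1..} \<subseteq> H \<and>
     (\<forall>k\<ge>1. \<forall>l\<ge>1. cinner (\<phi> k) (\<phi> l) = (if k = l then 1 else 0)) \<and>
     H \<subseteq> closure (complex_vector.span (\<phi> ` {1..}))"

definition linear_map_on :: "'h::complex_inner set \<Rightarrow> ('h \<Rightarrow> 'h) \<Rightarrow> bool" where
  "linear_map_on D f \<longleftrightarrow>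
     (\<forall>x\<in>D. \<forall>y\<in>D. f (x + y) = f x + f y) \<and> (\<forall>a. \<forall>x\<in>D. f (a *\<^sub>C x) = a *\<^sub>C f x)"

definition unitary_on :: "'h::complex_inner set \<Rightarrow> ('h \<Rightarrow> 'h) \<Rightarrow> bool" where
  "unitary_on H f \<longleftrightarrow>
     linear_map_on H f \<and> f ` H = H \<and> (\<forall>x\<in>H. \<forall>y\<in>H. cinner (f x) (f y) = cinner x y)"

text \<open>Operator norm of \<open>f\<close> as a map on \<open>H\<close>; compare \<^const>\<open>onorm\<close>.\<close>

definition opnorm_on :: "'h::complex_inner set \<Rightarrow> ('h \<Rightarrow> 'h) \<Rightarrow> real" where
  "opnorm_on H f = (SUP x\<in>H. norm (f x) / norm x)"

definition opnorm_continuous_on ::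
  "'h::complex_inner set \<Rightarrow> real set \<Rightarrow> (real \<Rightarrow> 'h \<Rightarrow> 'h) \<Rightarrow> bool" where
  "opnorm_continuous_on H I c \<longleftrightarrow>
     (\<forall>t\<in>I. ((\<lambda>s. opnorm_on H (\<lambda>x. c s x - c t x)) \<longlongrightarrow> 0) (at t within I))"


section \<open>Unbounded operators\<close>

text \<open>
  An operator is a partial function whose \<^const>\<open>dom\<close> is the domain of the operator, so that
  \<open>A \<subseteq>\<^sub>m C\<close> says that \<open>C\<close> is an extension of \<open>A\<close>, and equality of operators includes equality
  of their domains.
\<close>

definition densely_defined_operator :: "'h::complex_inner set \<Rightarrow> ('h \<rightharpoonup> 'h) \<Rightarrow> bool" where
  "densely_defined_operator H A \<longleftrightarrow>
     complex_vector.subspace (dom A) \<and> dom A \<subseteq> H \<and> ran A \<subseteq> H \<and>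
     linear_map_on (dom A) (\<lambda>x. the (A x)) \<and> H \<subseteq> closure (dom A)"

text \<open>For a densely defined \<open>A\<close> the vector \<open>z\<close> below is unique.\<close>

definition op_adjoint :: "'h::complex_inner set \<Rightarrow> ('h \<rightharpoonup> 'h) \<Rightarrow> ('h \<rightharpoonup> 'h)" where
  "op_adjoint H A = (\<lambda>y.
     if y \<in> H \<and> (\<exists>z\<in>H. \<forall>x\<in>dom A. cinner (the (A x)) y = cinner x z)
     then Some (THE z. z \<in> H \<and> (\<forall>x\<in>dom A. cinner (the (A x)) y = cinner x z))
     else None)"

definition op_uminus :: "('h::complex_inner \<rightharpoonup> 'h) \<Rightarrow> ('h \<rightharpoonup> 'h)" where
  "op_uminus A = (\<lambda>x. map_option uminus (A x))"

text \<open>The domain of \<open>A + uB\<close> is the intersection of the two domains, also for \<open>u = 0\<close>.\<close>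

definition op_add_scaled ::
  "('h::complex_inner \<rightharpoonup> 'h) \<Rightarrow> real \<Rightarrow> ('h \<rightharpoonup> 'h) \<Rightarrow> ('h \<rightharpoonup> 'h)" where
  "op_add_scaled A u B = (\<lambda>x.
     case (A x, B x) of (Some a, Some b) \<Rightarrow> Some (a + u *\<^sub>R b) | _ \<Rightarrow> None)"

definition skew_adjoint :: "'h::complex_inner set \<Rightarrow> ('h \<rightharpoonup> 'h) \<Rightarrow> bool" where
  "skew_adjoint H A \<longleftrightarrow> densely_defined_operator H A \<and> op_adjoint H A = op_uminus A"

text \<open>A simple eigenvalue is one whose eigenspace is a complex line.\<close>

definition simple_eigenvalue :: "('h::complex_inner \<rightharpoonup> 'h) \<Rightarrow> complex \<Rightarrow> bool" where
  "simple_eigenvalue A \<mu> \<longleftrightarrow>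
     (\<exists>v. v \<noteq> 0 \<and> {x. A x = Some (\<mu> *\<^sub>C x)} = complex_vector.span {v})"

definition unitary_group :: "'h::complex_inner set \<Rightarrow> (real \<Rightarrow> 'h \<Rightarrow> 'h) \<Rightarrow> bool" where
  "unitary_group H W \<longleftrightarrow>
     (\<forall>t. unitary_on H (W t)) \<and>
     (\<forall>x\<in>H. W 0 x = x) \<and>
     (\<forall>s t. \<forall>x\<in>H. W (s + t) x = W s (W t x)) \<and>
     (\<forall>x\<in>H. continuous_on UNIV (\<lambda>t. W t x))"

definition infinitesimal_generator ::
  "'h::complex_inner set \<Rightarrow> (real \<Rightarrow> 'h \<Rightarrow> 'h) \<Rightarrow> ('h \<rightharpoonup> 'h)" where
  "infinitesimal_generator H W = (\<lambda>x.
     if x \<in> H \<and> (\<lambda>t. W t x) differentiable (at 0)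
     then Some (vector_derivative (\<lambda>t. W t x) (at 0))
     else None)"


section \<open>Families of bilinear control systems\<close>

text \<open>
  The indices range over \<open>i \<in> {1..p}\<close>, \<open>j \<in> {1..n i}\<close> and \<open>k \<ge> 1\<close>.
  \<open>\<mu> i k\<close> is the eigenvalue of \<open>A i\<close> at \<open>\<phi> i k\<close>.
  A skew-adjoint extension of \<open>A i + u B i j\<close> need not be unique, so the extension that is meant
  by \<open>exp (t (A i + u B i j))\<close> is the parameter \<open>C i j u\<close>, and \<open>W i j u t\<close> is
  \<open>exp (t (C i j u))\<close>, the one-parameter unitary group generated by that extension.
  By Stone's theorem such a group exists for every skew-adjoint \<open>C i j u\<close>, and it is unique
  on \<open>H i\<close>.
\<close>

locale control_system_family =
  fixes p :: nat
    and n :: "nat \<Rightarrow> nat"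
    and H :: "nat \<Rightarrow> 'h::complex_inner set"
    and A :: "nat \<Rightarrow> 'h \<rightharpoonup> 'h"
    and B :: "nat \<Rightarrow> nat \<Rightarrow> 'h \<rightharpoonup> 'h"
    and U :: "real set"
    and \<phi> :: "nat \<Rightarrow> nat \<Rightarrow> 'h"
    and \<mu> :: "nat \<Rightarrow> nat \<Rightarrow> complex"
    and C :: "nat \<Rightarrow> nat \<Rightarrow> real \<Rightarrow> 'h \<rightharpoonup> 'h"
    and W :: "nat \<Rightarrow> nat \<Rightarrow> real \<Rightarrow> real \<Rightarrow> 'h \<Rightarrow> 'h"
  assumes p_ge_1: "p \<ge> 1"
    and n_ge_1: "\<And>i. i \<in> {1..p} \<Longrightarrow> n i \<ge> 1"
    and hilbert: "\<And>i. i \<in> {1..p} \<Longrightarrow> hilbert_space (H i)"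
    and A_skew_adjoint: "\<And>i. i \<in> {1..p} \<Longrightarrow> skew_adjoint (H i) (A i)"
    and B_skew_adjoint: "\<And>i j. \<lbrakk>i \<in> {1..p}; j \<in> {1..n i}\<rbrakk> \<Longrightarrow> skew_adjoint (H i) (B i j)"
    and basis: "\<And>i. i \<in> {1..p} \<Longrightarrow> hilbert_basis (H i) (\<phi> i)"
    and eigenvector: "\<And>i k. \<lbrakk>i \<in> {1..p}; k \<ge> 1\<rbrakk> \<Longrightarrow> A i (\<phi> i k) = Some (\<mu> i k *\<^sub>C \<phi> i k)"
    and simple: "\<And>i k. \<lbrakk>i \<in> {1..p}; k \<ge> 1\<rbrakk> \<Longrightarrow> simple_eigenvalue (A i) (\<mu> i k)"
    and basis_in_dom_B:
      "\<And>i j k. \<lbrakk>i \<in> {1..p}; j \<in> {1..n i}; k \<ge> 1\<rbrakk> \<Longrightarrow> \<phi> i k \<in> dom (B i j)"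
    and C_skew_adjoint:
      "\<And>i j u. \<lbrakk>i \<in> {1..p}; j \<in> {1..n i}; u \<in> U\<rbrakk> \<Longrightarrow> skew_adjoint (H i) (C i j u)"
    and C_extends:
      "\<And>i j u. \<lbrakk>i \<in> {1..p}; j \<in> {1..n i}; u \<in> U\<rbrakk> \<Longrightarrow> op_add_scaled (A i) u (B i j) \<subseteq>\<^sub>m C i j u"
    and W_unitary_group:
      "\<And>i j u. \<lbrakk>i \<in> {1..p}; j \<in> {1..n i}; u \<in> U\<rbrakk> \<Longrightarrow> unitary_group (H i) (W i j u)"
    and W_generator:
      "\<And>i j u. \<lbrakk>i \<in> {1..p}; j \<in> {1..n i}; u \<in> U\<rbrakk> \<Longrightarrow>
         infinitesimal_generator (H i) (W i j u) = C i j u"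

definition rat_independent_family :: "'i set \<Rightarrow> ('i \<Rightarrow> complex) \<Rightarrow> bool" where
  "rat_independent_family I f \<longleftrightarrow>
     (\<forall>F q. finite F \<and> F \<subseteq> I \<and> (\<Sum>x\<in>F. of_rat (q x) * f x) = 0 \<longrightarrow> (\<forall>x\<in>F. q x = 0))"

text \<open>Coefficients \<open>b(k, l)\<close> of an operator \<open>B\<close> in the basis \<open>\<phi>\<close>.\<close>

definition mcoeff :: "('h::complex_inner \<rightharpoonup> 'h) \<Rightarrow> (nat \<Rightarrow> 'h) \<Rightarrow> nat \<times> nat \<Rightarrow> complex" where
  "mcoeff B \<phi> = (\<lambda>(k, l). cinner (the (B (\<phi> k))) (\<phi> l))"

definition connects :: "(nat \<times> nat \<Rightarrow> complex) \<Rightarrow> nat list \<Rightarrow> nat \<Rightarrow> nat \<Rightarrow> bool" where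
  "connects b ks k k' \<longleftrightarrow>
     ks \<noteq> [] \<and> set ks \<subseteq> {1..} \<and> hd ks = k \<and> last ks = k' \<and>
     (\<Prod>r<length ks - 1. b (ks ! r, ks ! Suc r)) \<noteq> 0"

definition connectedness_chain :: "(nat \<times> nat \<Rightarrow> complex) \<Rightarrow> (nat \<times> nat) set \<Rightarrow> bool" where
  "connectedness_chain b S \<longleftrightarrow>
     S \<subseteq> {1..} \<times> {1..} \<and>
     (\<forall>M. \<exists>N'\<ge>M. \<forall>k\<in>{1..N'}. \<forall>k'\<in>{1..N'}. \<exists>qs.
        set qs \<subseteq> {1..N'} \<and> connects b qs k k' \<and>
        (\<forall>r<length qs - 1. (qs ! r, qs ! Suc r) \<in> S))"

text \<open>
  \<open>pieces = [(t\<^sub>1, u\<^sub>1), \<dots>, (t\<^sub>L, u\<^sub>L)]\<close> lists the durations of the successive intervals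
  and the values of the control on them.
\<close>

definition piecewise_constant_control ::
  "real set \<Rightarrow> real \<Rightarrow> (real \<Rightarrow> real) \<Rightarrow> (real \<times> real) list \<Rightarrow> bool" where
  "piecewise_constant_control U Tu u pieces \<longleftrightarrow>
     (\<forall>t\<in>{0..Tu}. u t \<in> U) \<and>
     (\<forall>(\<tau>, v) \<in> set pieces. \<tau> > 0 \<and> v \<in> U) \<and>
     Tu = sum_list (map fst pieces) \<and>
     (\<forall>k<length pieces. \<forall>t.
        sum_list (map fst (take k pieces)) \<le> t \<and> t < sum_list (map fst (take (Suc k) pieces))
        \<longrightarrow> u t = snd (pieces ! k))"

text \<open>Here \<open>E v t\<close> stands for \<open>exp (t (A + v B))\<close>.\<close>

fun propagator ::
  "(real \<Rightarrow> real \<Rightarrow> 'h \<Rightarrow> 'h) \<Rightarrow> (real \<times> real) list \<Rightarrow> real \<Rightarrow> 'h \<Rightarrow> 'h" where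
  "propagator E [] t \<psi> = \<psi>"
| "propagator E ((\<tau>, v) # ps) t \<psi> =
     (if t \<le> \<tau> then E v t \<psi> else propagator E ps (t - \<tau>) (E v \<tau> \<psi>))"

end

theory Submission
  imports Defs "HOL-Analysis.Kronecker_Approximation_Theorem"
begin

text \<open>
  Moduli of coefficients do not change during free evolution, and by Kronecker's theorem free
  evolution realises, up to any error, every choice of phases on finitely many eigenvectors
  (with the same phases for all \<open>j\<close>).  Hence short pulses of \<open>A\<^sub>i + u B\<^sub>i\<^sub>j\<close> can be conjugated by
  diagonal unitaries at no cost.  Call a family of skew operators \<open>M\<close> achievable if \<open>1 + \<tau> M + o(\<tau>)\<close>
  can be realised for small \<open>\<tau>\<close> on finitely many basis vectors while all intermediate propagators
  are nearly diagonal.  The reversible achievable families form a Lie algebra closed under strong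
  limits.  Averaging \<open>B\<close> over signs leaves a single transition \<open>(a, b)\<close> in one class \<open>i\<close>; brackets
  multiply the coupling of the \<open>j\<close>-th system by powers of \<open>\<bar>b\<^sub>i\<^sub>j(a, b)\<bar>\<^sup>2\<close>, so a polynomial in these
  numbers isolates one \<open>j\<close>, and a connectedness chain then gives all transitions of that system.
  In the strong limit all rank-one phases \<open>exp (i \<theta> |v\<rangle>\<langle>v|)\<close> are reached, with a deviation
  proportional to \<open>\<theta>\<close>.  Two of them with small \<open>\<theta>\<close> move a unit vector to any nearby one, so
  the curve of frames \<open>c(t) \<phi>\<^sub>l\<close> can be followed in small steps.
\<close>

section \<open>Complex inner product spaces\<close>

text \<open>The obstacle is requirement (a): the moduli must stay near the curve at all times, so it
  is not enough to know which isometries can be approximated; each must come with a bound on the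
  excursion made on the way. Composing words adds such bounds, and brackets need ever longer words
  as they are approximated better. Two notions keep this under control. \<open>ach\<close> speaks of
  one short word with error \<open>\<eta> * \<tau>\<close>, so that \<open>s / \<tau>\<close>
  repetitions give an error of order \<open>\<eta> * s\<close>; each repetition starts near a point
  of the flow, so the excursions are not summed, and the flow for time \<open>s\<close> has
  deviation \<open>C * s\<close>. Only directions of deviation 0 are collected in
  \<open>lie\<close>, so sums and brackets cost nothing however many are formed. The second obstacle
  is unboundedness: operators are evaluated only on the algebraic span of the basis, and closeness
  is required only on finitely many basis vectors; since words are isometries, it extends to any
  finitely many vectors. Finally, \<open>\<rho>\<close> does not depend on the number
  \<open>K\<close> of basis vectors under control, because the tracking error contains the term
  \<open>K * \<rho>\<close>.\<close>

lemma cinner_add_right: "cinner x (y + z) = cinner x y + cinner x (z::'a::complex_inner)"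
  by (metis cinner_add_left cinner_commute complex_cnj_add)

lemma cinner_scaleC_right: "cinner x (a *\<^sub>C y) = cnj a * cinner x (y::'a::complex_inner)"
  by (metis cinner_scaleC_left cinner_commute complex_cnj_mult)

lemma cinner_zero_left [simp]: "cinner 0 (x::'a::complex_inner) = 0"
  using cinner_add_left[of 0 0 x] by simp

lemma cinner_zero_right [simp]: "cinner (x::'a::complex_inner) 0 = 0"
  using cinner_add_right[of x 0 0] by simp

lemmas scaleC_minus_left = complex_vector.scale_minus_left
lemmas scaleC_diff_left = complex_vector.scale_left_diff_distrib
lemmas scaleC_diff_right = complex_vector.scale_right_diff_distrib

lemma cinner_minus_left: "cinner (- x) y = - cinner x (y::'a::complex_inner)"
  using cinner_add_left[of x "- x" y] by (simp add: eq_neg_iff_add_eq_0 add.commute)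

lemma cinner_minus_right: "cinner x (- y) = - cinner x (y::'a::complex_inner)"
  using cinner_add_right[of x y "- y"] by (simp add: eq_neg_iff_add_eq_0 add.commute)

lemma cinner_diff_left: "cinner (x - y) z = cinner x z - cinner y (z::'a::complex_inner)"
  using cinner_add_left[of x "- y" z] by (simp add: cinner_minus_left)

lemma cinner_diff_right: "cinner x (y - z) = cinner x y - cinner x (z::'a::complex_inner)"
  using cinner_add_right[of x y "- z"] by (simp add: cinner_minus_right)

lemma scaleR_scaleC: "r *\<^sub>R (x::'a::complex_inner) = complex_of_real r *\<^sub>C x"
  by (simp add: scaleC_of_real)

lemma scaleR_scaleC_commute: "r *\<^sub>R (a *\<^sub>C x) = a *\<^sub>C (r *\<^sub>R (x::'a::complex_inner))"
  by (simp add: scaleR_scaleC scaleC_scaleC mult.commute)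

lemma cinner_sum_left: "cinner (sum f S) (y::'a::complex_inner) = (\<Sum>k\<in>S. cinner (f k) y)"
  by (induction S rule: infinite_finite_induct) (auto simp: cinner_add_left)

lemma cinner_scaleR_left: "cinner (r *\<^sub>R x) (y::'a::complex_inner) = r *\<^sub>R cinner x y"
  by (simp add: scaleR_scaleC cinner_scaleC_left scaleR_conv_of_real)

lemma cinner_scaleR_right: "cinner x (r *\<^sub>R (y::'a::complex_inner)) = r *\<^sub>R cinner x y"
  by (simp add: scaleR_scaleC cinner_scaleC_right scaleR_conv_of_real)

lemma cinner_self: "cinner x (x::'a::complex_inner) = complex_of_real ((norm x)\<^sup>2)"
proof (rule complex_eqI)
  have "cinner x x = cnj (cinner x x)" by (rule cinner_commute)
  then show "Im (cinner x x) = Im (complex_of_real ((norm x)\<^sup>2))"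
    by (metis Im_complex_of_real complex_cnj_cancel_iff Reals_cnj_iff complex_is_Real_iff)
qed (simp add: Re_cinner power2_norm_eq_inner)

lemma norm_scaleC: "norm (a *\<^sub>C (x::'a::complex_inner)) = cmod a * norm x"
proof -
  have "complex_of_real ((norm (a *\<^sub>C x))\<^sup>2) = a * cnj a * cinner x x"
    by (metis cinner_scaleC_left cinner_scaleC_right cinner_self mult.assoc)
  also have "\<dots> = complex_of_real ((cmod a * norm x)\<^sup>2)"
    by (simp add: cinner_self power_mult_distrib flip: complex_norm_square)
  finally have "(norm (a *\<^sub>C x))\<^sup>2 = (cmod a * norm x)\<^sup>2"
    using of_real_eq_iff by blast
  then show ?thesis by simp
qed

text \<open>Follows from the real inequality: the unit number \<open>z\<close> rotates
  \<open>cinner x y\<close> onto the positive real axis, where it equals its real part.\<close>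

lemma cinner_cauchy_schwarz: "cmod (cinner x (y::'a::complex_inner)) \<le> norm x * norm y"
proof (cases "cinner x y = 0")
  case False
  define z where "z = cnj (cinner x y) / cmod (cinner x y)"
  have z: "cmod z = 1" using False by (simp add: z_def norm_divide)
  have "z * cinner x y = cmod (cinner x y)"
    using False by (simp add: z_def complex_norm_square[symmetric] mult.commute power2_eq_square)
  then have "cmod (cinner x y) = inner (z *\<^sub>C x) y"
    by (metis Re_cinner Re_complex_of_real cinner_scaleC_left)
  also have "\<dots> \<le> norm (z *\<^sub>C x) * norm y" by (rule norm_cauchy_schwarz)
  finally show ?thesis by (simp add: norm_scaleC z)
qed simp

lemma norm_add_sq: "(norm (x + y))\<^sup>2 = (norm x)\<^sup>2 + (norm (y::'a::complex_inner))\<^sup>2 + 2 * Re (cinner x y)"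
  by (simp add: power2_norm_eq_inner inner_add_left inner_add_right inner_commute Re_cinner)

lemma norm_sum_scaleC_le:
  fixes v :: "nat \<Rightarrow> 'a::complex_inner"
  assumes "\<And>k. k \<in> S \<Longrightarrow> norm (v k) \<le> r"
  shows "norm (\<Sum>k\<in>S. a k *\<^sub>C v k) \<le> (\<Sum>k\<in>S. cmod (a k)) * r"
proof -
  have "norm (\<Sum>k\<in>S. a k *\<^sub>C v k) \<le> (\<Sum>k\<in>S. norm (a k *\<^sub>C v k))" by (rule norm_sum)
  also have "\<dots> \<le> (\<Sum>k\<in>S. cmod (a k) * r)"
    by (rule sum_mono) (simp add: norm_scaleC assms mult_left_mono)
  finally show ?thesis by (simp add: sum_distrib_right)
qed

abbreviation "csubspace \<equiv> complex_vector.subspace"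
abbreviation "cspan \<equiv> complex_vector.span"

lemma csubspace_scaleR: "csubspace V \<Longrightarrow> x \<in> V \<Longrightarrow> r *\<^sub>R x \<in> V"
  by (simp add: scaleR_scaleC complex_vector.subspace_scale)

subsection \<open>Linear and isometric maps\<close>

text \<open>Domain and codomain are separate because unbounded operators are used on the algebraic
  span of the basis only, while their values lie in the whole Hilbert space.\<close>

definition lin_into :: "'h::complex_inner set \<Rightarrow> 'h set \<Rightarrow> ('h \<Rightarrow> 'h) \<Rightarrow> bool" where
  "lin_into V V' f \<longleftrightarrow> linear_map_on V f \<and> f ` V \<subseteq> V'"

definition isom_on :: "'h::complex_inner set \<Rightarrow> ('h \<Rightarrow> 'h) \<Rightarrow> bool" where
  "isom_on V f \<longleftrightarrow> lin_into V V f \<and> (\<forall>x\<in>V. norm (f x) = norm x)"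

lemma lin_into_add: "lin_into V V' f \<Longrightarrow> x \<in> V \<Longrightarrow> y \<in> V \<Longrightarrow> f (x + y) = f x + f y"
  by (simp add: lin_into_def linear_map_on_def)

lemma lin_into_scaleC: "lin_into V V' f \<Longrightarrow> x \<in> V \<Longrightarrow> f (a *\<^sub>C x) = a *\<^sub>C f x"
  by (simp add: lin_into_def linear_map_on_def)

lemma lin_into_scaleR: "lin_into V V' f \<Longrightarrow> x \<in> V \<Longrightarrow> f (r *\<^sub>R x) = r *\<^sub>R f x"
  by (simp add: scaleR_scaleC lin_into_scaleC)

lemma lin_into_mem: "lin_into V V' f \<Longrightarrow> x \<in> V \<Longrightarrow> f x \<in> V'"
  by (auto simp: lin_into_def)

lemma lin_into_zero: "lin_into V V' f \<Longrightarrow> csubspace V \<Longrightarrow> f 0 = 0"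
  using lin_into_scaleC[of V V' f 0 0] complex_vector.subspace_0[of V] by simp

lemma lin_into_minus: "lin_into V V' f \<Longrightarrow> x \<in> V \<Longrightarrow> f (- x) = - f x"
  using lin_into_scaleC[of V V' f x "-1"] by (simp add: scaleC_minus_left)

lemma lin_into_diff:
  "lin_into V V' f \<Longrightarrow> csubspace V \<Longrightarrow> x \<in> V \<Longrightarrow> y \<in> V \<Longrightarrow> f (x - y) = f x - f y"
  using lin_into_add[of V V' f x "- y"] lin_into_minus[of V V' f y]
    complex_vector.subspace_neg[of V y] by simp

lemma lin_into_sum:
  assumes "lin_into V V' f" "csubspace V" "\<And>k. k \<in> S \<Longrightarrow> v k \<in> V"
  shows "f (\<Sum>k\<in>S. a k *\<^sub>C v k) = (\<Sum>k\<in>S. a k *\<^sub>C f (v k))"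
  using assms(3)
proof (induction S rule: infinite_finite_induct)
  case (insert k S)
  have "(\<Sum>k\<in>S. a k *\<^sub>C v k) \<in> V"
    using insert assms(2)
    by (intro complex_vector.subspace_sum complex_vector.subspace_scale) auto
  then show ?case
    using insert assms
    by (simp add: lin_into_add[OF assms(1)] lin_into_scaleC[OF assms(1)]
        complex_vector.subspace_scale)
qed (auto simp: lin_into_zero[OF assms(1,2)])

lemma lin_into_compose: "lin_into V V' f \<Longrightarrow> lin_into V' V'' g \<Longrightarrow> lin_into V V'' (\<lambda>x. g (f x))"
  by (auto simp: lin_into_def linear_map_on_def image_subset_iff)

lemma lin_into_subset: "lin_into V V' f \<Longrightarrow> V1 \<subseteq> V \<Longrightarrow> lin_into V1 V' f"
  by (auto simp: lin_into_def linear_map_on_def image_subset_iff subset_iff)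

lemma lin_into_plus:
  "lin_into V V' f \<Longrightarrow> lin_into V V' g \<Longrightarrow> csubspace V' \<Longrightarrow> lin_into V V' (\<lambda>x. f x + g x)"
  by (auto simp: lin_into_def linear_map_on_def image_subset_iff scaleC_add_right
      complex_vector.subspace_add)

lemma lin_into_smult:
  "lin_into V V' f \<Longrightarrow> csubspace V' \<Longrightarrow> lin_into V V' (\<lambda>x. r *\<^sub>R f x)"
  by (auto simp: lin_into_def linear_map_on_def image_subset_iff scaleR_add_right
      csubspace_scaleR scaleR_scaleC_commute)

lemma lin_into_uminus:
  "lin_into V V' f \<Longrightarrow> csubspace V' \<Longrightarrow> lin_into V V' (\<lambda>x. - f x)"
  using lin_into_smult[of V V' f "-1"] by simp

lemma lin_into_minus_fun:
  "lin_into V V' f \<Longrightarrow> lin_into V V' g \<Longrightarrow> csubspace V' \<Longrightarrow> lin_into V V' (\<lambda>x. f x - g x)"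
  using lin_into_plus[OF _ lin_into_uminus, of V V' f g] by simp

lemma lin_into_id: "V \<subseteq> V' \<Longrightarrow> lin_into V V' (\<lambda>x. x)"
  by (auto simp: lin_into_def linear_map_on_def)

lemma lin_into_zero_map: "csubspace V' \<Longrightarrow> lin_into V V' (\<lambda>x. 0)"
  by (auto simp: lin_into_def linear_map_on_def complex_vector.subspace_0)

lemma isom_lin: "isom_on V f \<Longrightarrow> lin_into V V f"
  by (simp add: isom_on_def)

lemma isom_norm: "isom_on V f \<Longrightarrow> x \<in> V \<Longrightarrow> norm (f x) = norm x"
  by (simp add: isom_on_def)

lemma isom_mem: "isom_on V f \<Longrightarrow> x \<in> V \<Longrightarrow> f x \<in> V"
  by (meson isom_lin lin_into_mem)

lemma isom_compose: "isom_on V f \<Longrightarrow> isom_on V g \<Longrightarrow> isom_on V (\<lambda>x. g (f x))"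
  by (auto simp: isom_on_def lin_into_compose lin_into_mem)

lemma isom_id: "isom_on V (\<lambda>x. x)"
  by (simp add: isom_on_def lin_into_id)

lemma isom_dist:
  "isom_on V f \<Longrightarrow> csubspace V \<Longrightarrow> x \<in> V \<Longrightarrow> y \<in> V \<Longrightarrow> norm (f x - f y) = norm (x - y)"
  by (metis complex_vector.subspace_diff isom_lin isom_norm lin_into_diff)

lemma unitary_imp_isom:
  assumes "unitary_on V f"
  shows "isom_on V f"
proof -
  have "norm (f x) = norm x" if "x \<in> V" for x
  proof -
    have "cinner (f x) (f x) = cinner x x" using assms that by (simp add: unitary_on_def)
    then have "(norm (f x))\<^sup>2 = (norm x)\<^sup>2" unfolding cinner_self of_real_eq_iff .
    then show ?thesis by simp
  qed
  then show ?thesis using assms by (auto simp: unitary_on_def isom_on_def lin_into_def)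
qed

subsection \<open>Phases on a vector\<close>

text \<open>Here \<open>v\<close> is meant to be a unit vector, or \<open>0\<close> as a code for the identity.\<close>

definition ph :: "'h::complex_inner \<Rightarrow> complex \<Rightarrow> 'h \<Rightarrow> 'h" where
  "ph v z \<psi> = \<psi> + ((z - 1) * cinner \<psi> v) *\<^sub>C v"

lemma ph_zero [simp]: "ph 0 z \<psi> = \<psi>"
  by (simp add: ph_def)

lemma ph_one [simp]: "ph v 1 \<psi> = \<psi>"
  by (simp add: ph_def)

lemma ph_lin: "csubspace V \<Longrightarrow> v \<in> V \<Longrightarrow> lin_into V V (ph v z)"
  by (auto simp: lin_into_def linear_map_on_def ph_def cinner_add_left scaleC_add_right scaleC_add_left
      scaleC_scaleC cinner_scaleC_left algebra_simps complex_vector.subspace_add complex_vector.subspace_scale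
      complex_vector.subspace_diff)

lemma ph_orth: "cinner \<psi> v = 0 \<Longrightarrow> ph v z \<psi> = \<psi>"
  by (simp add: ph_def)

lemma ph_self: "norm v = 1 \<Longrightarrow> ph v z v = z *\<^sub>C v"
  by (simp add: ph_def cinner_self scaleC_diff_left)

lemma ph_mult:
  assumes "norm v = 0 \<or> norm v = 1"
  shows "ph v z (ph v z' \<psi>) = ph v (z * z') \<psi>"
proof (cases "norm v = 1")
  case True
  then have "cinner v v = 1" by (simp add: cinner_self)
  then show ?thesis
    by (simp add: ph_def cinner_add_left cinner_scaleC_left add.assoc flip: scaleC_add_left)
       (simp add: algebra_simps)
qed (use assms in auto)

lemma ph_commute:
  assumes "cinner v w = 0"
  shows "ph v z (ph w z' \<psi>) = ph w z' (ph v z \<psi>)"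
proof -
  have "cinner w v = 0" using assms cinner_commute[of w v] by simp
  then show ?thesis using assms
    by (simp add: ph_def cinner_add_left cinner_scaleC_left)
qed

text \<open>Expanding the square for a unit vector \<open>v\<close>, the excess over the squared
  norm of \<open>\<psi>\<close> is a multiple of (Re z)^2 + (Im z)^2 - 1.\<close>

lemma ph_norm:
  assumes "norm v = 0 \<or> norm v = 1" "cmod z = 1"
  shows "norm (ph v z \<psi>) = norm \<psi>"
proof (cases "norm v = 1")
  case True
  define c where "c = cinner \<psi> v"
  have z: "(Re z)\<^sup>2 + (Im z)\<^sup>2 = 1" using assms(2) by (metis cmod_power2 one_power2)
  have "(norm (ph v z \<psi>))\<^sup>2 = (norm \<psi>)\<^sup>2 + (cmod ((z - 1) * c))\<^sup>2 + 2 * Re (cnj ((z - 1) * c) * c)"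
    unfolding ph_def norm_add_sq cinner_scaleC_right c_def by (simp add: norm_scaleC True)
  also have "Re (cnj ((z - 1) * c) * c) = (Re z - 1) * (cmod c)\<^sup>2"
    unfolding cmod_power2 by (simp add: algebra_simps power2_eq_square)
  also have "(cmod ((z - 1) * c))\<^sup>2 = ((Re z)\<^sup>2 + (Im z)\<^sup>2 - 2 * Re z + 1) * (cmod c)\<^sup>2"
    by (simp add: norm_mult power_mult_distrib cmod_power2) (simp add: power2_eq_square algebra_simps)
  finally have "(norm (ph v z \<psi>))\<^sup>2 = (norm \<psi>)\<^sup>2 + ((Re z)\<^sup>2 + (Im z)\<^sup>2 - 1) * (cmod c)\<^sup>2"
    by (simp add: algebra_simps)
  then have "(norm (ph v z \<psi>))\<^sup>2 = (norm \<psi>)\<^sup>2" by (simp add: z)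
  then show ?thesis by simp
qed (use assms in auto)

lemma ph_isom:
  assumes "csubspace V" "v \<in> V" "norm v = 0 \<or> norm v = 1" "cmod z = 1"
  shows "isom_on V (ph v z)"
  using assms by (auto simp: isom_on_def ph_lin ph_norm)

lemma ph_near:
  assumes "norm v = 0 \<or> norm v = 1"
  shows "norm (ph v z \<psi> - \<psi>) \<le> cmod (z - 1) * norm \<psi>"
proof -
  have "cmod (cinner \<psi> v) * norm v \<le> norm \<psi>"
    using assms cinner_cauchy_schwarz[of \<psi> v] by auto
  then show ?thesis
    by (simp add: ph_def norm_scaleC norm_mult mult_left_mono mult.assoc)
qed

text \<open>The Taylor remainder of the exponential carries the factor exp |Re|, which is 1 on the
  imaginary axis; hence the bound is global in \<open>t\<close>.\<close>

lemma cmod_cis_minus_1_le: "cmod (cis t - 1) \<le> \<bar>t\<bar>"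
proof -
  have "norm (exp (\<i> * complex_of_real t) - (\<Sum>k\<le>0. (\<i> * complex_of_real t) ^ k / fact k)) \<le>
       exp \<bar>Re (\<i> * complex_of_real t)\<bar> * (norm (\<i> * complex_of_real t)) ^ Suc 0 / fact 0"
    by (rule Taylor_exp)
  then show ?thesis by (simp add: cis_conv_exp norm_mult)
qed

lemma cmod_cis_minus_linear_le: "cmod (cis t - 1 - \<i> * t) \<le> t\<^sup>2"
proof -
  have "norm (exp (\<i> * complex_of_real t) - (\<Sum>k\<le>1. (\<i> * complex_of_real t) ^ k / fact k)) \<le>
       exp \<bar>Re (\<i> * complex_of_real t)\<bar> * (norm (\<i> * complex_of_real t)) ^ Suc 1 / fact 1"
    by (rule Taylor_exp)
  then show ?thesis by (simp add: cis_conv_exp norm_mult power2_eq_square diff_diff_eq norm_power power_mult_distrib)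
qed

text \<open>The phases on \<open>v\<close> form a group with generator i |v><v|; this is its
  second-order estimate at 0.\<close>

lemma ph_linear_approx:
  assumes "norm v = 0 \<or> norm v = 1"
  shows "norm (ph v (cis t) \<psi> - \<psi> - (\<i> * t * cinner \<psi> v) *\<^sub>C v) \<le> t\<^sup>2 * norm \<psi>"
proof -
  have "ph v (cis t) \<psi> - \<psi> - (\<i> * t * cinner \<psi> v) *\<^sub>C v = ((cis t - 1 - \<i> * t) * cinner \<psi> v) *\<^sub>C v"
    by (simp add: ph_def algebra_simps flip: scaleC_diff_left)
  moreover have "cmod (cinner \<psi> v) * norm v \<le> norm \<psi>"
    using assms cinner_cauchy_schwarz[of \<psi> v] by auto
  then have "cmod (cis t - 1 - \<i> * t) * (cmod (cinner \<psi> v) * norm v) \<le> t\<^sup>2 * norm \<psi>"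
    by (intro mult_mono cmod_cis_minus_linear_le) auto
  ultimately show ?thesis by (simp add: norm_scaleC norm_mult mult.assoc)
qed

subsection \<open>Expansions in a Hilbert basis\<close>

lemma closure_approx: "x \<in> closure S \<Longrightarrow> \<eta> > 0 \<Longrightarrow> \<exists>y\<in>S. norm (x - y) < (\<eta>::real)"
  by (metis closure_approachable dist_commute dist_norm)

text \<open>For an orthonormal \<open>e\<close> this is the orthogonal projection onto the span of
  the first \<open>M\<close> vectors. Its values are finite combinations, to which unbounded
  operators can be applied.\<close>

definition bproj :: "(nat \<Rightarrow> 'h::complex_inner) \<Rightarrow> nat \<Rightarrow> 'h \<Rightarrow> 'h" where
  "bproj e M \<psi> = (\<Sum>k\<in>{1..M}. cinner \<psi> (e k) *\<^sub>C e k)"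

context
  fixes H :: "'h::complex_inner set" and e :: "nat \<Rightarrow> 'h"
  assumes HS: "hilbert_space H" and HB: "hilbert_basis H e"
begin

lemma hb_subspace: "csubspace H"
  using HS by (simp add: hilbert_space_def)

lemma hb_mem: "k \<ge> 1 \<Longrightarrow> e k \<in> H"
  using HB by (auto simp: hilbert_basis_def)

lemma hb_cinner: "k \<ge> 1 \<Longrightarrow> l \<ge> 1 \<Longrightarrow> cinner (e k) (e l) = (if k = l then 1 else 0)"
  using HB by (auto simp: hilbert_basis_def)

lemma hb_norm: "k \<ge> 1 \<Longrightarrow> norm (e k) = 1"
proof -
  assume "k \<ge> 1"
  then have "complex_of_real ((norm (e k))\<^sup>2) = complex_of_real 1"
    using hb_cinner[of k k] by (simp add: cinner_self)
  then have "(norm (e k))\<^sup>2 = 1" unfolding of_real_eq_iff .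
  then show ?thesis using norm_ge_zero[of "e k"] by (simp add: power2_eq_1_iff)
qed

lemma hb_span_subset: "cspan (e ` {1..}) \<subseteq> H"
  using hb_mem by (intro complex_vector.span_minimal hb_subspace) auto

lemma hb_span_mem: "k \<ge> 1 \<Longrightarrow> e k \<in> cspan (e ` {1..})"
  by (auto intro: complex_vector.span_base)

lemma bproj_span: "bproj e M \<psi> \<in> cspan (e ` {1..M})"
  unfolding bproj_def
  by (intro complex_vector.span_sum complex_vector.span_scale complex_vector.span_base) auto

lemma bproj_in_F: "bproj e M \<psi> \<in> cspan (e ` {1..})"
proof -
  have "e ` {1..M} \<subseteq> e ` {1..}" by auto
  from complex_vector.span_mono[OF this] show ?thesis using bproj_span[of M \<psi>] by blast
qed

lemma bproj_in_H: "bproj e M \<psi> \<in> H"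
  using bproj_in_F hb_span_subset by blast

lemma bproj_cinner: "l \<ge> 1 \<Longrightarrow> cinner (bproj e M \<psi>) (e l) = (if l \<le> M then cinner \<psi> (e l) else 0)"
proof -
  assume l: "l \<ge> 1"
  have "cinner (bproj e M \<psi>) (e l) = (\<Sum>k\<in>{1..M}. if k = l then cinner \<psi> (e l) else 0)"
    unfolding bproj_def cinner_sum_left
    using l by (intro sum.cong) (auto simp: cinner_scaleC_left hb_cinner)
  then show ?thesis using l by simp
qed

lemma bproj_lin: "lin_into V H (bproj e M)"
  using bproj_in_H
  by (auto simp: lin_into_def linear_map_on_def bproj_def cinner_add_left scaleC_add_left
      cinner_scaleC_left sum.distrib scaleC_scaleC complex_vector.scale_sum_right)

lemma bproj_fix: "\<psi> \<in> cspan (e ` {1..M}) \<Longrightarrow> bproj e M \<psi> = \<psi>"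
proof (induction rule: complex_vector.span_induct_alt)
  case base
  then show ?case by (simp add: bproj_def)
next
  case (step c x y)
  then obtain k where k: "k \<in> {1..M}" "x = e k" by auto
  have "bproj e M (e k) = (\<Sum>l\<in>{1..M}. if l = k then e l else 0)"
    unfolding bproj_def using k by (intro sum.cong) (auto simp: hb_cinner)
  then have "bproj e M x = x" using k by simp
  then show ?case using step
    by (simp add: lin_into_add[OF bproj_lin[of UNIV]] lin_into_scaleC[OF bproj_lin[of UNIV]])
qed

lemma F_expand:
  assumes "\<psi> \<in> cspan (e ` {1..})"
  obtains M where "\<psi> \<in> cspan (e ` {1..M})"
proof -
  have "\<exists>M. \<psi> \<in> cspan (e ` {1..M})"
    using assms
  proof (induction rule: complex_vector.span_induct_alt)
    case base
    then show ?case by (auto simp: complex_vector.span_zero)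
  next
    case (step c x y)
    then obtain k M where k: "k \<ge> 1" "x = e k" and M: "y \<in> cspan (e ` {1..M})" by auto
    have "e ` {1..M} \<subseteq> e ` {1..max k M}" by auto
    from complex_vector.span_mono[OF this] have "y \<in> cspan (e ` {1..max k M})" using M by blast
    moreover have "x \<in> cspan (e ` {1..max k M})" using k by (auto intro!: complex_vector.span_base)
    ultimately have "c *\<^sub>C x + y \<in> cspan (e ` {1..max k M})"
      by (simp add: complex_vector.span_add complex_vector.span_scale)
    then show ?case by blast
  qed
  then show ?thesis using that by blast
qed

lemma bproj_norm_diff: "norm (\<psi> - bproj e M \<psi>) \<le> norm \<psi>"
proof -
  have "cinner (\<psi> - bproj e M \<psi>) (bproj e M \<psi>) = 0"
  proof -
    have "cinner (\<psi> - bproj e M \<psi>) (e k) = 0" if "k \<in> {1..M}" for k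
      using that by (simp add: cinner_diff_left bproj_cinner)
    then have "cinner (bproj e M \<psi>) (\<psi> - bproj e M \<psi>) = 0"
      by (subst bproj_def)
         (auto simp: cinner_sum_left cinner_scaleC_left cinner_commute[of "e _"] intro!: sum.neutral)
    then show ?thesis by (metis cinner_commute complex_cnj_zero)
  qed
  then have "(norm (\<psi> - bproj e M \<psi> + bproj e M \<psi>))\<^sup>2 = (norm (\<psi> - bproj e M \<psi>))\<^sup>2 + (norm (bproj e M \<psi>))\<^sup>2"
    by (subst norm_add_sq) simp
  then have "(norm (\<psi> - bproj e M \<psi>))\<^sup>2 \<le> (norm \<psi>)\<^sup>2" by simp
  then show ?thesis by simp
qed

text \<open>Take \<open>\<xi>\<close> in the algebraic span near \<open>\<psi>\<close>. Once
  \<open>M\<close> exceeds the indices in \<open>\<xi>\<close>, the remainder of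
  \<open>\<psi>\<close> is that of \<open>\<psi> - \<xi>\<close>, and taking remainders does not
  increase norms.\<close>

lemma bproj_approx:
  assumes "\<psi> \<in> H" "\<eta> > 0"
  obtains K where "\<And>M. M \<ge> K \<Longrightarrow> norm (\<psi> - bproj e M \<psi>) < \<eta>"
proof -
  have "\<psi> \<in> closure (cspan (e ` {1..}))" using assms(1) HB by (auto simp: hilbert_basis_def)
  then obtain \<xi> where \<xi>: "\<xi> \<in> cspan (e ` {1..})" "norm (\<psi> - \<xi>) < \<eta>"
    using closure_approx assms(2) by blast
  obtain K where K: "\<xi> \<in> cspan (e ` {1..K})" using F_expand \<xi>(1) by blast
  have "norm (\<psi> - bproj e M \<psi>) < \<eta>" if "M \<ge> K" for M
  proof -
    have "e ` {1..K} \<subseteq> e ` {1..M}" using that by auto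
    from complex_vector.span_mono[OF this] have "bproj e M \<xi> = \<xi>" using K by (intro bproj_fix) auto
    then have "\<psi> - bproj e M \<psi> = (\<psi> - \<xi>) - bproj e M (\<psi> - \<xi>)"
      by (simp add: lin_into_diff[OF bproj_lin[of UNIV]])
    then have "norm (\<psi> - bproj e M \<psi>) \<le> norm (\<psi> - \<xi>)"
      using bproj_norm_diff[of "\<psi> - \<xi>" M] by (simp only:)
    then show ?thesis using \<xi>(2) by simp
  qed
  then show ?thesis using that by blast
qed

lemma hb_coeff_le: "k \<ge> 1 \<Longrightarrow> cmod (cinner \<psi> (e k)) \<le> norm \<psi>"
  using cinner_cauchy_schwarz[of \<psi> "e k"] by (simp add: hb_norm)

text \<open>A crude bound that sums the moduli of the coefficients, each at most
  \<open>norm \<psi>\<close>. It needs the values of \<open>L\<close> on finitely many basis vectors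
  only, so \<open>L\<close> may be unbounded.\<close>

lemma lin_bproj_bound:
  assumes L: "lin_into (cspan (e ` {1..})) UNIV L"
    and "\<And>k. k \<in> {1..M} \<Longrightarrow> norm (L (e k)) \<le> r"
  shows "norm (L (bproj e M \<psi>)) \<le> M * norm \<psi> * r"
proof -
  \<comment> \<open>For \<open>M = 0\<close> nothing bounds \<open>r\<close> from below, but then
    both sides of the claim vanish.\<close>
  have r: "r \<ge> 0 \<or> M = 0"
    using assms(2)[of M] norm_ge_zero[of "L (e M)"] by (cases M) (auto simp del: norm_ge_zero intro: order_trans)
  have "L (bproj e M \<psi>) = (\<Sum>k\<in>{1..M}. cinner \<psi> (e k) *\<^sub>C L (e k))"
    unfolding bproj_def
    by (rule lin_into_sum[OF L]) (use hb_span_mem in auto)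
  then have "norm (L (bproj e M \<psi>)) \<le> (\<Sum>k\<in>{1..M}. cmod (cinner \<psi> (e k))) * r"
    using norm_sum_scaleC_le[of "{1..M}" "\<lambda>k. L (e k)" r "\<lambda>k. cinner \<psi> (e k)"] assms(2) by simp
  also have "(\<Sum>k\<in>{1..M}. cmod (cinner \<psi> (e k))) \<le> (\<Sum>k\<in>{1..M}. norm \<psi>)"
    by (rule sum_mono) (auto intro: hb_coeff_le)
  then have "(\<Sum>k\<in>{1..M}. cmod (cinner \<psi> (e k))) * r \<le> M * norm \<psi> * r"
    using r by (auto intro: mult_right_mono)
  finally show ?thesis .
qed

text \<open>Once \<open>\<psi>\<close> has fixed a truncation \<open>M\<close>, its tail costs at
  most twice the norm of the tail whatever the isometries are, and its head costs
  \<open>M * norm \<psi>\<close> times the tolerance. The tolerance \<open>1 / Suc K\<close> shrinks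
  with \<open>K\<close>, so one threshold serves all pairs \<open>P\<close>,
  \<open>Q\<close>.\<close>

lemma isom_approx_ext:
  assumes "\<psi> \<in> H" "\<eta> > 0"
  obtains m where "\<And>P Q K. isom_on H P \<Longrightarrow> isom_on H Q \<Longrightarrow> K \<ge> m \<Longrightarrow>
    (\<And>k. k \<in> {1..K} \<Longrightarrow> norm (P (e k) - Q (e k)) \<le> 1 / Suc K) \<Longrightarrow> norm (P \<psi> - Q \<psi>) \<le> \<eta>"
proof -
  obtain M where M: "\<And>M'. M' \<ge> M \<Longrightarrow> norm (\<psi> - bproj e M' \<psi>) < \<eta> / 3"
    using bproj_approx[of \<psi> "\<eta>/3"] assms by auto
  obtain m0 :: nat where m0: "M * norm \<psi> * 3 / \<eta> < m0" using reals_Archimedean2 by blast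
  have "norm (P \<psi> - Q \<psi>) \<le> \<eta>"
    if P: "isom_on H P" and Q: "isom_on H Q" and K: "K \<ge> max M m0"
      and le: "\<And>k. k \<in> {1..K} \<Longrightarrow> norm (P (e k) - Q (e k)) \<le> 1 / Suc K" for P Q K
  proof -
    define L where "L x = P x - Q x" for x
    have LH: "lin_into H H L"
      unfolding L_def using P Q by (intro lin_into_minus_fun isom_lin hb_subspace) auto
    have L: "lin_into (cspan (e ` {1..})) UNIV L"
      using lin_into_subset[OF LH hb_span_subset] by (auto simp: lin_into_def)
    have "norm (L (bproj e M \<psi>)) \<le> M * norm \<psi> * (1 / Suc K)"
      using K le by (intro lin_bproj_bound[OF L]) (auto simp: L_def)
    also have "\<dots> \<le> \<eta> / 3"
    proof -
      have "M * norm \<psi> * 3 / \<eta> \<le> Suc K" using m0 K by linarith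
      then show ?thesis using assms(2) by (simp add: field_simps)
    qed
    finally have 1: "norm (L (bproj e M \<psi>)) \<le> \<eta> / 3" .
    have d: "\<psi> - bproj e M \<psi> \<in> H"
      using assms(1) bproj_in_H hb_subspace by (simp add: complex_vector.subspace_diff)
    have "norm (L (\<psi> - bproj e M \<psi>)) \<le> norm (P (\<psi> - bproj e M \<psi>)) + norm (Q (\<psi> - bproj e M \<psi>))"
      unfolding L_def by (rule norm_triangle_ineq4)
    also have "\<dots> \<le> \<eta>/3 + \<eta>/3" using M[of M] isom_norm[OF P d] isom_norm[OF Q d] by simp
    finally have 2: "norm (L (\<psi> - bproj e M \<psi>)) \<le> \<eta>/3 + \<eta>/3" .
    have "L \<psi> = L (\<psi> - bproj e M \<psi>) + L (bproj e M \<psi>)"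
      using lin_into_add[OF LH d bproj_in_H[of M \<psi>]] by simp
    then have "norm (L \<psi>) \<le> norm (L (\<psi> - bproj e M \<psi>)) + norm (L (bproj e M \<psi>))"
      by (metis norm_triangle_ineq)
    with 1 2 have "norm (L \<psi>) \<le> \<eta>" by linarith
    then show ?thesis by (simp add: L_def)
  qed
  then show ?thesis using that by blast
qed

end

section \<open>Approximate controllability by words\<close>

text \<open>The index \<open>x\<close> stands for a pair (i, j). Generators and eigenvalues are
  absent here: the calculus of words uses only that each piece acts by a unitary group.\<close>

locale controlled_family =
  fixes I :: "'x set"
    and H :: "'x \<Rightarrow> 'h::complex_inner set"
    and e :: "'x \<Rightarrow> nat \<Rightarrow> 'h"
    and W :: "'x \<Rightarrow> real \<Rightarrow> real \<Rightarrow> 'h \<Rightarrow> 'h"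
    and U :: "real set"
  assumes finite_I: "finite I"
    and hs: "\<And>x. x \<in> I \<Longrightarrow> hilbert_space (H x)"
    and hb: "\<And>x. x \<in> I \<Longrightarrow> hilbert_basis (H x) (e x)"
    and W_group: "\<And>x u. x \<in> I \<Longrightarrow> u \<in> U \<Longrightarrow> unitary_group (H x) (W x u)"
begin

text \<open>The algebraic span, without closure: a common dense domain for all the unbounded
  operators.\<close>

definition F :: "'x \<Rightarrow> 'h set" where
  "F x = cspan (e x ` {1..})"

lemma H_sub: "x \<in> I \<Longrightarrow> csubspace (H x)"
  using hb_subspace[OF hs hb] .

lemma F_sub: "csubspace (F x)"
  by (simp add: F_def)

lemma F_H: "x \<in> I \<Longrightarrow> F x \<subseteq> H x"
  using hb_span_subset[OF hs hb] by (simp add: F_def)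

lemma e_H: "x \<in> I \<Longrightarrow> k \<ge> 1 \<Longrightarrow> e x k \<in> H x"
  using hb_mem[OF hs hb] .

lemma e_F: "x \<in> I \<Longrightarrow> k \<ge> 1 \<Longrightarrow> e x k \<in> F x"
  using hb_span_mem[OF hs hb] by (simp add: F_def)

lemma e_norm: "x \<in> I \<Longrightarrow> k \<ge> 1 \<Longrightarrow> norm (e x k) = 1"
  using hb_norm[OF hs hb] .

lemma e_cinner: "x \<in> I \<Longrightarrow> k \<ge> 1 \<Longrightarrow> l \<ge> 1 \<Longrightarrow> cinner (e x k) (e x l) = (if k = l then 1 else 0)"
  using hb_cinner[OF hs hb] .

lemma span_F: "cspan (e x ` {1..K}) \<subseteq> F x"
  unfolding F_def by (rule complex_vector.span_mono) auto

lemma W_isom: "x \<in> I \<Longrightarrow> u \<in> U \<Longrightarrow> isom_on (H x) (W x u t)"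
  using W_group[of x u] by (auto simp: unitary_group_def intro: unitary_imp_isom)

definition adm :: "(real \<times> real) list \<Rightarrow> bool" where
  "adm w \<longleftrightarrow> (\<forall>(\<tau>, v) \<in> set w. \<tau> > 0 \<and> v \<in> U)"

definition dur :: "(real \<times> real) list \<Rightarrow> real" where
  "dur w = sum_list (map fst w)"

definition ev :: "'x \<Rightarrow> (real \<times> real) list \<Rightarrow> 'h \<Rightarrow> 'h" where
  "ev x w = propagator (W x) w (dur w)"

lemma adm_append [simp]: "adm (w @ w') \<longleftrightarrow> adm w \<and> adm w'"
  by (auto simp: adm_def)

lemma adm_Nil [simp]: "adm []"
  by (simp add: adm_def)

lemma dur_append [simp]: "dur (w @ w') = dur w + dur w'"
  by (simp add: dur_def)

lemma dur_Nil [simp]: "dur [] = 0"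
  by (simp add: dur_def)

lemma dur_nonneg: "adm w \<Longrightarrow> 0 \<le> dur w"
  unfolding dur_def adm_def by (rule sum_list_nonneg) force

lemma prop_isom:
  assumes "x \<in> I" "adm w"
  shows "isom_on (H x) (propagator (W x) w t)"
  using assms(2)
proof (induction w arbitrary: t)
  case Nil
  then show ?case using isom_id by (simp add: isom_on_def lin_into_def linear_map_on_def image_subset_iff)
next
  case (Cons a w)
  obtain \<tau> v where a: "a = (\<tau>, v)" by force
  have v: "v \<in> U" and w: "adm w" using Cons.prems by (auto simp: adm_def a)
  show ?case
  proof (cases "t \<le> \<tau>")
    case True
    then have "propagator (W x) (a # w) t = W x v t" by (auto simp: a)
    then show ?thesis using W_isom[OF assms(1) v] by simp
  next
    case False
    then have "propagator (W x) (a # w) t = (\<lambda>\<psi>. propagator (W x) w (t - \<tau>) (W x v \<tau> \<psi>))"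
      by (auto simp: a)
    then show ?thesis using isom_compose[OF W_isom[OF assms(1) v] Cons.IH[OF w]] by simp
  qed
qed

lemma prop_zero:
  assumes "x \<in> I" "adm w" "\<psi> \<in> H x"
  shows "propagator (W x) w 0 \<psi> = \<psi>"
proof (cases w)
  case (Cons a w')
  then obtain \<tau> v where a: "a = (\<tau>, v)" "\<tau> > 0" "v \<in> U" using assms(2) by (cases a) (auto simp: adm_def)
  then show ?thesis using W_group[OF assms(1), of v] assms(3) by (auto simp: Cons unitary_group_def)
qed simp

lemma prop_append:
  assumes "x \<in> I" "adm w" "adm w'" "\<psi> \<in> H x" "0 \<le> t"
  shows "propagator (W x) (w @ w') t \<psi> =
    (if t \<le> dur w then propagator (W x) w t \<psi> else propagator (W x) w' (t - dur w) (ev x w \<psi>))"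
  using assms(2,4,5)
proof (induction w arbitrary: t \<psi>)
  case Nil
  then show ?case using prop_zero[OF assms(1,3)] by (auto simp: ev_def)
next
  case (Cons a w)
  obtain \<tau> v where a: "a = (\<tau>, v)" by force
  have v: "v \<in> U" and w: "adm w" and \<tau>: "\<tau> > 0" using Cons.prems by (auto simp: adm_def a)
  have d: "dur (a # w) = \<tau> + dur w" by (simp add: dur_def a)
  have m: "W x v \<tau> \<psi> \<in> H x" using isom_mem[OF W_isom[OF assms(1) v]] Cons.prems by blast
  \<comment> \<open>If the rest of the word has duration 0, the branch \<open>t \<le> \<tau>\<close>
    of \<open>propagator\<close> is taken at the final time, and \<open>ev x w\<close> has to be
    recognised as the identity.\<close>
  have evC: "ev x (a # w) \<psi> = ev x w (W x v \<tau> \<psi>)"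
  proof (cases "dur w \<le> 0")
    case True
    then have "dur w = 0" using dur_nonneg[OF w] by simp
    then show ?thesis using prop_zero[OF assms(1) w m] by (simp add: ev_def d) (simp add: a)
  qed (simp add: ev_def d, simp add: a)
  show ?case
  proof (cases "t \<le> \<tau>")
    case True
    then show ?thesis using dur_nonneg[OF w] by (simp add: d) (simp add: a)
  next
    case False
    then show ?thesis using Cons.IH[OF w m, of "t - \<tau>"]
      by (simp add: d evC) (simp add: a algebra_simps)
  qed
qed

lemma ev_append:
  assumes "x \<in> I" "adm w" "adm w'" "\<psi> \<in> H x"
  shows "ev x (w @ w') \<psi> = ev x w' (ev x w \<psi>)"
proof -
  have m: "ev x w \<psi> \<in> H x"
    unfolding ev_def using isom_mem[OF prop_isom[OF assms(1,2)] assms(4)] .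
  have "propagator (W x) (w @ w') (dur w + dur w') \<psi> =
    (if dur w + dur w' \<le> dur w then propagator (W x) w (dur w + dur w') \<psi> else
      propagator (W x) w' (dur w + dur w' - dur w) (ev x w \<psi>))"
    using dur_nonneg assms by (intro prop_append) auto
  moreover have "dur w' = 0" if "dur w + dur w' \<le> dur w"
    using that dur_nonneg[OF assms(3)] by simp
  ultimately show ?thesis
    using prop_zero[OF assms(1,3) m] by (auto simp: ev_def)
qed

lemma ev_isom: "x \<in> I \<Longrightarrow> adm w \<Longrightarrow> isom_on (H x) (ev x w)"
  unfolding ev_def by (rule prop_isom)

lemma ev_Nil [simp]: "ev x [] \<psi> = \<psi>"
  by (simp add: ev_def)

subsection \<open>Deviation modulo diagonal phases\<close>

definition near_diag :: "real \<Rightarrow> 'x \<Rightarrow> nat \<Rightarrow> 'h \<Rightarrow> bool" where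
  "near_diag \<rho> x k \<psi> \<longleftrightarrow> (\<exists>z. cmod z = 1 \<and> norm (\<psi> - z *\<^sub>C e x k) \<le> \<rho>)"

text \<open>The free evolution moves basis vectors only by phases, so it does not contribute to \<open>\<rho>\<close>;
  the phase may depend on the system, on the basis vector and on the time.\<close>

definition ctrl :: "(real \<times> real) list \<Rightarrow> real \<Rightarrow> nat \<Rightarrow> bool" where
  "ctrl w \<rho> K \<longleftrightarrow>
     (\<forall>t\<in>{0..dur w}. \<forall>x\<in>I. \<forall>k\<in>{1..K}. near_diag \<rho> x k (propagator (W x) w t (e x k)))"

lemma near_diag_mono: "near_diag \<rho> x k \<psi> \<Longrightarrow> \<rho> \<le> \<rho>' \<Longrightarrow> near_diag \<rho>' x k \<psi>"
  unfolding near_diag_def using order_trans by blast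

lemma near_diagI: "norm (\<psi> - e x k) \<le> \<rho> \<Longrightarrow> near_diag \<rho> x k \<psi>"
  unfolding near_diag_def by (rule exI[of _ 1]) simp

lemma ctrl_mono: "ctrl w \<rho> K \<Longrightarrow> \<rho> \<le> \<rho>' \<Longrightarrow> K' \<le> K \<Longrightarrow> ctrl w \<rho>' K'"
  unfolding ctrl_def by (meson atLeastAtMost_iff near_diag_mono order_trans)

lemma ctrl_Nil: "\<rho> \<ge> 0 \<Longrightarrow> ctrl [] \<rho> K"
  by (auto simp: ctrl_def intro: near_diagI)

lemma ctrl_ev: "ctrl w \<rho> K \<Longrightarrow> adm w \<Longrightarrow> x \<in> I \<Longrightarrow> k \<in> {1..K} \<Longrightarrow> near_diag \<rho> x k (ev x w (e x k))"
  using dur_nonneg[of w] by (auto simp: ctrl_def ev_def)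

text \<open>By linearity the phases \<open>z\<close> and \<open>z'\<close> multiply, and the
  isometry carries the error \<open>\<sigma>\<close> over unchanged.\<close>

lemma near_diag_isom:
  assumes x: "x \<in> I" and P: "isom_on (H x) P" and k: "k \<ge> 1" and \<psi>: "\<psi> \<in> H x"
    and 1: "near_diag \<sigma> x k \<psi>" and 2: "near_diag \<rho> x k (P (e x k))"
  shows "near_diag (\<sigma> + \<rho>) x k (P \<psi>)"
proof -
  obtain z where z: "cmod z = 1" "norm (\<psi> - z *\<^sub>C e x k) \<le> \<sigma>"
    using 1 by (auto simp: near_diag_def)
  obtain z' where z': "cmod z' = 1" "norm (P (e x k) - z' *\<^sub>C e x k) \<le> \<rho>"
    using 2 by (auto simp: near_diag_def)
  have ek: "e x k \<in> H x" using e_H x k by blast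
  have "norm (P \<psi> - P (z *\<^sub>C e x k)) \<le> \<sigma>"
    using z(2) ek \<psi> x by (subst isom_dist[OF P]) (auto simp: H_sub complex_vector.subspace_scale)
  moreover have "P (z *\<^sub>C e x k) - (z * z') *\<^sub>C e x k = z *\<^sub>C (P (e x k) - z' *\<^sub>C e x k)"
    using lin_into_scaleC[OF isom_lin[OF P] ek] by (simp add: scaleC_diff_right scaleC_scaleC)
  then have "norm (P (z *\<^sub>C e x k) - (z * z') *\<^sub>C e x k) \<le> \<rho>"
    using z z' by (simp add: norm_scaleC)
  ultimately have "norm (P \<psi> - (z * z') *\<^sub>C e x k) \<le> \<sigma> + \<rho>"
    by (rule norm_diff_triangle_le)
  then show ?thesis using z z' by (auto simp: near_diag_def norm_mult intro!: exI[of _ "z * z'"])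
qed

text \<open>The second word starts from the final deviation \<open>\<sigma>\<close> of the first,
  which may be smaller than the largest excursion \<open>\<rho>\<close> on the way. This distinction
  keeps a long repetition of one word from accumulating excursions.\<close>

lemma ctrl_append_gen:
  assumes "adm w" "adm w'" "ctrl w \<rho> K" "ctrl w' \<rho>' K"
    and "\<And>x k. x \<in> I \<Longrightarrow> k \<in> {1..K} \<Longrightarrow> near_diag \<sigma> x k (ev x w (e x k))"
    and "\<sigma> + \<rho>' \<le> \<rho>"
  shows "ctrl (w @ w') \<rho> K"
  unfolding ctrl_def
proof (intro ballI)
  fix t x k
  assume t: "t \<in> {0..dur (w @ w')}" and x: "x \<in> I" and k: "k \<in> {1..K}"
  have ek: "e x k \<in> H x" using e_H x k by auto
  show "near_diag \<rho> x k (propagator (W x) (w @ w') t (e x k))"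
  proof (cases "t \<le> dur w")
    case True
    then show ?thesis using t x k assms(3) prop_append[OF x assms(1,2) ek, of t] by (auto simp: ctrl_def)
  next
    case False
    then have "t - dur w \<in> {0..dur w'}" using t by auto
    then have "near_diag \<rho>' x k (propagator (W x) w' (t - dur w) (e x k))"
      using assms(4) x k unfolding ctrl_def by blast
    then have "near_diag (\<sigma> + \<rho>') x k (propagator (W x) w' (t - dur w) (ev x w (e x k)))"
      using assms(5)[OF x k] k ek
      by (intro near_diag_isom[OF x prop_isom[OF x assms(2)]] isom_mem[OF ev_isom[OF x assms(1)]]) auto
    then show ?thesis using False t prop_append[OF x assms(1,2) ek, of t] assms(6)
      by (auto intro: near_diag_mono)
  qed
qed

lemma ctrl_append:
  assumes "adm w" "adm w'" "ctrl w \<rho> K" "ctrl w' \<rho>' K" "\<rho>' \<ge> 0"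
  shows "ctrl (w @ w') (\<rho> + \<rho>') K"
  using assms ctrl_mono[OF assms(3), of "\<rho> + \<rho>'" K] ctrl_ev[OF assms(3,1)]
  by (intro ctrl_append_gen[where \<rho>' = \<rho>' and \<sigma> = \<rho>]) auto

subsection \<open>Reachable isometries\<close>

text \<open>The deviation \<open>\<rho>\<close> is a price fixed by \<open>g\<close> before the
  number \<open>K\<close> of basis vectors and the accuracy \<open>\<eta>\<close> are given. That
  order allows \<open>K * \<rho>\<close> to be made small later.\<close>

definition reach :: "('x \<Rightarrow> 'h \<Rightarrow> 'h) \<Rightarrow> real \<Rightarrow> bool" where
  "reach g \<rho> \<longleftrightarrow> \<rho> \<ge> 0 \<and> (\<forall>x\<in>I. isom_on (H x) (g x)) \<and>
     (\<forall>K. \<forall>\<eta>>0. \<exists>w. adm w \<and> ctrl w (\<rho> + \<eta>) K \<and>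
        (\<forall>x\<in>I. \<forall>k\<in>{1..K}. norm (ev x w (e x k) - g x (e x k)) \<le> \<eta>))"

lemma reach_isom: "reach g \<rho> \<Longrightarrow> x \<in> I \<Longrightarrow> isom_on (H x) (g x)"
  by (simp add: reach_def)

lemma isom_approx_ext_finite:
  assumes "\<And>x. x \<in> I \<Longrightarrow> finite (S x)" "\<And>x. x \<in> I \<Longrightarrow> S x \<subseteq> H x" "\<eta> > 0"
  shows "\<exists>m\<ge>K. \<forall>x\<in>I. \<forall>\<psi>\<in>S x. \<forall>P Q. isom_on (H x) P \<longrightarrow> isom_on (H x) Q \<longrightarrow>
    (\<forall>k\<in>{1..m}. norm (P (e x k) - Q (e x k)) \<le> 1 / Suc m) \<longrightarrow> norm (P \<psi> - Q \<psi>) \<le> \<eta>"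
proof -
  have "\<forall>\<^sub>F m in sequentially. \<forall>x\<in>I. \<forall>\<psi>\<in>S x. \<forall>P Q. isom_on (H x) P \<longrightarrow> isom_on (H x) Q \<longrightarrow>
    (\<forall>k\<in>{1..m}. norm (P (e x k) - Q (e x k)) \<le> 1 / Suc m) \<longrightarrow> norm (P \<psi> - Q \<psi>) \<le> \<eta>"
  proof (intro eventually_ball_finite finite_I ballI)
    fix x assume x: "x \<in> I"
    then show "finite (S x)" using assms by blast
    fix \<psi> assume "\<psi> \<in> S x"
    then have "\<psi> \<in> H x" using assms x by blast
    then obtain m where m: "\<And>P Q K. isom_on (H x) P \<Longrightarrow> isom_on (H x) Q \<Longrightarrow> K \<ge> m \<Longrightarrow>
      (\<And>k. k \<in> {1..K} \<Longrightarrow> norm (P (e x k) - Q (e x k)) \<le> 1 / Suc K) \<Longrightarrow> norm (P \<psi> - Q \<psi>) \<le> \<eta>"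
      using isom_approx_ext[OF hs[OF x] hb[OF x]] assms(3) by blast
    show "\<forall>\<^sub>F m in sequentially. \<forall>P Q. isom_on (H x) P \<longrightarrow> isom_on (H x) Q \<longrightarrow>
      (\<forall>k\<in>{1..m}. norm (P (e x k) - Q (e x k)) \<le> 1 / Suc m) \<longrightarrow> norm (P \<psi> - Q \<psi>) \<le> \<eta>"
      unfolding eventually_sequentially using m by blast
  qed
  then obtain m0 where "\<forall>m\<ge>m0. \<forall>x\<in>I. \<forall>\<psi>\<in>S x. \<forall>P Q. isom_on (H x) P \<longrightarrow> isom_on (H x) Q \<longrightarrow>
    (\<forall>k\<in>{1..m}. norm (P (e x k) - Q (e x k)) \<le> 1 / Suc m) \<longrightarrow> norm (P \<psi> - Q \<psi>) \<le> \<eta>"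
    unfolding eventually_sequentially by blast
  then show ?thesis by (meson max.cobounded1 max.cobounded2)
qed

text \<open>Words and targets are isometries, so accuracy on enough basis vectors gives accuracy on
  any finite set of vectors. This lets a word act on vectors that earlier words have already
  moved.\<close>

lemma reach_apply:
  assumes "reach g \<rho>" "\<And>x. x \<in> I \<Longrightarrow> finite (S x)" "\<And>x. x \<in> I \<Longrightarrow> S x \<subseteq> H x" "\<eta> > 0"
  obtains w where "adm w" "ctrl w (\<rho> + \<eta>) K"
    "\<And>x \<psi>. x \<in> I \<Longrightarrow> \<psi> \<in> S x \<Longrightarrow> norm (ev x w \<psi> - g x \<psi>) \<le> \<eta>"
proof -
  obtain m where m: "m \<ge> K" and ext: "\<And>x \<psi> P Q. x \<in> I \<Longrightarrow> \<psi> \<in> S x \<Longrightarrow> isom_on (H x) P \<Longrightarrow>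
    isom_on (H x) Q \<Longrightarrow> (\<forall>k\<in>{1..m}. norm (P (e x k) - Q (e x k)) \<le> 1 / Suc m) \<Longrightarrow> norm (P \<psi> - Q \<psi>) \<le> \<eta>"
    using isom_approx_ext_finite[OF assms(2-4), of K] by blast
  define \<delta> where "\<delta> = min \<eta> (1 / Suc m)"
  have "\<delta> > 0" using assms(4) by (simp add: \<delta>_def)
  then obtain w where w: "adm w" "ctrl w (\<rho> + \<delta>) m"
    "\<And>x k. x \<in> I \<Longrightarrow> k \<in> {1..m} \<Longrightarrow> norm (ev x w (e x k) - g x (e x k)) \<le> \<delta>"
    using assms(1) unfolding reach_def by blast
  have "norm (ev x w \<psi> - g x \<psi>) \<le> \<eta>" if "x \<in> I" "\<psi> \<in> S x" for x \<psi>
  proof (rule ext[OF that ev_isom[OF that(1) w(1)] reach_isom[OF assms(1) that(1)]], intro ballI)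
    fix k assume "k \<in> {1..m}"
    from w(3)[OF that(1) this] show "norm (ev x w (e x k) - g x (e x k)) \<le> 1 / Suc m"
      by (simp add: \<delta>_def)
  qed
  moreover have "ctrl w (\<rho> + \<eta>) K" using ctrl_mono[OF w(2)] m by (simp add: \<delta>_def)
  ultimately show ?thesis using that w(1) by blast
qed

lemma reach_compose:
  assumes g: "reach g \<rho>" and g': "reach g' \<rho>'"
  shows "reach (\<lambda>x \<psi>. g' x (g x \<psi>)) (\<rho> + \<rho>')"
  unfolding reach_def
proof (intro conjI ballI allI impI)
  show "0 \<le> \<rho> + \<rho>'" using assms by (simp add: reach_def)
  show "isom_on (H x) (\<lambda>\<psi>. g' x (g x \<psi>))" if "x \<in> I" for x
    using isom_compose[OF reach_isom[OF g that] reach_isom[OF g' that]] .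
  fix K and \<eta> :: real assume \<eta>: "\<eta> > 0"
  have e2: "\<eta>/2 > 0" using \<eta> by simp
  obtain w where w: "adm w" "ctrl w (\<rho> + \<eta>/2) K"
    "\<And>x k. x \<in> I \<Longrightarrow> k \<in> {1..K} \<Longrightarrow> norm (ev x w (e x k) - g x (e x k)) \<le> \<eta>/2"
    using g e2 unfolding reach_def by blast
  \<comment> \<open>The second word must be accurate on the images \<open>g x (e x k)\<close>, which
    in general are not basis vectors.\<close>
  have "(\<lambda>k. g x (e x k)) ` {1..K} \<subseteq> H x" if "x \<in> I" for x
    using isom_mem[OF reach_isom[OF g that]] e_H that by auto
  then obtain w' where w': "adm w'" "ctrl w' (\<rho>' + \<eta>/2) K"
    "\<And>x \<psi>. x \<in> I \<Longrightarrow> \<psi> \<in> (\<lambda>k. g x (e x k)) ` {1..K} \<Longrightarrow> norm (ev x w' \<psi> - g' x \<psi>) \<le> \<eta>/2"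
    using reach_apply[OF g' _ _ e2, of "\<lambda>x. (\<lambda>k. g x (e x k)) ` {1..K}" K] by blast
  have "ctrl (w @ w') (\<rho> + \<eta>/2 + (\<rho>' + \<eta>/2)) K"
    using g' \<eta> by (intro ctrl_append w w') (auto simp: reach_def)
  then have "ctrl (w @ w') (\<rho> + \<rho>' + \<eta>) K" by (simp add: algebra_simps)
  moreover have "norm (ev x (w @ w') (e x k) - g' x (g x (e x k))) \<le> \<eta>"
    if x: "x \<in> I" and k: "k \<in> {1..K}" for x k
  proof -
    have ek: "e x k \<in> H x" using e_H x k by auto
    have "norm (ev x w' (ev x w (e x k)) - ev x w' (g x (e x k))) \<le> \<eta>/2"
      using w(3)[OF x k] isom_mem[OF ev_isom[OF x w(1)] ek] isom_mem[OF reach_isom[OF g x] ek]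
      by (subst isom_dist[OF ev_isom[OF x w'(1)] H_sub[OF x]]) auto
    moreover have "norm (ev x w' (g x (e x k)) - g' x (g x (e x k))) \<le> \<eta>/2"
      using w'(3)[OF x] k by blast
    ultimately have "norm (ev x w' (ev x w (e x k)) - g' x (g x (e x k))) \<le> \<eta>/2 + \<eta>/2"
      by (rule norm_diff_triangle_le)
    then show ?thesis using ev_append[OF x w(1) w'(1) ek] by simp
  qed
  ultimately show "\<exists>w. adm w \<and> ctrl w (\<rho> + \<rho>' + \<eta>) K \<and>
     (\<forall>x\<in>I. \<forall>k\<in>{1..K}. norm (ev x w (e x k) - g' x (g x (e x k))) \<le> \<eta>)"
    using w(1) w'(1) by (intro exI[of _ "w @ w'"]) auto
qed

lemma reach_limit:
  assumes "\<rho> \<ge> 0" and iso: "\<And>x. x \<in> I \<Longrightarrow> isom_on (H x) (g x)"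
    and lim: "\<And>K \<eta>. \<eta> > 0 \<Longrightarrow> \<exists>g' \<rho>'. reach g' \<rho>' \<and> \<rho>' \<le> \<rho> + \<eta> \<and>
      (\<forall>x\<in>I. \<forall>k\<in>{1..K}. norm (g' x (e x k) - g x (e x k)) \<le> \<eta>)"
  shows "reach g \<rho>"
  unfolding reach_def
proof (intro conjI ballI allI impI assms(1) iso)
  fix K and \<eta> :: real assume \<eta>: "\<eta> > 0"
  then have e2: "\<eta>/2 > 0" by simp
  obtain g' \<rho>' where g': "reach g' \<rho>'" "\<rho>' \<le> \<rho> + \<eta>/2"
    "\<And>x k. x \<in> I \<Longrightarrow> k \<in> {1..K} \<Longrightarrow> norm (g' x (e x k) - g x (e x k)) \<le> \<eta>/2"
    using lim[OF e2, of K] by blast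
  obtain w where w: "adm w" "ctrl w (\<rho>' + \<eta>/2) K"
    "\<And>x k. x \<in> I \<Longrightarrow> k \<in> {1..K} \<Longrightarrow> norm (ev x w (e x k) - g' x (e x k)) \<le> \<eta>/2"
    using g'(1) e2 unfolding reach_def by blast
  have "norm (ev x w (e x k) - g x (e x k)) \<le> \<eta>" if "x \<in> I" "k \<in> {1..K}" for x k
    using norm_diff_triangle_le[OF w(3)[OF that] g'(3)[OF that]] by simp
  moreover have "ctrl w (\<rho> + \<eta>) K" using ctrl_mono[OF w(2), of "\<rho> + \<eta>" K] g'(2) by simp
  ultimately show "\<exists>w. adm w \<and> ctrl w (\<rho> + \<eta>) K \<and>
     (\<forall>x\<in>I. \<forall>k\<in>{1..K}. norm (ev x w (e x k) - g x (e x k)) \<le> \<eta>)"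
    using w(1) by blast
qed

lemma reach_mono: "reach g \<rho> \<Longrightarrow> \<rho> \<le> \<rho>' \<Longrightarrow> reach g \<rho>'"
  by (rule reach_limit) (auto simp: reach_def intro!: exI[of _ g] exI[of _ \<rho>])

lemma reach_cong:
  assumes "reach g \<rho>" "\<And>x \<psi>. x \<in> I \<Longrightarrow> \<psi> \<in> H x \<Longrightarrow> g' x \<psi> = g x \<psi>"
  shows "reach g' \<rho>"
proof -
  have iso: "isom_on (H x) (g' x)" if "x \<in> I" for x
    using reach_isom[OF assms(1) that] assms(2)[OF that] H_sub[OF that]
    by (auto simp: isom_on_def lin_into_def linear_map_on_def complex_vector.subspace_add
        complex_vector.subspace_scale image_subset_iff)
  have "g' x (e x k) = g x (e x k)" if "x \<in> I" "k \<in> {1..K}" for x k K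
    using assms(2)[OF that(1) e_H] that by auto
  then show ?thesis
    using assms(1) iso by (intro reach_limit) (auto simp: reach_def intro!: exI[of _ g] exI[of _ \<rho>])
qed

lemma reach_id: "reach (\<lambda>x \<psi>. \<psi>) 0"
  unfolding reach_def using isom_id by (auto intro!: exI[of _ "[]"] ctrl_Nil)

subsection \<open>Infinitesimally achievable directions\<close>

text \<open>The increment along the word is of order \<open>\<tau>\<close>, but the excursion \<open>\<rho>\<close> on the way need not be.\<close>

definition ach :: "('x \<Rightarrow> 'h \<Rightarrow> 'h) \<Rightarrow> real \<Rightarrow> bool" where
  "ach M \<rho> \<longleftrightarrow> \<rho> \<ge> 0 \<and> (\<forall>x\<in>I. lin_into (F x) (H x) (M x)) \<and>
     (\<forall>K. \<forall>\<eta>>0. \<exists>\<tau>0>0. \<forall>\<tau>\<in>{0<..\<tau>0}. \<exists>w. adm w \<and> ctrl w (\<rho> + \<eta>) K \<and>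
        (\<forall>x\<in>I. \<forall>k\<in>{1..K}. norm (ev x w (e x k) - e x k - \<tau> *\<^sub>R M x (e x k)) \<le> \<eta> * \<tau>))"

lemma ach_lin: "ach M \<rho> \<Longrightarrow> x \<in> I \<Longrightarrow> lin_into (F x) (H x) (M x)"
  by (simp add: ach_def)

lemma ach_nonneg: "ach M \<rho> \<Longrightarrow> \<rho> \<ge> 0"
  by (simp add: ach_def)

lemma achE:
  assumes "ach M \<rho>" "\<eta> > 0"
  obtains \<tau>0 where "\<tau>0 > 0" "\<And>\<tau>. 0 < \<tau> \<Longrightarrow> \<tau> \<le> \<tau>0 \<Longrightarrow> \<exists>w. adm w \<and> ctrl w (\<rho> + \<eta>) K \<and>
    (\<forall>x\<in>I. \<forall>k\<in>{1..K}. norm (ev x w (e x k) - e x k - \<tau> *\<^sub>R M x (e x k)) \<le> \<eta> * \<tau>)"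
proof -
  have "\<exists>\<tau>0>0. \<forall>\<tau>\<in>{0<..\<tau>0}. \<exists>w. adm w \<and> ctrl w (\<rho> + \<eta>) K \<and>
        (\<forall>x\<in>I. \<forall>k\<in>{1..K}. norm (ev x w (e x k) - e x k - \<tau> *\<^sub>R M x (e x k)) \<le> \<eta> * \<tau>)"
    using assms unfolding ach_def by blast
  then show ?thesis using that by auto
qed

text \<open>The number \<open>m\<close> plays two roles, as the number of basis vectors tested and
  as the constant in the bound. Both requirements hold for all large \<open>m\<close>, hence jointly
  for finitely many vectors.\<close>

lemma F_lin_bound_finite:
  assumes "\<And>x. x \<in> I \<Longrightarrow> finite (S x)" "\<And>x. x \<in> I \<Longrightarrow> S x \<subseteq> F x"
  shows "\<exists>m\<ge>K. \<forall>x\<in>I. \<forall>\<psi>\<in>S x. \<forall>L r. lin_into (F x) UNIV L \<longrightarrow> r \<ge> 0 \<longrightarrow>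
    (\<forall>k\<in>{1..m}. norm (L (e x k)) \<le> r) \<longrightarrow> norm (L \<psi>) \<le> real m * r"
proof -
  have "\<forall>\<^sub>F m in sequentially. \<forall>x\<in>I. \<forall>\<psi>\<in>S x. \<forall>L r. lin_into (F x) UNIV L \<longrightarrow> r \<ge> 0 \<longrightarrow>
    (\<forall>k\<in>{1..m}. norm (L (e x k)) \<le> r) \<longrightarrow> norm (L \<psi>) \<le> real m * r"
  proof (intro eventually_ball_finite finite_I ballI)
    fix x assume x: "x \<in> I"
    then show "finite (S x)" using assms by blast
    fix \<psi> assume "\<psi> \<in> S x"
    then have "\<psi> \<in> F x" using assms x by blast
    then obtain M where M: "\<psi> \<in> cspan (e x ` {1..M})"
      using F_expand[OF hs[OF x] hb[OF x]] unfolding F_def by blast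
    obtain m0 :: nat where m0: "M * norm \<psi> \<le> m0" using real_arch_simple by blast
    have "norm (L \<psi>) \<le> real m * r" if m: "m \<ge> max M m0" and L: "lin_into (F x) UNIV L" and r: "r \<ge> 0"
      and le: "\<forall>k\<in>{1..m}. norm (L (e x k)) \<le> r" for m L r
    proof -
      have "norm (L (bproj (e x) M \<psi>)) \<le> M * norm \<psi> * r"
        using L le m unfolding F_def by (intro lin_bproj_bound[OF hs[OF x] hb[OF x]]) auto
      also have "\<dots> \<le> real m * r" using m0 m r by (intro mult_right_mono) auto
      finally show ?thesis using bproj_fix[OF hs[OF x] hb[OF x] M] by simp
    qed
    then show "\<forall>\<^sub>F m in sequentially. \<forall>L r. lin_into (F x) UNIV L \<longrightarrow> r \<ge> 0 \<longrightarrow>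
      (\<forall>k\<in>{1..m}. norm (L (e x k)) \<le> r) \<longrightarrow> norm (L \<psi>) \<le> real m * r"
      unfolding eventually_sequentially by blast
  qed
  then obtain m0 where "\<forall>m\<ge>m0. \<forall>x\<in>I. \<forall>\<psi>\<in>S x. \<forall>L r. lin_into (F x) UNIV L \<longrightarrow> r \<ge> 0 \<longrightarrow>
    (\<forall>k\<in>{1..m}. norm (L (e x k)) \<le> r) \<longrightarrow> norm (L \<psi>) \<le> real m * r"
    unfolding eventually_sequentially by blast
  then show ?thesis by (meson max.cobounded1 max.cobounded2)
qed

lemma first_order_lin:
  assumes "x \<in> I" "isom_on (H x) P" "lin_into (F x) (H x) (M x)"
  shows "lin_into (F x) UNIV (\<lambda>\<psi>. P \<psi> - \<psi> - \<tau> *\<^sub>R M x \<psi>)"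
proof -
  have "lin_into (F x) UNIV P" "lin_into (F x) UNIV (M x)"
    using lin_into_subset[OF isom_lin[OF assms(2)] F_H[OF assms(1)]] assms(3) by (auto simp: lin_into_def)
  then show ?thesis
    by (intro lin_into_minus_fun lin_into_smult lin_into_id) auto
qed

lemma ach_apply:
  assumes "ach M \<rho>" "\<And>x. x \<in> I \<Longrightarrow> finite (S x)" "\<And>x. x \<in> I \<Longrightarrow> S x \<subseteq> F x" "\<eta> > 0"
  obtains \<tau>0 where "\<tau>0 > 0" "\<And>\<tau>. 0 < \<tau> \<Longrightarrow> \<tau> \<le> \<tau>0 \<Longrightarrow> \<exists>w. adm w \<and> ctrl w (\<rho> + \<eta>) K \<and>
    (\<forall>x\<in>I. \<forall>\<psi>\<in>S x. norm (ev x w \<psi> - \<psi> - \<tau> *\<^sub>R M x \<psi>) \<le> \<eta> * \<tau>)"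
proof -
  obtain m where m: "m \<ge> K" and ext: "\<And>x \<psi> L r. x \<in> I \<Longrightarrow> \<psi> \<in> S x \<Longrightarrow> lin_into (F x) UNIV L \<Longrightarrow> r \<ge> 0 \<Longrightarrow>
    (\<forall>k\<in>{1..m}. norm (L (e x k)) \<le> r) \<Longrightarrow> norm (L \<psi>) \<le> real m * r"
    using F_lin_bound_finite[OF assms(2,3), of K] by blast
  \<comment> \<open>Compensates the factor \<open>m\<close> lost when passing from basis vectors to
    the vectors of \<open>S x\<close>.\<close>
  define \<delta> where "\<delta> = \<eta> / Suc m"
  have \<delta>: "\<delta> > 0" "real m * \<delta> \<le> \<eta>" "\<delta> \<le> \<eta>" using assms(4) by (auto simp: \<delta>_def field_simps)
  obtain \<tau>0 where \<tau>0: "\<tau>0 > 0" and a: "\<And>\<tau>. 0 < \<tau> \<Longrightarrow> \<tau> \<le> \<tau>0 \<Longrightarrow> \<exists>w. adm w \<and> ctrl w (\<rho> + \<delta>) m \<and>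
    (\<forall>x\<in>I. \<forall>k\<in>{1..m}. norm (ev x w (e x k) - e x k - \<tau> *\<^sub>R M x (e x k)) \<le> \<delta> * \<tau>)"
    using achE[OF assms(1) \<delta>(1)] by blast
  have "\<exists>w. adm w \<and> ctrl w (\<rho> + \<eta>) K \<and>
    (\<forall>x\<in>I. \<forall>\<psi>\<in>S x. norm (ev x w \<psi> - \<psi> - \<tau> *\<^sub>R M x \<psi>) \<le> \<eta> * \<tau>)" if \<tau>: "0 < \<tau>" "\<tau> \<le> \<tau>0" for \<tau>
  proof -
    obtain w where w: "adm w" "ctrl w (\<rho> + \<delta>) m"
      "\<forall>x\<in>I. \<forall>k\<in>{1..m}. norm (ev x w (e x k) - e x k - \<tau> *\<^sub>R M x (e x k)) \<le> \<delta> * \<tau>"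
      using a[OF \<tau>] by blast
    have "norm (ev x w \<psi> - \<psi> - \<tau> *\<^sub>R M x \<psi>) \<le> \<eta> * \<tau>" if "x \<in> I" "\<psi> \<in> S x" for x \<psi>
    proof -
      have "norm (ev x w \<psi> - \<psi> - \<tau> *\<^sub>R M x \<psi>) \<le> real m * (\<delta> * \<tau>)"
        using ext[OF that first_order_lin[where M = M, OF that(1) ev_isom[OF that(1) w(1)] ach_lin[OF assms(1) that(1)]]]
          w(3) \<delta> \<tau> that by simp
      also have "\<dots> \<le> \<eta> * \<tau>" using \<delta>(2) \<tau> by simp
      finally show ?thesis .
    qed
    then show ?thesis using w(1) ctrl_mono[OF w(2), of "\<rho> + \<eta>" K] m \<delta>(3) by auto
  qed
  then show ?thesis using that \<tau>0 by blast
qed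

lemma ach_limit:
  assumes "\<rho> \<ge> 0" and lin: "\<And>x. x \<in> I \<Longrightarrow> lin_into (F x) (H x) (M x)"
    and lim: "\<And>K \<eta>. \<eta> > 0 \<Longrightarrow> \<exists>M' \<rho>'. ach M' \<rho>' \<and> \<rho>' \<le> \<rho> + \<eta> \<and>
      (\<forall>x\<in>I. \<forall>k\<in>{1..K}. norm (M' x (e x k) - M x (e x k)) \<le> \<eta>)"
  shows "ach M \<rho>"
  unfolding ach_def
proof (intro conjI allI impI ballI assms(1) lin)
  fix K and \<eta> :: real assume \<eta>: "\<eta> > 0"
  then have e2: "\<eta>/2 > 0" by simp
  obtain M' \<rho>' where M': "ach M' \<rho>'" "\<rho>' \<le> \<rho> + \<eta>/2"
    "\<And>x k. x \<in> I \<Longrightarrow> k \<in> {1..K} \<Longrightarrow> norm (M' x (e x k) - M x (e x k)) \<le> \<eta>/2"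
    using lim[OF e2, of K] by blast
  obtain \<tau>0 where \<tau>0: "\<tau>0 > 0" and a: "\<And>\<tau>. 0 < \<tau> \<Longrightarrow> \<tau> \<le> \<tau>0 \<Longrightarrow> \<exists>w. adm w \<and> ctrl w (\<rho>' + \<eta>/2) K \<and>
    (\<forall>x\<in>I. \<forall>k\<in>{1..K}. norm (ev x w (e x k) - e x k - \<tau> *\<^sub>R M' x (e x k)) \<le> \<eta>/2 * \<tau>)"
    using achE[OF M'(1) e2] by blast
  have "\<exists>w. adm w \<and> ctrl w (\<rho> + \<eta>) K \<and>
    (\<forall>x\<in>I. \<forall>k\<in>{1..K}. norm (ev x w (e x k) - e x k - \<tau> *\<^sub>R M x (e x k)) \<le> \<eta> * \<tau>)"
    if \<tau>: "\<tau> \<in> {0<..\<tau>0}" for \<tau>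
  proof -
    obtain w where w: "adm w" "ctrl w (\<rho>' + \<eta>/2) K"
      "\<forall>x\<in>I. \<forall>k\<in>{1..K}. norm (ev x w (e x k) - e x k - \<tau> *\<^sub>R M' x (e x k)) \<le> \<eta>/2 * \<tau>"
      using a[of \<tau>] \<tau> by auto
    have "norm (ev x w (e x k) - e x k - \<tau> *\<^sub>R M x (e x k)) \<le> \<eta> * \<tau>" if "x \<in> I" "k \<in> {1..K}" for x k
    proof -
      have "norm (ev x w (e x k) - e x k - \<tau> *\<^sub>R M' x (e x k)) \<le> \<eta>/2 * \<tau>"
        using w(3) that by blast
      moreover have "norm (\<tau> *\<^sub>R (M' x (e x k) - M x (e x k))) \<le> \<eta>/2 * \<tau>"
        using M'(3)[OF that] \<tau> by (simp add: mult.commute)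
      moreover have "ev x w (e x k) - e x k - \<tau> *\<^sub>R M x (e x k) =
        (ev x w (e x k) - e x k - \<tau> *\<^sub>R M' x (e x k)) + \<tau> *\<^sub>R (M' x (e x k) - M x (e x k))"
        by (simp add: scaleR_diff_right)
      ultimately have "norm (ev x w (e x k) - e x k - \<tau> *\<^sub>R M x (e x k)) \<le> \<eta>/2 * \<tau> + \<eta>/2 * \<tau>"
        by (metis norm_triangle_mono)
      then show ?thesis by simp
    qed
    moreover have "ctrl w (\<rho> + \<eta>) K" using ctrl_mono[OF w(2), of "\<rho> + \<eta>" K] M'(2) by simp
    ultimately show ?thesis using w(1) by blast
  qed
  then show "\<exists>\<tau>0>0. \<forall>\<tau>\<in>{0<..\<tau>0}. \<exists>w. adm w \<and> ctrl w (\<rho> + \<eta>) K \<and>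
    (\<forall>x\<in>I. \<forall>k\<in>{1..K}. norm (ev x w (e x k) - e x k - \<tau> *\<^sub>R M x (e x k)) \<le> \<eta> * \<tau>)"
    using \<tau>0 by blast
qed

lemma ach_cong:
  assumes "ach M \<rho>" "\<And>x. x \<in> I \<Longrightarrow> lin_into (F x) (H x) (M' x)"
    and "\<And>x k. x \<in> I \<Longrightarrow> k \<ge> 1 \<Longrightarrow> M' x (e x k) = M x (e x k)"
  shows "ach M' \<rho>"
  using assms by (intro ach_limit) (auto simp: ach_nonneg intro!: exI[of _ M] exI[of _ \<rho>])

lemma ach_zero: "ach (\<lambda>x \<psi>. 0) 0"
  unfolding ach_def
  by (auto simp: lin_into_zero_map H_sub ctrl_Nil intro!: exI[of _ 1] exI[of _ "[]"])

text \<open>The word for the step \<open>c * \<tau>\<close> of \<open>M\<close> serves as the word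
  for the step \<open>\<tau>\<close>. Steps are positive, so this gives no reversal of
  direction.\<close>

lemma ach_scale_pos:
  assumes "ach M \<rho>" "c > 0"
  shows "ach (\<lambda>x \<psi>. c *\<^sub>R M x \<psi>) \<rho>"
  unfolding ach_def
proof (intro conjI allI impI ballI)
  show "\<rho> \<ge> 0" using assms(1) by (rule ach_nonneg)
  show "lin_into (F x) (H x) (\<lambda>\<psi>. c *\<^sub>R M x \<psi>)" if "x \<in> I" for x
    by (rule lin_into_smult[OF ach_lin[OF assms(1) that] H_sub[OF that]])
  fix K and \<eta> :: real assume \<eta>: "\<eta> > 0"
  define \<delta> where "\<delta> = min \<eta> (\<eta> / c)"
  have \<delta>: "\<delta> > 0" "\<delta> \<le> \<eta>" "\<delta> * c \<le> \<eta>"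
    using \<eta> assms(2) by (auto simp: \<delta>_def min_def field_simps)
  obtain \<tau>0 where \<tau>0: "\<tau>0 > 0" and a: "\<And>\<tau>. 0 < \<tau> \<Longrightarrow> \<tau> \<le> \<tau>0 \<Longrightarrow> \<exists>w. adm w \<and> ctrl w (\<rho> + \<delta>) K \<and>
    (\<forall>x\<in>I. \<forall>k\<in>{1..K}. norm (ev x w (e x k) - e x k - \<tau> *\<^sub>R M x (e x k)) \<le> \<delta> * \<tau>)"
    using achE[OF assms(1) \<delta>(1)] by blast
  have "\<exists>w. adm w \<and> ctrl w (\<rho> + \<eta>) K \<and>
    (\<forall>x\<in>I. \<forall>k\<in>{1..K}. norm (ev x w (e x k) - e x k - \<tau> *\<^sub>R (c *\<^sub>R M x (e x k))) \<le> \<eta> * \<tau>)"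
    if \<tau>: "\<tau> \<in> {0<..\<tau>0 / c}" for \<tau>
  proof -
    have "0 < c * \<tau>" "c * \<tau> \<le> \<tau>0" using \<tau> assms(2) by (auto simp: field_simps)
    then obtain w where w: "adm w" "ctrl w (\<rho> + \<delta>) K"
      "\<forall>x\<in>I. \<forall>k\<in>{1..K}. norm (ev x w (e x k) - e x k - (c * \<tau>) *\<^sub>R M x (e x k)) \<le> \<delta> * (c * \<tau>)"
      using a by blast
    have "\<delta> * (c * \<tau>) \<le> \<eta> * \<tau>" using \<delta>(3) \<tau> by (simp flip: mult.assoc)
    then show ?thesis using w ctrl_mono[OF w(2), of "\<rho> + \<eta>" K] \<delta>(2)
      by (intro exI[of _ w]) (fastforce simp: mult.commute[of c] intro: order_trans)
  qed
  then show "\<exists>\<tau>0>0. \<forall>\<tau>\<in>{0<..\<tau>0}. \<exists>w. adm w \<and> ctrl w (\<rho> + \<eta>) K \<and>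
    (\<forall>x\<in>I. \<forall>k\<in>{1..K}. norm (ev x w (e x k) - e x k - \<tau> *\<^sub>R (c *\<^sub>R M x (e x k))) \<le> \<eta> * \<tau>)"
    using \<tau>0 assms(2) by (intro exI[of _ "\<tau>0 / c"]) auto
qed

text \<open>The word of \<open>Y\<close> runs first. The cross term asks the word of
  \<open>X\<close> to be close to the identity at \<open>Y x (e x k)\<close>, a vector that may lie
  outside the algebraic span, where \<open>X\<close> is not controlled. Closeness there comes from
  isometry and from closeness on \<open>m\<close> basis vectors.\<close>

lemma ach_add:
  assumes X: "ach X \<rho>" and Y: "ach Y \<sigma>"
  shows "ach (\<lambda>x \<psi>. X x \<psi> + Y x \<psi>) (\<rho> + \<sigma>)"
  unfolding ach_def
proof (intro conjI allI impI ballI)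
  show "0 \<le> \<rho> + \<sigma>" using assms ach_nonneg by (simp add: add_nonneg_nonneg)
  show "lin_into (F x) (H x) (\<lambda>\<psi>. X x \<psi> + Y x \<psi>)" if "x \<in> I" for x
    by (rule lin_into_plus[OF ach_lin[OF X that] ach_lin[OF Y that] H_sub[OF that]])
  fix K and \<eta> :: real assume \<eta>: "\<eta> > 0"
  then have e3: "\<eta>/3 > 0" by simp
  have YH: "(\<lambda>k. Y x (e x k)) ` {1..K} \<subseteq> H x" if "x \<in> I" for x
    using lin_into_mem[OF ach_lin[OF Y that]] e_F[OF that] by auto
  obtain m where m: "m \<ge> K" and ext: "\<And>x k P Q. x \<in> I \<Longrightarrow> k \<in> {1..K} \<Longrightarrow> isom_on (H x) P \<Longrightarrow>
    isom_on (H x) Q \<Longrightarrow> (\<forall>l\<in>{1..m}. norm (P (e x l) - Q (e x l)) \<le> 1 / Suc m) \<Longrightarrow>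
    norm (P (Y x (e x k)) - Q (Y x (e x k))) \<le> \<eta>/3"
    using isom_approx_ext_finite[of "\<lambda>x. (\<lambda>k. Y x (e x k)) ` {1..K}" "\<eta>/3" K] YH e3 by blast
  define B where "B = 1 + (\<Sum>x\<in>I. \<Sum>k\<in>{1..m}. norm (X x (e x k)))"
  have B1: "B \<ge> 1" by (simp add: B_def sum_nonneg)
  have B: "norm (X x (e x k)) \<le> B" if "x \<in> I" "k \<in> {1..m}" for x k
  proof -
    have "norm (X x (e x k)) \<le> (\<Sum>k\<in>{1..m}. norm (X x (e x k)))"
      using that by (intro member_le_sum) auto
    also have "\<dots> \<le> (\<Sum>x\<in>I. \<Sum>k\<in>{1..m}. norm (X x (e x k)))"
      using that finite_I by (intro member_le_sum[of x I "\<lambda>x. \<Sum>k\<in>{1..m}. norm (X x (e x k))"]) (auto simp: sum_nonneg)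
    finally show ?thesis by (simp add: B_def)
  qed
  obtain \<tau>1 where \<tau>1: "\<tau>1 > 0" and aX: "\<And>\<tau>. 0 < \<tau> \<Longrightarrow> \<tau> \<le> \<tau>1 \<Longrightarrow> \<exists>w. adm w \<and> ctrl w (\<rho> + \<eta>/3) m \<and>
    (\<forall>x\<in>I. \<forall>k\<in>{1..m}. norm (ev x w (e x k) - e x k - \<tau> *\<^sub>R X x (e x k)) \<le> \<eta>/3 * \<tau>)"
    using achE[OF X e3] by blast
  obtain \<tau>2 where \<tau>2: "\<tau>2 > 0" and aY: "\<And>\<tau>. 0 < \<tau> \<Longrightarrow> \<tau> \<le> \<tau>2 \<Longrightarrow> \<exists>w. adm w \<and> ctrl w (\<sigma> + \<eta>/3) K \<and>
    (\<forall>x\<in>I. \<forall>k\<in>{1..K}. norm (ev x w (e x k) - e x k - \<tau> *\<^sub>R Y x (e x k)) \<le> \<eta>/3 * \<tau>)"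
    using achE[OF Y e3] by blast
  \<comment> \<open>For \<open>\<tau> \<le> \<tau>3\<close> the word of \<open>X\<close> moves the
    first \<open>m\<close> basis vectors by at most
    \<open>(\<eta>/3 + B) * \<tau> \<le> 1 / Suc m\<close>, as \<open>ext\<close> demands.\<close>
  define \<tau>3 where "\<tau>3 = 1 / (Suc m * (\<eta>/3 + B))"
  have \<tau>3: "\<tau>3 > 0" using \<eta> B1 by (simp add: \<tau>3_def)
  have "\<exists>w. adm w \<and> ctrl w (\<rho> + \<sigma> + \<eta>) K \<and>
    (\<forall>x\<in>I. \<forall>k\<in>{1..K}. norm (ev x w (e x k) - e x k - \<tau> *\<^sub>R (X x (e x k) + Y x (e x k))) \<le> \<eta> * \<tau>)"
    if \<tau>: "\<tau> \<in> {0<..min \<tau>1 (min \<tau>2 \<tau>3)}" for \<tau>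
  proof -
    have \<tau>p: "\<tau> > 0" and "\<tau> \<le> \<tau>3" using \<tau> by auto
    have c: "\<eta>/3 + B > 0" using \<eta> B1 by simp
    then have "\<tau> * (Suc m * (\<eta>/3 + B)) \<le> 1"
      using \<open>\<tau> \<le> \<tau>3\<close> unfolding \<tau>3_def by (subst (asm) pos_le_divide_eq) auto
    then have small: "(\<eta>/3 + B) * \<tau> \<le> 1 / Suc m"
      by (subst pos_le_divide_eq) (auto simp: mult_ac)
    obtain wX where wX: "adm wX" "ctrl wX (\<rho> + \<eta>/3) m"
      "\<And>x k. x\<in>I \<Longrightarrow> k\<in>{1..m} \<Longrightarrow> norm (ev x wX (e x k) - e x k - \<tau> *\<^sub>R X x (e x k)) \<le> \<eta>/3 * \<tau>"
      using aX[of \<tau>] \<tau> by auto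
    obtain wY where wY: "adm wY" "ctrl wY (\<sigma> + \<eta>/3) K"
      "\<And>x k. x\<in>I \<Longrightarrow> k\<in>{1..K} \<Longrightarrow> norm (ev x wY (e x k) - e x k - \<tau> *\<^sub>R Y x (e x k)) \<le> \<eta>/3 * \<tau>"
      using aY[of \<tau>] \<tau> by auto
    have est: "norm (ev x (wY @ wX) (e x k) - e x k - \<tau> *\<^sub>R (X x (e x k) + Y x (e x k))) \<le> \<eta> * \<tau>"
      if x: "x \<in> I" and k: "k \<in> {1..K}" for x k
    proof -
      let ?P = "ev x wX" and ?a = "e x k" and ?y = "Y x (e x k)" and ?b = "ev x wY (e x k)"
      have P: "isom_on (H x) ?P" by (rule ev_isom[OF x wX(1)])
      have a: "?a \<in> H x" using e_H x k by auto
      have y: "?y \<in> H x" using YH[OF x] k by auto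
      have b: "?b \<in> H x" using isom_mem[OF ev_isom[OF x wY(1)] a] .
      have ay: "?a + \<tau> *\<^sub>R ?y \<in> H x"
        using a y H_sub[OF x] by (simp add: complex_vector.subspace_add csubspace_scaleR)
      have Pay: "?P (?a + \<tau> *\<^sub>R ?y) = ?P ?a + \<tau> *\<^sub>R ?P ?y"
        using a y H_sub[OF x]
        by (simp add: lin_into_add[OF isom_lin[OF P]] lin_into_scaleR[OF isom_lin[OF P]] csubspace_scaleR)
      have "norm (?P ?b - ?P (?a + \<tau> *\<^sub>R ?y)) \<le> \<eta>/3 * \<tau>"
        using wY(3)[OF x k] by (subst isom_dist[OF P H_sub[OF x] b ay]) (simp add: diff_diff_eq)
      moreover have "norm (?P ?a - ?a - \<tau> *\<^sub>R X x ?a) \<le> \<eta>/3 * \<tau>"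
        using wX(3)[OF x, of k] k m by auto
      moreover have "norm (?P ?y - ?y) \<le> \<eta>/3"
      proof (rule ext[OF x k P isom_id], intro ballI)
        fix l assume l: "l \<in> {1..m}"
        have "norm (?P (e x l) - e x l) \<le> norm (?P (e x l) - e x l - \<tau> *\<^sub>R X x (e x l)) + norm (\<tau> *\<^sub>R X x (e x l))"
          by (metis add.commute norm_triangle_sub)
        also have "\<dots> \<le> \<eta>/3 * \<tau> + B * \<tau>"
          using wX(3)[OF x l] B[OF x l] \<tau>p by (intro add_mono) (auto simp: mult.commute)
        finally show "norm (?P (e x l) - e x l) \<le> 1 / Suc m" using small by (simp add: algebra_simps)
      qed
      then have "norm (\<tau> *\<^sub>R (?P ?y - ?y)) \<le> \<eta>/3 * \<tau>" using \<tau>p by (simp add: mult.commute)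
      moreover have "ev x (wY @ wX) ?a - ?a - \<tau> *\<^sub>R (X x ?a + ?y) =
         (?P ?b - ?P (?a + \<tau> *\<^sub>R ?y)) + ((?P ?a - ?a - \<tau> *\<^sub>R X x ?a) + \<tau> *\<^sub>R (?P ?y - ?y))"
        unfolding ev_append[OF x wY(1) wX(1) a] Pay by (simp add: algebra_simps)
      ultimately have "norm (ev x (wY @ wX) ?a - ?a - \<tau> *\<^sub>R (X x ?a + ?y)) \<le> \<eta>/3*\<tau> + (\<eta>/3*\<tau> + \<eta>/3*\<tau>)"
        by (metis norm_triangle_mono)
      then show ?thesis by simp
    qed
    have "ctrl (wY @ wX) (\<sigma> + \<eta>/3 + (\<rho> + \<eta>/3)) K"
      using ctrl_mono[OF wX(2) order_refl m] ach_nonneg[OF X] e3 by (intro ctrl_append wX wY) auto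
    then have "ctrl (wY @ wX) (\<rho> + \<sigma> + \<eta>) K" using \<eta> by (rule_tac ctrl_mono) auto
    then show ?thesis using est wX(1) wY(1) by (intro exI[of _ "wY @ wX"]) auto
  qed
  then show "\<exists>\<tau>0>0. \<forall>\<tau>\<in>{0<..\<tau>0}. \<exists>w. adm w \<and> ctrl w (\<rho> + \<sigma> + \<eta>) K \<and>
    (\<forall>x\<in>I. \<forall>k\<in>{1..K}. norm (ev x w (e x k) - e x k - \<tau> *\<^sub>R (X x (e x k) + Y x (e x k))) \<le> \<eta> * \<tau>)"
    using \<tau>1 \<tau>2 \<tau>3 by (intro exI[of _ "min \<tau>1 (min \<tau>2 \<tau>3)"]) auto
qed

text \<open>The words for \<open>g'\<close> and \<open>g\<close> make no small step, yet they have
  to cancel up to a small multiple of \<open>\<tau>\<close>. Their accuracy is therefore chosen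
  after \<open>\<tau>\<close>, which \<open>reach\<close> permits at the fixed deviation
  \<open>\<rho>\<close>. That \<open>g'\<close> preserves the algebraic span makes \<open>M\<close>
  applicable after it.\<close>

lemma ach_conj:
  assumes g: "reach g \<rho>" and g': "reach g' \<rho>" and M: "ach M \<sigma>"
    and inv: "\<And>x \<psi>. x \<in> I \<Longrightarrow> \<psi> \<in> H x \<Longrightarrow> g x (g' x \<psi>) = \<psi>"
    and fin: "\<And>x \<psi>. x \<in> I \<Longrightarrow> \<psi> \<in> F x \<Longrightarrow> g' x \<psi> \<in> F x"
  shows "ach (\<lambda>x \<psi>. g x (M x (g' x \<psi>))) (2 * \<rho> + \<sigma>)"
  unfolding ach_def
proof (intro conjI allI impI ballI)
  have \<rho>0: "\<rho> \<ge> 0" using g by (simp add: reach_def)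
  show "0 \<le> 2 * \<rho> + \<sigma>" using \<rho>0 ach_nonneg[OF M] by simp
  show "lin_into (F x) (H x) (\<lambda>\<psi>. g x (M x (g' x \<psi>)))" if x: "x \<in> I" for x
  proof -
    have "lin_into (F x) (F x) (g' x)"
      using lin_into_subset[OF isom_lin[OF reach_isom[OF g' x]] F_H[OF x]] fin[OF x]
      by (auto simp: lin_into_def)
    then show ?thesis
      by (rule lin_into_compose[OF lin_into_compose[OF _ ach_lin[OF M x]] isom_lin[OF reach_isom[OF g x]]])
  qed
  fix K and \<eta> :: real assume \<eta>: "\<eta> > 0"
  then have e3: "\<eta>/3 > 0" by simp
  define E where "E x = e x ` {1..K}" for x
  define S where "S x = g' x ` E x" for x
  \<comment> \<open>The last word meets both \<open>g' x (e x k)\<close> and the increment that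
    \<open>M\<close> makes there, and must be accurate on each.\<close>
  define S2 where "S2 x = S x \<union> M x ` S x" for x
  have fE: "finite (E x)" "finite (S x)" "finite (S2 x)" for x by (auto simp: E_def S_def S2_def)
  have EF: "E x \<subseteq> F x" if "x \<in> I" for x using e_F that by (auto simp: E_def)
  have SF: "S x \<subseteq> F x" if "x \<in> I" for x using EF fin that by (auto simp: S_def)
  have S2H: "S2 x \<subseteq> H x" if "x \<in> I" for x
    using SF[OF that] F_H[OF that] lin_into_mem[OF ach_lin[OF M that]] by (auto simp: S2_def)
  obtain \<tau>0 where \<tau>0: "\<tau>0 > 0" and a: "\<And>\<tau>. 0 < \<tau> \<Longrightarrow> \<tau> \<le> \<tau>0 \<Longrightarrow> \<exists>w. adm w \<and> ctrl w (\<sigma> + \<eta>/3) K \<and>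
    (\<forall>x\<in>I. \<forall>\<psi>\<in>S x. norm (ev x w \<psi> - \<psi> - \<tau> *\<^sub>R M x \<psi>) \<le> \<eta>/3 * \<tau>)"
    using ach_apply[OF M fE(2) SF e3] by blast
  have "\<exists>w. adm w \<and> ctrl w (2 * \<rho> + \<sigma> + \<eta>) K \<and>
    (\<forall>x\<in>I. \<forall>k\<in>{1..K}. norm (ev x w (e x k) - e x k - \<tau> *\<^sub>R g x (M x (g' x (e x k)))) \<le> \<eta> * \<tau>)"
    if \<tau>: "\<tau> \<in> {0<..\<tau>0}" for \<tau>
  proof -
    have \<tau>p: "\<tau> > 0" using \<tau> by simp
    \<comment> \<open>The multiple of \<open>\<tau>\<close> serves the terms of order 0, which are
      compared with \<open>\<eta> * \<tau>\<close>; the bound \<open>\<eta>/6\<close> suffices for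
      the increment, already multiplied by \<open>\<tau>\<close>, and for the deviation.\<close>
    define \<delta> where "\<delta> = min (\<eta>/6) (\<eta>/6 * \<tau>)"
    have \<delta>: "\<delta> > 0" "\<delta> \<le> \<eta>/6" "\<delta> \<le> \<eta>/6 * \<tau>" using \<eta> \<tau>p by (auto simp: \<delta>_def)
    obtain w where w: "adm w" "ctrl w (\<sigma> + \<eta>/3) K"
      "\<And>x \<psi>. x\<in>I \<Longrightarrow> \<psi>\<in>S x \<Longrightarrow> norm (ev x w \<psi> - \<psi> - \<tau> *\<^sub>R M x \<psi>) \<le> \<eta>/3 * \<tau>"
      using a[of \<tau>] \<tau> by auto
    have EH: "E x \<subseteq> H x" if "x \<in> I" for x using EF F_H that by blast
    obtain q' where q': "adm q'" "ctrl q' (\<rho> + \<delta>) K"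
      "\<And>x \<psi>. x \<in> I \<Longrightarrow> \<psi> \<in> E x \<Longrightarrow> norm (ev x q' \<psi> - g' x \<psi>) \<le> \<delta>"
      using reach_apply[OF g' fE(1) EH \<delta>(1)] by blast
    obtain q where q: "adm q" "ctrl q (\<rho> + \<delta>) K"
      "\<And>x \<psi>. x \<in> I \<Longrightarrow> \<psi> \<in> S2 x \<Longrightarrow> norm (ev x q \<psi> - g x \<psi>) \<le> \<delta>"
      using reach_apply[OF g fE(3) S2H \<delta>(1)] by blast
    have est: "norm (ev x (q' @ w @ q) (e x k) - e x k - \<tau> *\<^sub>R g x (M x (g' x (e x k)))) \<le> \<eta> * \<tau>"
      if x: "x \<in> I" and k: "k \<in> {1..K}" for x k
    proof -
      let ?P = "ev x w" and ?Q = "ev x q" and ?Q' = "ev x q'" and ?a = "e x k"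
      define \<xi> where "\<xi> = g' x ?a"
      define y where "y = M x \<xi>"
      have P: "isom_on (H x) ?P" and Q: "isom_on (H x) ?Q" and Q': "isom_on (H x) ?Q'"
        using ev_isom[OF x] w q q' by auto
      have sub: "csubspace (H x)" by (rule H_sub[OF x])
      have a: "?a \<in> H x" "?a \<in> E x" using e_H x k by (auto simp: E_def)
      have \<xi>S: "\<xi> \<in> S x" using a by (simp add: S_def \<xi>_def)
      have \<xi>: "\<xi> \<in> H x" using isom_mem[OF reach_isom[OF g' x] a(1)] by (simp add: \<xi>_def)
      have y: "y \<in> H x" "y \<in> S2 x" using \<xi>S S2H[OF x] by (auto simp: y_def S2_def)
      have Q'a: "?Q' ?a \<in> H x" by (rule isom_mem[OF Q' a(1)])
      have P\<xi>: "?P \<xi> \<in> H x" by (rule isom_mem[OF P \<xi>])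
      have \<xi>y: "\<xi> + \<tau> *\<^sub>R y \<in> H x"
        using \<xi> y sub by (simp add: complex_vector.subspace_add csubspace_scaleR)
      have 1: "norm (?Q (?P (?Q' ?a)) - ?Q (?P \<xi>)) \<le> \<eta>/6 * \<tau>"
        using q'(3)[OF x a(2)] \<delta>(3)
        by (simp add: isom_dist[OF Q sub isom_mem[OF P Q'a] P\<xi>] isom_dist[OF P sub Q'a \<xi>] flip: \<xi>_def)
      have 2: "norm (?Q (?P \<xi>) - ?Q (\<xi> + \<tau> *\<^sub>R y)) \<le> \<eta>/3 * \<tau>"
        using w(3)[OF x \<xi>S] by (simp add: isom_dist[OF Q sub P\<xi> \<xi>y] diff_diff_eq flip: y_def)
      have Qxy: "?Q (\<xi> + \<tau> *\<^sub>R y) = ?Q \<xi> + \<tau> *\<^sub>R ?Q y"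
        using \<xi> y sub
        by (simp add: lin_into_add[OF isom_lin[OF Q]] lin_into_scaleR[OF isom_lin[OF Q]] csubspace_scaleR)
      have g\<xi>: "g x \<xi> = ?a" using inv[OF x a(1)] by (simp add: \<xi>_def)
      have 3: "norm (?Q \<xi> - ?a) \<le> \<eta>/6 * \<tau>" using q(3)[OF x, of \<xi>] \<xi>S \<delta>(3) g\<xi> by (auto simp: S2_def)
      have "norm (?Q y - g x y) \<le> \<eta>/6" using q(3)[OF x y(2)] \<delta>(2) by simp
      then have 4: "norm (\<tau> *\<^sub>R (?Q y - g x y)) \<le> \<eta>/6 * \<tau>" using \<tau>p by (simp add: mult.commute)
      have "?Q (?P (?Q' ?a)) - ?a - \<tau> *\<^sub>R g x y = (?Q (?P (?Q' ?a)) - ?Q (?P \<xi>)) +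
        ((?Q (?P \<xi>) - ?Q (\<xi> + \<tau> *\<^sub>R y)) + ((?Q \<xi> - ?a) + \<tau> *\<^sub>R (?Q y - g x y)))"
        unfolding Qxy by (simp add: algebra_simps)
      then have "norm (?Q (?P (?Q' ?a)) - ?a - \<tau> *\<^sub>R g x y) \<le> \<eta>/6*\<tau> + (\<eta>/3*\<tau> + (\<eta>/6*\<tau> + \<eta>/6*\<tau>))"
        by (simp only:) (intro norm_triangle_mono 1 2 3 4)
      also have "\<dots> \<le> \<eta> * \<tau>" using \<eta> \<tau>p by simp
      finally show ?thesis
        using ev_append[OF x q'(1), of "w @ q"] ev_append[OF x w(1) q(1) Q'a] w(1) q(1) a(1)
        by (simp add: y_def \<xi>_def)
    qed
    have "ctrl (q' @ w @ q) (\<rho> + \<delta> + ((\<sigma> + \<eta>/3) + (\<rho> + \<delta>))) K"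
      using \<rho>0 ach_nonneg[OF M] \<delta> \<eta> w q q' by (intro ctrl_append) auto
    then have "ctrl (q' @ w @ q) (2 * \<rho> + \<sigma> + \<eta>) K" using \<delta> \<eta> by (rule_tac ctrl_mono) auto
    then show ?thesis using est w(1) q(1) q'(1) by (intro exI[of _ "q' @ w @ q"]) auto
  qed
  then show "\<exists>\<tau>0>0. \<forall>\<tau>\<in>{0<..\<tau>0}. \<exists>w. adm w \<and> ctrl w (2 * \<rho> + \<sigma> + \<eta>) K \<and>
    (\<forall>x\<in>I. \<forall>k\<in>{1..K}. norm (ev x w (e x k) - e x k - \<tau> *\<^sub>R g x (M x (g' x (e x k)))) \<le> \<eta> * \<tau>)"
    using \<tau>0 by blast
qed

end

context controlled_family
begin

subsection \<open>One-parameter groups\<close>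

text \<open>A one-parameter group with bounded generator \<open>X\<close>, with one constant
  \<open>C\<close> for its first-order and second-order estimates. Invariance of the spans from
  \<open>K\<^sub>0\<close> on keeps the orbits of basis vectors in a finite-dimensional space, where
  errors on basis vectors control all errors.\<close>

definition flow :: "('x \<Rightarrow> real \<Rightarrow> 'h \<Rightarrow> 'h) \<Rightarrow> ('x \<Rightarrow> 'h \<Rightarrow> 'h) \<Rightarrow> real \<Rightarrow> nat \<Rightarrow> bool" where
  "flow R X C K\<^sub>0 \<longleftrightarrow> C \<ge> 0 \<and> (\<forall>x\<in>I.
     (\<forall>s. isom_on (H x) (R x s)) \<and>
     (\<forall>s t. \<forall>\<psi>\<in>H x. R x (s + t) \<psi> = R x s (R x t \<psi>)) \<and>
     (\<forall>s. \<forall>\<psi>\<in>H x. norm (R x s \<psi> - \<psi>) \<le> C * \<bar>s\<bar> * norm \<psi>) \<and>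
     (\<forall>s. \<forall>\<psi>\<in>H x. norm (R x s \<psi> - \<psi> - s *\<^sub>R X x \<psi>) \<le> C * s\<^sup>2 * norm \<psi>) \<and>
     (\<forall>K\<ge>K\<^sub>0. \<forall>s. R x s ` cspan (e x ` {1..K}) \<subseteq> cspan (e x ` {1..K})) \<and>
     lin_into (H x) (H x) (X x))"

lemma flow_rev:
  assumes "flow R X C K\<^sub>0"
  shows "flow (\<lambda>x s. R x (- s)) (\<lambda>x \<psi>. - X x \<psi>) C K\<^sub>0"
  unfolding flow_def
proof (intro conjI ballI allI impI)
  show "C \<ge> 0" using assms by (simp add: flow_def)
  fix x assume x: "x \<in> I"
  show "isom_on (H x) (R x (- s))" for s using assms x by (simp add: flow_def)
  show "lin_into (H x) (H x) (\<lambda>\<psi>. - X x \<psi>)"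
    using assms x by (simp add: flow_def lin_into_uminus H_sub)
  show "R x (- s) ` cspan (e x ` {1..K}) \<subseteq> cspan (e x ` {1..K})" if "K \<ge> K\<^sub>0" for K s
    using assms x that unfolding flow_def by blast
  fix s \<psi> assume \<psi>: "\<psi> \<in> H x"
  show "R x (- (s + t)) \<psi> = R x (- s) (R x (- t) \<psi>)" for t
  proof -
    have "R x (- s + - t) \<psi> = R x (- s) (R x (- t) \<psi>)"
      using assms x \<psi> unfolding flow_def by blast
    then show ?thesis by simp
  qed
  have "norm (R x (- s) \<psi> - \<psi>) \<le> C * \<bar>- s\<bar> * norm \<psi>"
    using assms x \<psi> unfolding flow_def by blast
  then show "norm (R x (- s) \<psi> - \<psi>) \<le> C * \<bar>s\<bar> * norm \<psi>" by simp
  have "norm (R x (- s) \<psi> - \<psi> - (- s) *\<^sub>R X x \<psi>) \<le> C * (- s)\<^sup>2 * norm \<psi>"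
    using assms x \<psi> unfolding flow_def by blast
  then show "norm (R x (- s) \<psi> - \<psi> - s *\<^sub>R (- X x \<psi>)) \<le> C * s\<^sup>2 * norm \<psi>" by simp
qed

lemma flow_zero:
  assumes "flow R X C K\<^sub>0" "x \<in> I" "\<psi> \<in> H x"
  shows "R x 0 \<psi> = \<psi>"
proof -
  have "norm (R x 0 \<psi> - \<psi>) \<le> C * \<bar>0\<bar> * norm \<psi>"
    using assms unfolding flow_def by blast
  then show ?thesis by simp
qed

lemma flow_F:
  assumes "flow R X C K\<^sub>0" "x \<in> I" "\<psi> \<in> F x"
  shows "R x s \<psi> \<in> F x"
proof -
  obtain M where M: "\<psi> \<in> cspan (e x ` {1..M})"
    using F_expand[OF hs[OF assms(2)] hb[OF assms(2)]] assms(3) unfolding F_def by blast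
  have "e x ` {1..M} \<subseteq> e x ` {1..max M K\<^sub>0}" by auto
  from complex_vector.span_mono[OF this] have "\<psi> \<in> cspan (e x ` {1..max M K\<^sub>0})" using M by blast
  then have "R x s \<psi> \<in> cspan (e x ` {1..max M K\<^sub>0})"
    using assms(1,2) unfolding flow_def by (meson image_subset_iff max.cobounded2)
  then show ?thesis using span_F by blast
qed

text \<open>Euler's method: the group is approximated by a repetition of one short word.\<close>

lemma reach_flow:
  assumes fl: "flow R X C K\<^sub>0" and X: "ach X 0" and s: "s > 0"
  shows "reach (\<lambda>x. R x s) (C * s)"
  unfolding reach_def
proof (intro conjI ballI allI impI)
  have C0: "C \<ge> 0" using fl by (simp add: flow_def)
  show "0 \<le> C * s" using C0 s by simp
  have Riso: "isom_on (H x) (R x t)" if "x \<in> I" for x t using fl that by (simp add: flow_def)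
  then show "isom_on (H x) (R x s)" if "x \<in> I" for x using that by blast
  fix K and \<eta> :: real assume \<eta>: "\<eta> > 0"
  define K' where "K' = max K K\<^sub>0"
  \<comment> \<open>Chosen for two bounds: \<open>\<eta>1 \<le> \<eta> / 2\<close> for the excursion
    of a single word, and \<open>2 * K' * \<eta>1 * s \<le> \<eta> / 2\<close> for the sum of all
    step errors.\<close>
  define \<eta>1 where "\<eta>1 = \<eta> / (4 * (K' + 1) * (s + 1))"
  have \<eta>1: "\<eta>1 > 0" using \<eta> s by (simp add: \<eta>1_def)
  have \<eta>1_eq: "\<eta>1 * (4 * (real K' + 1) * (s + 1)) = \<eta>"
  proof -
    have "4 * (real K' + 1) * (s + 1) > 0" using s by (intro mult_pos_pos) auto
    then have "4 * (real K' + 1) * (s + 1) \<noteq> 0" by linarith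
    then show ?thesis unfolding \<eta>1_def by (rule nonzero_eq_divide_eq[THEN iffD1]) simp
  qed
  have "1 * 1 \<le> (real K' + 1) * (s + 1)" using s by (intro mult_mono) auto
  then have "\<eta>1 * (2 * 1) \<le> \<eta>1 * (2 * ((real K' + 1) * (s + 1)))" using \<eta>1 by (intro mult_left_mono) auto
  also have "\<dots> = \<eta> / 2" using \<eta>1_eq by (simp add: algebra_simps)
  finally have \<eta>1_le: "\<eta>1 \<le> \<eta> / 2" using \<eta>1 by simp
  have "\<eta>1 * (2 * (real K' * s)) \<le> \<eta>1 * (2 * ((real K' + 1) * (s + 1)))"
    using \<eta>1 s by (intro mult_left_mono mult_mono) auto
  also have "\<dots> = \<eta> / 2" using \<eta>1_eq by (simp add: algebra_simps)
  finally have \<eta>1_K: "2 * K' * \<eta>1 * s \<le> \<eta> / 2" by (simp add: mult_ac)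
  obtain \<tau>0 where \<tau>0: "\<tau>0 > 0" and a: "\<And>\<tau>. 0 < \<tau> \<Longrightarrow> \<tau> \<le> \<tau>0 \<Longrightarrow> \<exists>w. adm w \<and> ctrl w (0 + \<eta>1) K' \<and>
    (\<forall>x\<in>I. \<forall>k\<in>{1..K'}. norm (ev x w (e x k) - e x k - \<tau> *\<^sub>R X x (e x k)) \<le> \<eta>1 * \<tau>)"
    using achE[OF X \<eta>1] by blast
  \<comment> \<open>The second entry turns the remainder \<open>C * \<tau>\<^sup>2\<close> of the
    flow into at most \<open>\<eta>1 * \<tau>\<close>.\<close>
  define \<tau>m where "\<tau>m = min \<tau>0 (\<eta>1 / (C + 1))"
  have \<tau>m: "\<tau>m > 0" using \<tau>0 \<eta>1 C0 by (simp add: \<tau>m_def)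
  obtain n :: nat where n: "s / \<tau>m < n" using reals_Archimedean2 by blast
  have n0: "n > 0" using n s \<tau>m by (metis divide_pos_pos of_nat_0_less_iff order.strict_trans)
  define \<tau> where "\<tau> = s / n"
  have \<tau>: "\<tau> > 0" "\<tau> \<le> \<tau>m" "n * \<tau> = s"
    using s n0 n \<tau>m by (auto simp: \<tau>_def field_simps)
  then have \<tau>0': "\<tau> \<le> \<tau>0" and "\<tau> \<le> \<eta>1 / (C + 1)" by (auto simp: \<tau>m_def)
  then have C\<tau>: "C * \<tau> \<le> \<eta>1" using C0 \<tau>(1) by (simp add: field_simps)
  obtain w where w: "adm w" "ctrl w (0 + \<eta>1) K'"
    "\<And>x k. x\<in>I \<Longrightarrow> k\<in>{1..K'} \<Longrightarrow> norm (ev x w (e x k) - e x k - \<tau> *\<^sub>R X x (e x k)) \<le> \<eta>1 * \<tau>"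
    using a[OF \<tau>(1) \<tau>0'] by blast
  \<comment> \<open>Error of one step on a vector of norm at most 1 in the span of \<open>K'\<close>
    basis vectors: word and flow each miss the linear approximation by
    \<open>\<eta>1 * \<tau>\<close> on a basis vector, and summing coefficients costs the factor
    \<open>K'\<close>.\<close>
  define d where "d = 2 * K' * \<eta>1 * \<tau>"
  have nd: "real r * d \<le> \<eta> / 2" if "r \<le> n" for r
  proof -
    have "real r * d \<le> real n * d" using that \<eta>1 \<tau>(1) by (intro mult_right_mono) (auto simp: d_def)
    also have "\<dots> = 2 * K' * \<eta>1 * s" unfolding d_def \<tau>(3)[symmetric] by simp
    finally show ?thesis using \<eta>1_K by simp
  qed
  have step: "norm (ev x w \<psi> - R x \<tau> \<psi>) \<le> d"
    if x: "x \<in> I" and \<psi>: "\<psi> \<in> cspan (e x ` {1..K'})" "norm \<psi> \<le> 1" for x \<psi>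
  proof -
    define L where "L \<psi> = ev x w \<psi> - R x \<tau> \<psi>" for \<psi>
    have "lin_into (H x) (H x) L"
      unfolding L_def using x by (intro lin_into_minus_fun isom_lin ev_isom Riso H_sub w) auto
    then have L: "lin_into (cspan (e x ` {1..})) UNIV L"
      using lin_into_subset[of "H x" "H x" L "F x"] F_H[OF x] by (auto simp: lin_into_def F_def)
    have "norm (L (bproj (e x) K' \<psi>)) \<le> K' * norm \<psi> * (2 * \<eta>1 * \<tau>)"
    proof (rule lin_bproj_bound[OF hs[OF x] hb[OF x] L])
      fix k assume k: "k \<in> {1..K'}"
      have "e x k \<in> H x" using e_H x k by auto
      then have "norm (R x \<tau> (e x k) - e x k - \<tau> *\<^sub>R X x (e x k)) \<le> C * \<tau>\<^sup>2 * norm (e x k)"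
        using fl x unfolding flow_def by blast
      also have "\<dots> = (C * \<tau>) * \<tau>" using e_norm[OF x, of k] k by (simp add: power2_eq_square)
      also have "\<dots> \<le> \<eta>1 * \<tau>" using C\<tau> \<tau>(1) by (intro mult_right_mono) auto
      finally have 1: "norm (R x \<tau> (e x k) - e x k - \<tau> *\<^sub>R X x (e x k)) \<le> \<eta>1 * \<tau>" .
      have "L (e x k) = (ev x w (e x k) - e x k - \<tau> *\<^sub>R X x (e x k)) - (R x \<tau> (e x k) - e x k - \<tau> *\<^sub>R X x (e x k))"
        by (simp add: L_def)
      then have "norm (L (e x k)) \<le> \<eta>1 * \<tau> + \<eta>1 * \<tau>"
        using norm_triangle_le_diff[OF add_mono[OF w(3)[OF x k] 1]] by simp
      then show "norm (L (e x k)) \<le> 2 * \<eta>1 * \<tau>" by simp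
    qed
    also have "\<dots> \<le> real K' * 1 * (2 * \<eta>1 * \<tau>)"
      using \<psi>(2) \<eta>1 \<tau>(1) by (intro mult_right_mono[OF mult_left_mono]) auto
    finally show ?thesis using bproj_fix[OF hs[OF x] hb[OF x] \<psi>(1)] by (simp add: L_def d_def)
  qed
  define ws where "ws r = concat (replicate r w)" for r
  have ws_adm: "adm (ws r)" for r using w(1) by (induction r) (auto simp: ws_def)
  have ws_Suc: "ws (Suc r) = ws r @ w" for r
    unfolding ws_def using replicate_append_same[of r w]
    by (metis concat.simps(1) concat.simps(2) concat_append append_Nil2 replicate_Suc)
  have main: "r \<le> n \<Longrightarrow> ctrl (ws r) (C * s + \<eta>) K' \<and>
    (\<forall>x\<in>I. \<forall>k\<in>{1..K'}. norm (ev x (ws r) (e x k) - R x (r * \<tau>) (e x k)) \<le> r * d)" for r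
  proof (induction r)
    case 0
    have "R x 0 (e x k) = e x k" if "x \<in> I" "k \<in> {1..K'}" for x k
      using flow_zero[OF fl that(1)] e_H[OF that(1)] that(2) by auto
    then show ?case using C0 s \<eta> by (auto simp: ws_def intro!: ctrl_Nil)
  next
    case (Suc r)
    then have IH: "ctrl (ws r) (C * s + \<eta>) K'"
      "\<And>x k. x\<in>I \<Longrightarrow> k\<in>{1..K'} \<Longrightarrow> norm (ev x (ws r) (e x k) - R x (r * \<tau>) (e x k)) \<le> r * d" by auto
    \<comment> \<open>After \<open>r\<close> repetitions the state is compared with the flow, which
      lies within \<open>C * s\<close> of the basis vector. Only the excursion of the current
      repetition is added, so excursions do not pile up.\<close>
    have "ctrl (ws r @ w) (C * s + \<eta>) K'"
    proof (rule ctrl_append_gen[OF ws_adm w(1) IH(1) w(2)])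
      show "(C * s + \<eta>/2) + (0 + \<eta>1) \<le> C * s + \<eta>" using \<eta>1_le by simp
      fix x k assume x: "x \<in> I" and k: "k \<in> {1..K'}"
      have ek: "e x k \<in> H x" using e_H x k by auto
      have "norm (R x (r * \<tau>) (e x k) - e x k) \<le> C * \<bar>r * \<tau>\<bar> * norm (e x k)"
        using fl x ek unfolding flow_def by blast
      also have "\<dots> = C * (r * \<tau>)" using e_norm[OF x, of k] k \<tau>(1) by simp
      also have "\<dots> \<le> C * (n * \<tau>)" using C0 \<tau>(1) Suc.prems by (intro mult_left_mono mult_right_mono) auto
      finally have "norm (R x (r * \<tau>) (e x k) - e x k) \<le> C * s" using \<tau>(3) by simp
      with IH(2)[OF x k] have "norm (ev x (ws r) (e x k) - e x k) \<le> r * d + C * s"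
        by (rule norm_diff_triangle_le)
      then show "near_diag (C * s + \<eta>/2) x k (ev x (ws r) (e x k))"
        using nd[of r] Suc.prems by (intro near_diagI) auto
    qed
    moreover have "norm (ev x (ws r @ w) (e x k) - R x (Suc r * \<tau>) (e x k)) \<le> Suc r * d"
      if x: "x \<in> I" and k: "k \<in> {1..K'}" for x k
    proof -
      have ek: "e x k \<in> H x" using e_H x k by auto
      have m: "R x (r * \<tau>) (e x k) \<in> H x" "ev x (ws r) (e x k) \<in> H x"
        using isom_mem[OF Riso[OF x] ek] isom_mem[OF ev_isom[OF x ws_adm] ek] by auto
      have "norm (ev x w (ev x (ws r) (e x k)) - ev x w (R x (r * \<tau>) (e x k))) \<le> r * d"
        using IH(2)[OF x k] isom_dist[OF ev_isom[OF x w(1)] H_sub[OF x] m(2) m(1)] by simp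
      moreover have "norm (ev x w (R x (r * \<tau>) (e x k)) - R x \<tau> (R x (r * \<tau>) (e x k))) \<le> d"
      proof (rule step[OF x])
        have "e x k \<in> cspan (e x ` {1..K'})" using k by (intro complex_vector.span_base) auto
        then show "R x (r * \<tau>) (e x k) \<in> cspan (e x ` {1..K'})"
          using fl x unfolding flow_def K'_def by (meson image_subset_iff max.cobounded2)
        show "norm (R x (r * \<tau>) (e x k)) \<le> 1"
          using isom_norm[OF Riso[OF x] ek] e_norm[OF x, of k] k by simp
      qed
      ultimately have "norm (ev x w (ev x (ws r) (e x k)) - R x \<tau> (R x (r * \<tau>) (e x k))) \<le> r * d + d"
        by (rule norm_diff_triangle_le)
      moreover have "R x (Suc r * \<tau>) (e x k) = R x \<tau> (R x (r * \<tau>) (e x k))"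
      proof -
        have "R x (\<tau> + r * \<tau>) (e x k) = R x \<tau> (R x (r * \<tau>) (e x k))"
          using fl x ek unfolding flow_def by blast
        then show ?thesis by (simp add: algebra_simps)
      qed
      ultimately show ?thesis using ev_append[OF x ws_adm w(1) ek] by (simp add: algebra_simps)
    qed
    ultimately show ?case by (simp add: ws_Suc)
  qed
  have "ctrl (ws n) (C * s + \<eta>) K"
    using main[of n] ctrl_mono[of "ws n" "C * s + \<eta>" K' _ K] by (auto simp: K'_def)
  moreover have "norm (ev x (ws n) (e x k) - R x s (e x k)) \<le> \<eta>" if "x \<in> I" "k \<in> {1..K}" for x k
  proof -
    have "norm (ev x (ws n) (e x k) - R x (n * \<tau>) (e x k)) \<le> n * d"
      using main[of n] that by (auto simp: K'_def)
    then show ?thesis using nd[of n] \<eta> \<tau>(3) by simp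
  qed
  ultimately show "\<exists>w. adm w \<and> ctrl w (C * s + \<eta>) K \<and>
     (\<forall>x\<in>I. \<forall>k\<in>{1..K}. norm (ev x w (e x k) - R x s (e x k)) \<le> \<eta>)"
    using ws_adm by blast
qed

subsection \<open>The Lie algebra of reversible directions\<close>

text \<open>Both signs make this a real vector space, as averages and differences require; deviation
  0 makes sums of any length free of cost.\<close>

definition lie :: "('x \<Rightarrow> 'h \<Rightarrow> 'h) \<Rightarrow> bool" where
  "lie M \<longleftrightarrow> ach M 0 \<and> ach (\<lambda>x \<psi>. - M x \<psi>) 0"

lemma lie_lin: "lie M \<Longrightarrow> x \<in> I \<Longrightarrow> lin_into (F x) (H x) (M x)"
  unfolding lie_def by (elim conjE) (rule ach_lin)

lemma lie_cong:
  assumes "lie M" "\<And>x. x \<in> I \<Longrightarrow> lin_into (F x) (H x) (M' x)"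
    and "\<And>x k. x \<in> I \<Longrightarrow> k \<ge> 1 \<Longrightarrow> M' x (e x k) = M x (e x k)"
  shows "lie M'"
proof -
  have M: "ach M 0" "ach (\<lambda>x \<psi>. - M x \<psi>) 0" using assms(1) by (simp_all add: lie_def)
  have "ach M' 0" by (rule ach_cong[OF M(1) assms(2,3)])
  moreover have "ach (\<lambda>x \<psi>. - M' x \<psi>) 0"
    by (rule ach_cong[OF M(2) lin_into_uminus[OF assms(2) H_sub]]) (simp_all add: assms(3))
  ultimately show ?thesis by (simp add: lie_def)
qed

lemma lie_limit:
  assumes lin: "\<And>x. x \<in> I \<Longrightarrow> lin_into (F x) (H x) (M x)"
    and lim: "\<And>K \<eta>. \<eta> > 0 \<Longrightarrow> \<exists>M'. lie M' \<and> (\<forall>x\<in>I. \<forall>k\<in>{1..K}. norm (M' x (e x k) - M x (e x k)) \<le> \<eta>)"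
  shows "lie M"
  unfolding lie_def
proof
  show "ach M 0"
  proof (rule ach_limit)
    fix K and \<eta> :: real assume "\<eta> > 0"
    with lim[OF this, of K] show "\<exists>M' \<rho>'. ach M' \<rho>' \<and> \<rho>' \<le> 0 + \<eta> \<and>
      (\<forall>x\<in>I. \<forall>k\<in>{1..K}. norm (M' x (e x k) - M x (e x k)) \<le> \<eta>)"
      unfolding lie_def by (metis add_0 less_imp_le)
  qed (auto intro: lin)
  show "ach (\<lambda>x \<psi>. - M x \<psi>) 0"
  proof (rule ach_limit)
    fix K and \<eta> :: real assume \<eta>: "\<eta> > 0"
    then obtain M' where "lie M'" "\<forall>x\<in>I. \<forall>k\<in>{1..K}. norm (M' x (e x k) - M x (e x k)) \<le> \<eta>"
      using lim by blast
    then show "\<exists>M' \<rho>'. ach M' \<rho>' \<and> \<rho>' \<le> 0 + \<eta> \<and>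
      (\<forall>x\<in>I. \<forall>k\<in>{1..K}. norm (M' x (e x k) - - M x (e x k)) \<le> \<eta>)"
      using \<eta> unfolding lie_def
      by (intro exI[of _ "\<lambda>x \<psi>. - M' x \<psi>"] exI[of _ 0]) (auto simp: norm_minus_commute)
  qed (auto intro: lin lin_into_uminus H_sub)
qed

lemma lie_zero: "lie (\<lambda>x \<psi>. 0)"
  by (simp add: lie_def ach_zero)

lemma lie_scale:
  assumes "lie M"
  shows "lie (\<lambda>x \<psi>. c *\<^sub>R M x \<psi>)"
proof -
  consider "c > 0" | "c = 0" | "c < 0" by linarith
  then show ?thesis
  proof cases
    case 1
    then show ?thesis
      using assms ach_scale_pos[of M 0 c] ach_scale_pos[of "\<lambda>x \<psi>. - M x \<psi>" 0 c] by (simp add: lie_def)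
  next
    case 2
    then show ?thesis by (simp add: lie_zero)
  next
    case 3
    then show ?thesis
      using assms ach_scale_pos[of M 0 "- c"] ach_scale_pos[of "\<lambda>x \<psi>. - M x \<psi>" 0 "- c"] by (simp add: lie_def)
  qed
qed

lemma lie_add:
  assumes "lie X" "lie Y"
  shows "lie (\<lambda>x \<psi>. X x \<psi> + Y x \<psi>)"
  using assms ach_add[of X 0 Y 0] ach_add[of "\<lambda>x \<psi>. - X x \<psi>" 0 "\<lambda>x \<psi>. - Y x \<psi>" 0]
  by (simp add: lie_def add.commute)

lemma lie_sum:
  assumes "finite S" "\<And>a. a \<in> S \<Longrightarrow> lie (X a)"
  shows "lie (\<lambda>x \<psi>. \<Sum>a\<in>S. X a x \<psi>)"
  using assms by (induction S rule: finite_induct) (auto simp: lie_zero intro!: lie_add)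

lemma lie_minus: "lie X \<Longrightarrow> lie Y \<Longrightarrow> lie (\<lambda>x \<psi>. X x \<psi> - Y x \<psi>)"
  using lie_add[OF _ lie_scale[of Y "-1"], of X] by simp

lemma lie_conj:
  assumes g: "reach g 0" and g': "reach g' 0" and M: "lie M"
    and inv: "\<And>x \<psi>. x \<in> I \<Longrightarrow> \<psi> \<in> H x \<Longrightarrow> g x (g' x \<psi>) = \<psi>"
    and fin: "\<And>x \<psi>. x \<in> I \<Longrightarrow> \<psi> \<in> F x \<Longrightarrow> g' x \<psi> \<in> F x"
  shows "lie (\<lambda>x \<psi>. g x (M x (g' x \<psi>)))"
proof -
  have 1: "ach (\<lambda>x \<psi>. g x (M x (g' x \<psi>))) 0"
    using ach_conj[OF g g' _ inv fin, of M 0] M by (simp add: lie_def)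
  have 2: "ach (\<lambda>x \<psi>. g x (- M x (g' x \<psi>))) 0"
    using ach_conj[OF g g' _ inv fin, of "\<lambda>x \<psi>. - M x \<psi>" 0] M by (simp add: lie_def)
  have "g x (- M x (g' x (e x k))) = - g x (M x (g' x (e x k)))" if "x \<in> I" "k \<ge> 1" for x k
    using lin_into_minus[OF isom_lin[OF reach_isom[OF g that(1)]]]
      lin_into_mem[OF lie_lin[OF M that(1)] fin[OF that(1) e_F[OF that]]] by blast
  then have "ach (\<lambda>x \<psi>. - g x (M x (g' x \<psi>))) 0"
    using 2 ach_lin[OF 1] by (intro ach_cong[OF 2]) (auto intro: lin_into_uminus H_sub)
  with 1 show ?thesis by (simp add: lie_def)
qed

text \<open>\<open>(R\<^sub>s M R\<^sub>-\<^sub>s - M) / s\<close> tends to \<open>[X, M]\<close> as \<open>s \<rightarrow> 0\<close>, and the deviation \<open>2 C s\<close> that the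
  conjugation costs tends to \<open>0\<close>.\<close>

lemma ach_bracket:
  assumes fl: "flow R X C K\<^sub>0" and X: "lie X" and M: "ach M 0" and M': "ach (\<lambda>x \<psi>. - M x \<psi>) 0"
    and lin: "\<And>x. x \<in> I \<Longrightarrow> lin_into (H x) (H x) (M x)"
    and bd: "\<And>x \<psi>. x \<in> I \<Longrightarrow> \<psi> \<in> H x \<Longrightarrow> norm (M x \<psi>) \<le> D * norm \<psi>"
    and D: "D \<ge> 0"
  shows "ach (\<lambda>x \<psi>. X x (M x \<psi>) - M x (X x \<psi>)) 0"
proof (rule ach_limit)
  have C0: "C \<ge> 0" using fl by (simp add: flow_def)
  have Xlin: "lin_into (H x) (H x) (X x)" if "x \<in> I" for x using fl that by (simp add: flow_def)
  have Riso: "isom_on (H x) (R x s)" if "x \<in> I" for x s using fl that by (simp add: flow_def)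
  show "lin_into (F x) (H x) (\<lambda>\<psi>. X x (M x \<psi>) - M x (X x \<psi>))" if x: "x \<in> I" for x
    by (rule lin_into_subset[OF _ F_H[OF x]])
       (intro lin_into_minus_fun lin_into_compose[OF lin[OF x] Xlin[OF x]]
          lin_into_compose[OF Xlin[OF x] lin[OF x]] H_sub[OF x])
  fix K and \<eta> :: real assume \<eta>: "\<eta> > 0"
  \<comment> \<open>The coefficients of \<open>s\<^sup>2\<close> in \<open>b1\<close>,
    \<open>b2\<close> and \<open>b3\<close>; after division by \<open>s\<close> they leave the error
    \<open>E * s\<close>.\<close>
  define E where "E = C * D + C * (D * (2 * C)) + D * C"
  have E0: "E \<ge> 0" using C0 D by (simp add: E_def)
  \<comment> \<open>Solves \<open>s * (2 * C + E + 1) = \<eta>\<close>, so that the deviation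
    \<open>2 * (C * s)\<close> and the error \<open>E * s\<close> are both at most
    \<open>\<eta>\<close>.\<close>
  define s where "s = \<eta> / (2 * C + E + 1)"
  have s: "s > 0" using \<eta> C0 E0 by (simp add: s_def)
  have "2 * C + E + 1 \<noteq> 0" using C0 E0 by linarith
  then have "s * (2 * C + E + 1) = \<eta>" unfolding s_def by simp
  then have "(2 * C + E) * s + s = \<eta>" by (simp add: algebra_simps)
  moreover have "(2 * C + E) * s = 2 * (C * s) + E * s" by (simp add: algebra_simps)
  moreover have "E * s \<ge> 0" "2 * (C * s) \<ge> 0" using s E0 C0 by auto
  ultimately have s2: "2 * (C * s) \<le> \<eta>" "E * s \<le> \<eta>" using s by linarith+
  have r1: "reach (\<lambda>x. R x s) (C * s)" using reach_flow[OF fl _ s] X by (simp add: lie_def)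
  have r2: "reach (\<lambda>x. R x (- s)) (C * s)" using reach_flow[OF flow_rev[OF fl] _ s] X by (simp add: lie_def)
  have RR: "R x s (R x (- s) \<psi>) = \<psi>" if "x \<in> I" "\<psi> \<in> H x" for x \<psi>
  proof -
    have "R x (s + - s) \<psi> = R x s (R x (- s) \<psi>)" using fl that unfolding flow_def by blast
    then show ?thesis using flow_zero[OF fl that] by simp
  qed
  have "ach (\<lambda>x \<psi>. R x s (M x (R x (- s) \<psi>))) (2 * (C * s) + 0)"
    using RR flow_F[OF fl] by (intro ach_conj[OF r1 r2 M]) auto
  then have "ach (\<lambda>x \<psi>. R x s (M x (R x (- s) \<psi>)) + - M x \<psi>) (2 * (C * s) + 0 + 0)"
    by (rule ach_add[OF _ M'])
  then have a: "ach (\<lambda>x \<psi>. (1/s) *\<^sub>R (R x s (M x (R x (- s) \<psi>)) + - M x \<psi>)) (2 * (C * s))"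
    using ach_scale_pos[of _ _ "1/s"] s by simp
  have "norm ((1/s) *\<^sub>R (R x s (M x (R x (- s) \<psi>)) + - M x \<psi>) - (X x (M x \<psi>) - M x (X x \<psi>))) \<le> \<eta>"
    if x: "x \<in> I" and \<psi>: "\<psi> \<in> H x" and n1: "norm \<psi> = 1" for x \<psi>
  proof -
    note sub = H_sub[OF x]
    have RA: "norm (R x t \<phi> - \<phi>) \<le> C * \<bar>t\<bar> * norm \<phi>"
      and RB: "norm (R x t \<phi> - \<phi> - t *\<^sub>R X x \<phi>) \<le> C * t\<^sup>2 * norm \<phi>" if "\<phi> \<in> H x" for t \<phi>
      using fl x that unfolding flow_def by blast+
    define y where "y = M x \<psi>"
    define u where "u = M x (X x \<psi>)"
    define r where "r = R x (- s) \<psi> - \<psi> - (- s) *\<^sub>R X x \<psi>"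
    have X\<psi>: "X x \<psi> \<in> H x" using lin_into_mem[OF Xlin[OF x] \<psi>] .
    have yH: "y \<in> H x" and uH: "u \<in> H x" using lin_into_mem[OF lin[OF x]] \<psi> X\<psi> by (auto simp: y_def u_def)
    have rH: "r \<in> H x" unfolding r_def using isom_mem[OF Riso[OF x] \<psi>] \<psi> X\<psi> sub
      by (intro complex_vector.subspace_diff csubspace_scaleR) auto
    have MrH: "M x r \<in> H x" using lin_into_mem[OF lin[OF x] rH] .
    \<comment> \<open>The norm of the generator is read off from the two flow estimates at time
      1.\<close>
    have Xn: "norm (X x \<psi>) \<le> 2 * C"
    proof -
      have "X x \<psi> = (R x 1 \<psi> - \<psi>) - (R x 1 \<psi> - \<psi> - 1 *\<^sub>R X x \<psi>)" by simp
      then have "norm (X x \<psi>) \<le> norm (R x 1 \<psi> - \<psi>) + norm (R x 1 \<psi> - \<psi> - 1 *\<^sub>R X x \<psi>)"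
        by (metis norm_triangle_ineq4)
      then show ?thesis using RA[OF \<psi>, of 1] RB[OF \<psi>, of 1] n1 by simp
    qed
    have yn: "norm y \<le> D" using bd[OF x \<psi>] n1 by (simp add: y_def)
    have un: "norm u \<le> D * (2 * C)"
      using bd[OF x X\<psi>] mult_left_mono[OF Xn D] unfolding u_def by (rule order_trans)
    have rn: "norm r \<le> C * s\<^sup>2" using RB[OF \<psi>, of "- s"] n1 by (simp add: r_def)
    have Mrn: "norm (M x r) \<le> D * (C * s\<^sup>2)"
      using bd[OF x rH] mult_left_mono[OF rn D] by (rule order_trans)
    have "R x (- s) \<psi> = \<psi> + ((- s) *\<^sub>R X x \<psi> + r)" by (simp add: r_def)
    then have "M x (R x (- s) \<psi>) = y + ((- s) *\<^sub>R u + M x r)"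
      using \<psi> X\<psi> rH sub
      by (simp add: lin_into_add[OF lin[OF x]] lin_into_scaleR[OF lin[OF x]] lin_into_minus[OF lin[OF x]]
         csubspace_scaleR complex_vector.subspace_add complex_vector.subspace_diff complex_vector.subspace_neg
         lin_into_diff[OF lin[OF x]] y_def u_def del: scaleR_minus_left)
    then have "R x s (M x (R x (- s) \<psi>)) = R x s y + ((- s) *\<^sub>R R x s u + R x s (M x r))"
      using yH uH MrH sub lin_into_add[OF isom_lin[OF Riso[OF x]]] lin_into_scaleR[OF isom_lin[OF Riso[OF x]]]
      by (simp add: csubspace_scaleR complex_vector.subspace_add del: scaleR_minus_left)
    then have eq: "R x s (M x (R x (- s) \<psi>)) + - M x \<psi> - s *\<^sub>R (X x y - u) =
      (R x s y - y - s *\<^sub>R X x y) + ((- s) *\<^sub>R (R x s u - u) + R x s (M x r))"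
      by (simp add: algebra_simps flip: y_def)
    have b1: "norm (R x s y - y - s *\<^sub>R X x y) \<le> C * D * s\<^sup>2"
    proof -
      have "C * s\<^sup>2 * norm y \<le> C * s\<^sup>2 * D" using yn C0 by (intro mult_left_mono) auto
      then show ?thesis using RB[OF yH, of s] by (simp add: mult_ac)
    qed
    have b2: "norm ((- s) *\<^sub>R (R x s u - u)) \<le> C * (D * (2 * C)) * s\<^sup>2"
    proof -
      have "C * \<bar>s\<bar> * norm u \<le> C * \<bar>s\<bar> * (D * (2 * C))" using un C0 by (intro mult_left_mono) auto
      then have "norm (R x s u - u) \<le> C * s * (D * (2 * C))" using RA[OF uH, of s] s by simp
      then have "s * norm (R x s u - u) \<le> s * (C * s * (D * (2 * C)))" using s by (intro mult_left_mono) auto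
      then show ?thesis using s by (simp add: power2_eq_square mult_ac)
    qed
    have b3: "norm (R x s (M x r)) \<le> D * C * s\<^sup>2"
      using Mrn isom_norm[OF Riso[OF x] MrH] by (simp add: mult_ac)
    have "norm (R x s (M x (R x (- s) \<psi>)) + - M x \<psi> - s *\<^sub>R (X x y - u)) \<le>
      C * D * s\<^sup>2 + (C * (D * (2 * C)) * s\<^sup>2 + D * C * s\<^sup>2)"
      unfolding eq by (intro norm_triangle_mono b1 b2 b3)
    also have "\<dots> = (E * s) * s" by (simp add: E_def algebra_simps power2_eq_square)
    also have "\<dots> \<le> \<eta> * s" using s2 s by (intro mult_right_mono) auto
    finally have fin: "norm (R x s (M x (R x (- s) \<psi>)) + - M x \<psi> - s *\<^sub>R (X x y - u)) \<le> \<eta> * s" .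
    have "(1/s) *\<^sub>R (R x s (M x (R x (- s) \<psi>)) + - M x \<psi>) - (X x y - u) =
      (1/s) *\<^sub>R (R x s (M x (R x (- s) \<psi>)) + - M x \<psi> - s *\<^sub>R (X x y - u))"
      using s by (simp add: scaleR_diff_right scaleR_add_right)
    moreover have "norm ((1/s) *\<^sub>R z) \<le> \<eta>" if "norm z \<le> \<eta> * s" for z :: 'h
      using that s by (simp add: pos_divide_le_eq)
    ultimately have "norm ((1/s) *\<^sub>R (R x s (M x (R x (- s) \<psi>)) + - M x \<psi>) - (X x y - u)) \<le> \<eta>"
      using fin by simp
    then show ?thesis by (simp add: y_def u_def)
  qed
  then show "\<exists>M' \<rho>'. ach M' \<rho>' \<and> \<rho>' \<le> 0 + \<eta> \<and>
    (\<forall>x\<in>I. \<forall>k\<in>{1..K}. norm (M' x (e x k) - (X x (M x (e x k)) - M x (X x (e x k)))) \<le> \<eta>)"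
    using a s2(1) e_H e_norm
    by (intro exI[of _ "\<lambda>x \<psi>. (1/s) *\<^sub>R (R x s (M x (R x (- s) \<psi>)) + - M x \<psi>)"] exI[of _ "2 * (C * s)"]) auto
qed simp

lemma lie_bracket:
  assumes fl: "flow R X C K\<^sub>0" and X: "lie X" and M: "lie M"
    and lin: "\<And>x. x \<in> I \<Longrightarrow> lin_into (H x) (H x) (M x)"
    and bd: "\<And>x \<psi>. x \<in> I \<Longrightarrow> \<psi> \<in> H x \<Longrightarrow> norm (M x \<psi>) \<le> D * norm \<psi>"
    and D: "D \<ge> 0"
  shows "lie (\<lambda>x \<psi>. X x (M x \<psi>) - M x (X x \<psi>))"
proof -
  have 1: "ach (\<lambda>x \<psi>. X x (M x \<psi>) - M x (X x \<psi>)) 0"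
    using M by (intro ach_bracket[OF fl X _ _ lin bd D]) (auto simp: lie_def)
  have 2: "ach (\<lambda>x \<psi>. X x (- M x \<psi>) - - M x (X x \<psi>)) 0"
    using M lin bd D H_sub
    by (intro ach_bracket[OF fl X, of "\<lambda>x \<psi>. - M x \<psi>" D]) (auto simp: lie_def intro: lin_into_uminus)
  have Xlin: "lin_into (H x) (H x) (X x)" if "x \<in> I" for x using fl that by (simp add: flow_def)
  have "X x (- M x (e x k)) = - X x (M x (e x k))" if "x \<in> I" "k \<ge> 1" for x k
    using lin_into_minus[OF Xlin[OF that(1)]] lin_into_mem[OF lin[OF that(1)] e_H[OF that]] by blast
  then have "ach (\<lambda>x \<psi>. - (X x (M x \<psi>) - M x (X x \<psi>))) 0"
    using ach_lin[OF 1] by (intro ach_cong[OF 2] lin_into_uminus) (auto simp: H_sub)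
  with 1 show ?thesis by (simp add: lie_def)
qed

subsection \<open>Groups generated by phases on two orthogonal vectors\<close>

text \<open>Orthogonality makes the two phase groups commute, so their product is again a group.
  With \<open>r\<close> for the sum inside the square, \<open>3 * r\<^sup>2\<close> dominates both
  the first-order constant \<open>r\<close> and the second-order constant
  \<open>2 * r\<^sup>2\<close>. The index \<open>K\<^sub>0\<close> is one from which the spans of
  the first basis vectors contain all \<open>v x\<close> and \<open>u x\<close>.\<close>

lemma flow_two_phases:
  assumes "\<And>x. x \<in> I \<Longrightarrow> v x \<in> F x" "\<And>x. x \<in> I \<Longrightarrow> u x \<in> F x"
    and "\<And>x. x \<in> I \<Longrightarrow> norm (v x) = 0 \<or> norm (v x) = 1"
    and "\<And>x. x \<in> I \<Longrightarrow> norm (u x) = 0 \<or> norm (u x) = 1"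
    and "\<And>x. x \<in> I \<Longrightarrow> cinner (v x) (u x) = 0"
  obtains K\<^sub>0 where "flow (\<lambda>x s \<psi>. ph (v x) (cis (a x * s)) (ph (u x) (cis (b x * s)) \<psi>))
    (\<lambda>x \<psi>. (\<i> * a x * cinner \<psi> (v x)) *\<^sub>C v x + (\<i> * b x * cinner \<psi> (u x)) *\<^sub>C u x)
    (3 * (1 + (\<Sum>x\<in>I. \<bar>a x\<bar> + \<bar>b x\<bar>))\<^sup>2) K\<^sub>0"
proof -
  define r where "r = 1 + (\<Sum>x\<in>I. \<bar>a x\<bar> + \<bar>b x\<bar>)"
  have r1: "r \<ge> 1" by (simp add: r_def sum_nonneg)
  have r: "\<bar>a x\<bar> + \<bar>b x\<bar> \<le> r" if "x \<in> I" for x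
    using member_le_sum[OF that, of "\<lambda>x. \<bar>a x\<bar> + \<bar>b x\<bar>"] finite_I by (simp add: r_def)
  define C where "C = 3 * r\<^sup>2"
  have "r * 1 \<le> r * r" using r1 by (intro mult_left_mono) auto
  then have rC: "r \<le> C" using r1 unfolding C_def power2_eq_square by linarith
  have "\<exists>m\<ge>0. \<forall>x\<in>I. v x \<in> cspan (e x ` {1..m}) \<and> u x \<in> cspan (e x ` {1..m})"
  proof -
    have mono: "cspan (e x ` {1..m}) \<subseteq> cspan (e x ` {1..n})" if "m \<le> n" for m n x
      using that by (intro complex_vector.span_mono) auto
    have "\<forall>\<^sub>F m in sequentially. \<forall>x\<in>I. v x \<in> cspan (e x ` {1..m}) \<and> u x \<in> cspan (e x ` {1..m})"
    proof (intro eventually_ball_finite finite_I ballI)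
      fix x assume x: "x \<in> I"
      obtain m1 where "v x \<in> cspan (e x ` {1..m1})"
        using F_expand[OF hs[OF x] hb[OF x]] assms(1)[OF x] unfolding F_def by blast
      moreover obtain m2 where "u x \<in> cspan (e x ` {1..m2})"
        using F_expand[OF hs[OF x] hb[OF x]] assms(2)[OF x] unfolding F_def by blast
      ultimately show "\<forall>\<^sub>F m in sequentially. v x \<in> cspan (e x ` {1..m}) \<and> u x \<in> cspan (e x ` {1..m})"
        unfolding eventually_sequentially using mono by (intro exI[of _ "max m1 m2"]) fastforce
    qed
    then show ?thesis unfolding eventually_sequentially by blast
  qed
  then obtain K\<^sub>0 where K\<^sub>0: "\<And>x. x \<in> I \<Longrightarrow> v x \<in> cspan (e x ` {1..K\<^sub>0}) \<and> u x \<in> cspan (e x ` {1..K\<^sub>0})"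
    by blast
  show ?thesis
  proof (rule that[of K\<^sub>0], fold r_def, fold C_def, unfold flow_def, intro conjI ballI allI impI)
    show "C \<ge> 0" by (simp add: C_def)
    fix x assume x: "x \<in> I"
    let ?v = "v x" and ?u = "u x" and ?a = "a x" and ?b = "b x"
    note sub = H_sub[OF x]
    have vH: "?v \<in> H x" "?u \<in> H x" using assms(1,2)[OF x] F_H[OF x] by auto
    note nv = assms(3)[OF x] and nu = assms(4)[OF x] and orth = assms(5)[OF x]
    have orth': "cinner ?u ?v = 0" using orth cinner_commute[of ?u ?v] by simp
    show "isom_on (H x) (\<lambda>\<psi>. ph ?v (cis (?a * s)) (ph ?u (cis (?b * s)) \<psi>))" for s
      by (rule isom_compose[OF ph_isom[OF sub vH(2) nu] ph_isom[OF sub vH(1) nv]]) auto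
    show "lin_into (H x) (H x) (\<lambda>\<psi>. (\<i> * ?a * cinner \<psi> ?v) *\<^sub>C ?v + (\<i> * ?b * cinner \<psi> ?u) *\<^sub>C ?u)"
      using sub vH
      by (auto simp: lin_into_def linear_map_on_def cinner_add_left cinner_scaleC_left scaleC_scaleC
         scaleC_add_left scaleC_add_right algebra_simps complex_vector.subspace_add complex_vector.subspace_scale)
    show "(\<lambda>\<psi>. ph ?v (cis (?a * s)) (ph ?u (cis (?b * s)) \<psi>)) ` cspan (e x ` {1..K}) \<subseteq> cspan (e x ` {1..K})"
      if "K \<ge> K\<^sub>0" for K s
    proof -
      have "cspan (e x ` {1..K\<^sub>0}) \<subseteq> cspan (e x ` {1..K})"
        using that by (intro complex_vector.span_mono) auto
      then have "?v \<in> cspan (e x ` {1..K})" "?u \<in> cspan (e x ` {1..K})" using K\<^sub>0[OF x] by auto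
      then show ?thesis
        by (auto simp: ph_def intro!: complex_vector.span_add complex_vector.span_scale)
    qed
    fix s \<psi> assume \<psi>: "\<psi> \<in> H x"
    show "ph ?v (cis (?a * (s + t))) (ph ?u (cis (?b * (s + t))) \<psi>) =
      ph ?v (cis (?a * s)) (ph ?u (cis (?b * s)) (ph ?v (cis (?a * t)) (ph ?u (cis (?b * t)) \<psi>)))" for t
    proof -
      have "ph ?u (cis (?b * s)) (ph ?v (cis (?a * t)) (ph ?u (cis (?b * t)) \<psi>)) =
        ph ?v (cis (?a * t)) (ph ?u (cis (?b * s)) (ph ?u (cis (?b * t)) \<psi>))"
        by (rule ph_commute[OF orth'])
      then show ?thesis by (simp add: ph_mult[OF nv] ph_mult[OF nu] cis_mult distrib_left)
    qed
    have ab: "(\<bar>?a\<bar> + \<bar>?b\<bar>) * \<bar>s\<bar> \<le> r * \<bar>s\<bar>" using r[OF x] by (intro mult_right_mono) auto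
    let ?\<xi> = "ph ?u (cis (?b * s)) \<psi>"
    have \<xi>n: "norm ?\<xi> = norm \<psi>" by (rule ph_norm[OF nu]) simp
    have nb: "norm (?\<xi> - \<psi>) \<le> \<bar>?b * s\<bar> * norm \<psi>"
      using ph_near[OF nu, of "cis (?b * s)" \<psi>] mult_right_mono[OF cmod_cis_minus_1_le[of "?b * s"], of "norm \<psi>"] by simp
    have na: "norm (ph ?v (cis (?a * s)) ?\<xi> - ?\<xi>) \<le> \<bar>?a * s\<bar> * norm \<psi>"
      using ph_near[OF nv, of "cis (?a * s)" ?\<xi>] mult_right_mono[OF cmod_cis_minus_1_le[of "?a * s"], of "norm \<psi>"]
      by (simp add: \<xi>n)
    have "norm (ph ?v (cis (?a * s)) ?\<xi> - \<psi>) \<le> \<bar>?a * s\<bar> * norm \<psi> + \<bar>?b * s\<bar> * norm \<psi>"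
      by (rule norm_diff_triangle_le[OF na nb])
    also have "\<dots> = ((\<bar>?a\<bar> + \<bar>?b\<bar>) * \<bar>s\<bar>) * norm \<psi>" by (simp add: abs_mult algebra_simps)
    also have "\<dots> \<le> (C * \<bar>s\<bar>) * norm \<psi>"
      by (rule mult_right_mono[OF order_trans[OF ab mult_right_mono[OF rC]]]) auto
    finally show "norm (ph ?v (cis (?a * s)) ?\<xi> - \<psi>) \<le> C * \<bar>s\<bar> * norm \<psi>" .
    have c\<xi>: "cinner ?\<xi> ?v = cinner \<psi> ?v" by (simp add: ph_def cinner_add_left cinner_scaleC_left orth')
    have "ph ?v (cis (?a * s)) ?\<xi> - \<psi> - s *\<^sub>R ((\<i> * ?a * cinner \<psi> ?v) *\<^sub>C ?v + (\<i> * ?b * cinner \<psi> ?u) *\<^sub>C ?u)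
      = (ph ?v (cis (?a * s)) ?\<xi> - ?\<xi> - (\<i> * (?a * s) * cinner ?\<xi> ?v) *\<^sub>C ?v) +
        (?\<xi> - \<psi> - (\<i> * (?b * s) * cinner \<psi> ?u) *\<^sub>C ?u)"
      unfolding c\<xi> by (simp add: algebra_simps scaleR_scaleC scaleC_scaleC scaleC_add_right)
    moreover have "norm (ph ?v (cis (?a * s)) ?\<xi> - ?\<xi> - (\<i> * (?a * s) * cinner ?\<xi> ?v) *\<^sub>C ?v) \<le> (?a * s)\<^sup>2 * norm \<psi>"
      using ph_linear_approx[OF nv, of "?a * s" ?\<xi>] by (simp add: \<xi>n)
    moreover have "norm (?\<xi> - \<psi> - (\<i> * (?b * s) * cinner \<psi> ?u) *\<^sub>C ?u) \<le> (?b * s)\<^sup>2 * norm \<psi>"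
      using ph_linear_approx[OF nu, of "?b * s" \<psi>] by simp
    ultimately have "norm (ph ?v (cis (?a * s)) ?\<xi> - \<psi> - s *\<^sub>R ((\<i> * ?a * cinner \<psi> ?v) *\<^sub>C ?v + (\<i> * ?b * cinner \<psi> ?u) *\<^sub>C ?u))
      \<le> (?a * s)\<^sup>2 * norm \<psi> + (?b * s)\<^sup>2 * norm \<psi>"
      by (metis norm_triangle_mono)
    also have "\<dots> = (?a\<^sup>2 + ?b\<^sup>2) * s\<^sup>2 * norm \<psi>" by (simp add: algebra_simps power_mult_distrib)
    also have "\<dots> \<le> C * s\<^sup>2 * norm \<psi>"
    proof -
      have "?a\<^sup>2 \<le> r\<^sup>2" "?b\<^sup>2 \<le> r\<^sup>2"
        using r[OF x] by (auto intro!: abs_le_square_iff[THEN iffD1])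
      then have "?a\<^sup>2 + ?b\<^sup>2 \<le> C" using zero_le_power2[of r] unfolding C_def by linarith
      then show ?thesis by (intro mult_right_mono) auto
    qed
    finally show "norm (ph ?v (cis (?a * s)) ?\<xi> - \<psi> - s *\<^sub>R ((\<i> * ?a * cinner \<psi> ?v) *\<^sub>C ?v + (\<i> * ?b * cinner \<psi> ?u) *\<^sub>C ?u))
      \<le> C * s\<^sup>2 * norm \<psi>" .
  qed
qed

end

section \<open>The Lie algebra generated by the couplings\<close>

context controlled_family
begin

lemma flow_cong:
  assumes "flow R X C K\<^sub>0" "\<And>x \<psi>. x \<in> I \<Longrightarrow> \<psi> \<in> H x \<Longrightarrow> X' x \<psi> = X x \<psi>"
  shows "flow R X' C K\<^sub>0"
proof -
  have "lin_into (H x) (H x) (X' x)" if x: "x \<in> I" for x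
  proof -
    have "lin_into (H x) (H x) (X x)" using assms(1) x by (simp add: flow_def)
    then show ?thesis
      using assms(2)[OF x] H_sub[OF x]
      by (auto simp: lin_into_def linear_map_on_def complex_vector.subspace_add
          complex_vector.subspace_scale image_subset_iff)
  qed
  then show ?thesis using assms unfolding flow_def by simp
qed

text \<open>The operator beta |e_b><e_a| minus its adjoint, the elementary skew-adjoint transition,
  with its own strength \<open>\<beta> x\<close> in each system. For \<open>a = b\<close> it
  degenerates to a diagonal operator with entry 2 i Im(beta).\<close>

definition jump :: "nat \<Rightarrow> nat \<Rightarrow> ('x \<Rightarrow> complex) \<Rightarrow> 'x \<Rightarrow> 'h \<Rightarrow> 'h" where
  "jump a b \<beta> x \<psi> = (\<beta> x * cinner \<psi> (e x a)) *\<^sub>C e x b - (cnj (\<beta> x) * cinner \<psi> (e x b)) *\<^sub>C e x a"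

definition diag_op :: "nat \<Rightarrow> ('x \<Rightarrow> real) \<Rightarrow> 'x \<Rightarrow> 'h \<Rightarrow> 'h" where
  "diag_op a \<zeta> x \<psi> = (\<i> * \<zeta> x * cinner \<psi> (e x a)) *\<^sub>C e x a"

lemma jump_lin: "x \<in> I \<Longrightarrow> a \<ge> 1 \<Longrightarrow> b \<ge> 1 \<Longrightarrow> lin_into (H x) (H x) (jump a b \<beta> x)"
  using e_H[of x a] e_H[of x b] H_sub[of x]
  by (auto simp: lin_into_def linear_map_on_def jump_def cinner_add_left cinner_scaleC_left scaleC_scaleC
      scaleC_add_left scaleC_diff_right distrib_left mult_ac complex_vector.subspace_diff
      complex_vector.subspace_scale)

lemma diag_op_lin: "x \<in> I \<Longrightarrow> a \<ge> 1 \<Longrightarrow> lin_into (H x) (H x) (diag_op a \<zeta> x)"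
  using e_H[of x a] H_sub[of x]
  by (auto simp: lin_into_def linear_map_on_def diag_op_def cinner_add_left cinner_scaleC_left scaleC_scaleC
      scaleC_add_left distrib_left mult_ac complex_vector.subspace_scale)

lemma jump_hom:
  "jump a b \<beta> x (- \<psi>) = - jump a b \<beta> x \<psi>" "jump a b \<beta> x (c *\<^sub>C \<psi>) = c *\<^sub>C jump a b \<beta> x \<psi>"
  "jump a b \<beta> x 0 = 0"
  by (auto simp: jump_def cinner_minus_left cinner_scaleC_left scaleC_scaleC scaleC_diff_right
      scaleC_minus_left mult_ac)

lemma diag_op_hom:
  "diag_op a \<zeta> x (- \<psi>) = - diag_op a \<zeta> x \<psi>" "diag_op a \<zeta> x (c *\<^sub>C \<psi>) = c *\<^sub>C diag_op a \<zeta> x \<psi>"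
  "diag_op a \<zeta> x 0 = 0"
  by (auto simp: diag_op_def cinner_minus_left cinner_scaleC_left scaleC_scaleC scaleC_minus_left mult_ac)

lemma lin_F: "x \<in> I \<Longrightarrow> lin_into (H x) (H x) M \<Longrightarrow> lin_into (F x) (H x) M"
  by (rule lin_into_subset[OF _ F_H])

lemma jump_bound:
  assumes "x \<in> I" "a \<ge> 1" "b \<ge> 1"
  shows "norm (jump a b \<beta> x \<psi>) \<le> (2 * (\<Sum>x\<in>I. cmod (\<beta> x))) * norm \<psi>"
proof -
  have c: "cmod (cinner \<psi> (e x k)) \<le> norm \<psi>" if "k \<ge> 1" for k
    using cinner_cauchy_schwarz[of \<psi> "e x k"] e_norm[OF assms(1) that] by simp
  have d: "norm ((z * cinner \<psi> (e x k)) *\<^sub>C e x l) \<le> cmod z * norm \<psi>" if "k \<ge> 1" "l \<ge> 1" for k l z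
    using c[OF that(1)] e_norm[OF assms(1) that(2)] by (simp add: norm_scaleC norm_mult mult_left_mono)
  have "norm (jump a b \<beta> x \<psi>) \<le> cmod (\<beta> x) * norm \<psi> + cmod (cnj (\<beta> x)) * norm \<psi>"
    unfolding jump_def by (intro norm_triangle_le_diff[OF add_mono[OF d d]] assms)
  also have "\<dots> = 2 * cmod (\<beta> x) * norm \<psi>" by simp
  also have "\<dots> \<le> 2 * (\<Sum>x\<in>I. cmod (\<beta> x)) * norm \<psi>"
    using member_le_sum[OF assms(1), of "\<lambda>x. cmod (\<beta> x)"] finite_I by (intro mult_right_mono mult_left_mono) auto
  finally show ?thesis .
qed

lemma diag_op_bound:
  assumes "x \<in> I" "a \<ge> 1"
  shows "norm (diag_op a \<zeta> x \<psi>) \<le> (\<Sum>x\<in>I. \<bar>\<zeta> x\<bar>) * norm \<psi>"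
proof -
  have c: "cmod (cinner \<psi> (e x a)) \<le> norm \<psi>"
    using cinner_cauchy_schwarz[of \<psi> "e x a"] e_norm[OF assms] by simp
  then have "norm (diag_op a \<zeta> x \<psi>) \<le> \<bar>\<zeta> x\<bar> * norm \<psi>"
    using e_norm[OF assms] by (simp add: diag_op_def norm_scaleC norm_mult mult_left_mono)
  also have "\<dots> \<le> (\<Sum>x\<in>I. \<bar>\<zeta> x\<bar>) * norm \<psi>"
    using member_le_sum[OF assms(1), of "\<lambda>x. \<bar>\<zeta> x\<bar>"] finite_I by (intro mult_right_mono) auto
  finally show ?thesis .
qed

lemma jump_basis:
  assumes "x \<in> I" "a \<ge> 1" "b \<ge> 1" "a \<noteq> b" "k \<ge> 1"
  shows "jump a b \<beta> x (e x k) =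
    (if k = a then \<beta> x *\<^sub>C e x b else if k = b then (- cnj (\<beta> x)) *\<^sub>C e x a else 0)"
  using assms by (simp add: jump_def e_cinner scaleC_minus_left)

lemma diag_op_basis:
  assumes "x \<in> I" "a \<ge> 1" "k \<ge> 1"
  shows "diag_op a \<zeta> x (e x k) = (if k = a then (\<i> * \<zeta> x) *\<^sub>C e x a else 0)"
  using assms by (simp add: diag_op_def e_cinner)

text \<open>The eigenvectors of the jump are \<open>(e\<^sub>a \<mp> i \<omega> e\<^sub>b) / \<surd>2\<close>, where \<open>\<beta> = \<bar>\<beta>\<bar> \<omega>\<close>, with eigenvalues \<open>\<plusminus> i \<bar>\<beta>\<bar>\<close>.\<close>

lemma flow_jump:
  assumes "a \<ge> 1" "b \<ge> 1" "a \<noteq> b"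
  obtains R C K\<^sub>0 where "flow R (jump a b \<beta>) C K\<^sub>0"
proof -
  define \<omega> where "\<omega> x = (if \<beta> x = 0 then 1 else \<beta> x / cmod (\<beta> x))" for x
  have \<omega>: "cmod (\<omega> x) = 1" "\<omega> x * cnj (\<omega> x) = 1" "cmod (\<beta> x) * \<omega> x = \<beta> x"
    "cmod (\<beta> x) * cnj (\<omega> x) = cnj (\<beta> x)" for x
  proof -
    show 1: "cmod (\<omega> x) = 1" by (simp add: \<omega>_def norm_divide)
    show "\<omega> x * cnj (\<omega> x) = 1" using complex_norm_square[of "\<omega> x"] by (simp add: 1)
    show "cmod (\<beta> x) * \<omega> x = \<beta> x" by (simp add: \<omega>_def)
    then show "cmod (\<beta> x) * cnj (\<omega> x) = cnj (\<beta> x)"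
      by (metis complex_cnj_complex_of_real complex_cnj_mult)
  qed
  define c where "c = complex_of_real (1 / sqrt 2)"
  have cc: "c * c = 1/2" "cnj c = c" "c * (c * z) = z / 2" for z
    by (auto simp: c_def simp flip: of_real_mult mult.assoc)
  define v where "v x = c *\<^sub>C e x a - (c * \<i> * \<omega> x) *\<^sub>C e x b" for x
  define u where "u x = c *\<^sub>C e x a + (c * \<i> * \<omega> x) *\<^sub>C e x b" for x
  have F: "v x \<in> F x" "u x \<in> F x" if "x \<in> I" for x
    using e_F[OF that] assms F_sub[of x]
    by (auto simp: v_def u_def complex_vector.subspace_add complex_vector.subspace_diff complex_vector.subspace_scale)
  note ip = cinner_add_left cinner_add_right cinner_diff_left cinner_diff_right cinner_scaleC_left cinner_scaleC_right
  have "cinner (v x) (v x) = 1" "cinner (u x) (u x) = 1" and orth: "cinner (v x) (u x) = 0" if "x \<in> I" for x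
    using e_cinner[OF that] assms \<omega>(2)[of x] by (auto simp: v_def u_def ip cc algebra_simps)
  then have n1: "norm (v x) = 1" "norm (u x) = 1" if "x \<in> I" for x
    using that cinner_self[of "v x"] cinner_self[of "u x"]
    by (metis abs_norm_cancel of_real_eq_1_iff real_sqrt_abs real_sqrt_one)+
  obtain K\<^sub>0 where fl: "flow (\<lambda>x s \<psi>. ph (v x) (cis (cmod (\<beta> x) * s)) (ph (u x) (cis (- cmod (\<beta> x) * s)) \<psi>))
    (\<lambda>x \<psi>. (\<i> * complex_of_real (cmod (\<beta> x)) * cinner \<psi> (v x)) *\<^sub>C v x +
       (\<i> * complex_of_real (- cmod (\<beta> x)) * cinner \<psi> (u x)) *\<^sub>C u x)
    (3 * (1 + (\<Sum>x\<in>I. \<bar>cmod (\<beta> x)\<bar> + \<bar>- cmod (\<beta> x)\<bar>))\<^sup>2) K\<^sub>0"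
    by (rule flow_two_phases[of v u "\<lambda>x. cmod (\<beta> x)" "\<lambda>x. - cmod (\<beta> x)"]) (use F n1 orth in auto)
  show ?thesis
  proof (rule that, rule flow_cong[OF fl])
    fix x \<psi> assume x: "x \<in> I"
    define p q r where "p = cinner \<psi> (e x a)" and "q = cinner \<psi> (e x b)" and "r = complex_of_real (cmod (\<beta> x))"
    have pv: "cinner \<psi> (v x) = c * p + c * \<i> * cnj (\<omega> x) * q" and pu: "cinner \<psi> (u x) = c * p - c * \<i> * cnj (\<omega> x) * q"
      by (auto simp: v_def u_def ip cc p_def q_def)
    have "(\<i> * r * cinner \<psi> (v x)) *\<^sub>C v x + (\<i> * (- r) * cinner \<psi> (u x)) *\<^sub>C u x =
      (\<i> * r * (cinner \<psi> (v x) - cinner \<psi> (u x)) * c) *\<^sub>C e x a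
      - (\<i> * r * (cinner \<psi> (v x) + cinner \<psi> (u x)) * (c * \<i> * \<omega> x)) *\<^sub>C e x b"
      unfolding v_def u_def
      by (simp add: scaleC_add_right scaleC_diff_right scaleC_scaleC scaleC_minus_left algebra_simps
          scaleC_add_left scaleC_diff_left)
    also have "\<i> * r * (cinner \<psi> (v x) - cinner \<psi> (u x)) * c = - ((r * cnj (\<omega> x)) * q)"
      unfolding pv pu using cc by (simp add: algebra_simps)
    also have "\<i> * r * (cinner \<psi> (v x) + cinner \<psi> (u x)) * (c * \<i> * \<omega> x) = - ((r * \<omega> x) * p)"
      unfolding pv pu using cc by (simp add: algebra_simps)
    finally show "jump a b \<beta> x \<psi> = (\<i> * complex_of_real (cmod (\<beta> x)) * cinner \<psi> (v x)) *\<^sub>C v x +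
       (\<i> * complex_of_real (- cmod (\<beta> x)) * cinner \<psi> (u x)) *\<^sub>C u x"
      using \<omega>(3,4)[of x] by (simp add: jump_def p_def q_def r_def scaleC_minus_left)
  qed
qed

text \<open>\<open>lie_bracket\<close> wants an explicit flow for one factor and a bound for the
  other; a jump supplies the flow. The value of the bracket then has to be checked on basis vectors
  only.\<close>

lemma lie_jump_bracket:
  assumes "lie (jump a b \<beta>)" "a \<ge> 1" "b \<ge> 1" "a \<noteq> b" and M: "lie M"
    and lin: "\<And>x. x \<in> I \<Longrightarrow> lin_into (H x) (H x) (M x)"
    and bd: "\<And>x \<psi>. x \<in> I \<Longrightarrow> \<psi> \<in> H x \<Longrightarrow> norm (M x \<psi>) \<le> D * norm \<psi>" and D: "D \<ge> 0"
    and lin': "\<And>x. x \<in> I \<Longrightarrow> lin_into (H x) (H x) (M' x)"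
    and eq: "\<And>x k. x \<in> I \<Longrightarrow> k \<ge> 1 \<Longrightarrow> M' x (e x k) = jump a b \<beta> x (M x (e x k)) - M x (jump a b \<beta> x (e x k))"
  shows "lie M'"
proof -
  obtain R C K\<^sub>0 where fl: "flow R (jump a b \<beta>) C K\<^sub>0" using flow_jump assms(2-4) by blast
  show ?thesis
    by (rule lie_cong[OF lie_bracket[OF fl assms(1) M lin bd D] lin_F[OF _ lin'] eq])
qed

lemma lie_jump_mult_real:
  "lie (jump a b \<beta>) \<Longrightarrow> lie (jump a b (\<lambda>x. of_real r * \<beta> x))"
proof -
  have "(\<lambda>x \<psi>. r *\<^sub>R jump a b \<beta> x \<psi>) = jump a b (\<lambda>x. of_real r * \<beta> x)"
    by (simp add: jump_def fun_eq_iff scaleR_scaleC scaleC_diff_right scaleC_scaleC mult.assoc)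
  then show "lie (jump a b \<beta>) \<Longrightarrow> ?thesis" using lie_scale[of "jump a b \<beta>" r] by simp
qed

lemma lie_jump_diff:
  assumes "lie (jump a b \<beta>)" "lie (jump a b \<gamma>)"
  shows "lie (jump a b (\<lambda>x. \<beta> x - \<gamma> x))"
proof -
  have "(\<lambda>x \<psi>. jump a b \<beta> x \<psi> - jump a b \<gamma> x \<psi>) = jump a b (\<lambda>x. \<beta> x - \<gamma> x)"
    by (simp add: jump_def fun_eq_iff scaleC_diff_left left_diff_distrib)
  then show ?thesis using lie_minus[OF assms] by simp
qed

text \<open>The su(2) relation in the plane of \<open>e x a\<close> and \<open>e x b\<close>: two
  off-diagonal generators bracket to a diagonal one whose size depends on their relative
  phase.\<close>

lemma lie_diag_diff:
  assumes "lie (jump a b \<beta>)" "lie (jump a b \<gamma>)" "a \<ge> 1" "b \<ge> 1" "a \<noteq> b"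
    and "\<And>x. x \<in> I \<Longrightarrow> \<zeta> x = 2 * Im (\<beta> x * cnj (\<gamma> x))"
  shows "lie (\<lambda>x \<psi>. diag_op a \<zeta> x \<psi> - diag_op b \<zeta> x \<psi>)"
proof (rule lie_jump_bracket[OF assms(1,3,4,5,2)])
  fix x assume x: "x \<in> I"
  show "lin_into (H x) (H x) (jump a b \<gamma> x)" using x assms by (intro jump_lin)
  show "norm (jump a b \<gamma> x \<psi>) \<le> (2 * (\<Sum>x\<in>I. cmod (\<gamma> x))) * norm \<psi>" for \<psi>
    using x assms by (intro jump_bound)
  show "lin_into (H x) (H x) (\<lambda>\<psi>. diag_op a \<zeta> x \<psi> - diag_op b \<zeta> x \<psi>)"
    using x assms by (intro lin_into_minus_fun diag_op_lin H_sub)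
  have "\<i> * complex_of_real (\<zeta> x) = \<beta> x * cnj (\<gamma> x) - cnj (\<beta> x) * \<gamma> x"
    unfolding assms(6)[OF x] by (rule complex_eqI) (simp_all add: algebra_simps)
  then have z: "(\<i> * complex_of_real (\<zeta> x)) *\<^sub>C w = (\<beta> x * cnj (\<gamma> x)) *\<^sub>C w - (cnj (\<beta> x) * \<gamma> x) *\<^sub>C w" for w :: 'h
    by (simp add: scaleC_diff_left)
  fix k :: nat assume k: "k \<ge> 1"
  note t = jump_basis[OF x assms(3,4,5)]
  show "diag_op a \<zeta> x (e x k) - diag_op b \<zeta> x (e x k) =
    jump a b \<beta> x (jump a b \<gamma> x (e x k)) - jump a b \<gamma> x (jump a b \<beta> x (e x k))"
    unfolding diag_op_basis[OF x assms(3) k] diag_op_basis[OF x assms(4) k] t[OF k]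
    using t[OF assms(3)] t[OF assms(4)] assms(5)
    by (simp add: jump_hom z scaleC_scaleC scaleC_minus_left mult_ac)
qed (simp add: sum_nonneg)

text \<open>A diagonal difference multiplies the strength by \<open>2 * \<i> * \<zeta> x\<close>,
  separately in each system. Together with \<open>lie_diag_diff\<close> this lets brackets treat
  systems with different couplings differently.\<close>

lemma lie_jump_diag:
  assumes "lie (jump a b \<beta>)" "lie (\<lambda>x \<psi>. diag_op a \<zeta> x \<psi> - diag_op b \<zeta> x \<psi>)" "a \<ge> 1" "b \<ge> 1" "a \<noteq> b"
  shows "lie (jump a b (\<lambda>x. 2 * \<i> * \<zeta> x * \<beta> x))"
proof (rule lie_jump_bracket[OF assms(1,3,4,5,2)])
  fix x assume x: "x \<in> I"
  show "lin_into (H x) (H x) (\<lambda>\<psi>. diag_op a \<zeta> x \<psi> - diag_op b \<zeta> x \<psi>)"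
    using x assms by (intro lin_into_minus_fun diag_op_lin H_sub)
  show "norm (diag_op a \<zeta> x \<psi> - diag_op b \<zeta> x \<psi>) \<le> (2 * (\<Sum>x\<in>I. \<bar>\<zeta> x\<bar>)) * norm \<psi>" for \<psi>
    unfolding mult_2 distrib_right
    by (rule norm_triangle_le_diff[OF add_mono[OF diag_op_bound[OF x assms(3)] diag_op_bound[OF x assms(4)]]])
  show "lin_into (H x) (H x) (jump a b (\<lambda>x. 2 * \<i> * \<zeta> x * \<beta> x) x)" using x assms by (intro jump_lin)
  note t = jump_basis[OF x assms(3,4,5)]
  fix k :: nat assume k: "k \<ge> 1"
  show "jump a b (\<lambda>x. 2 * \<i> * \<zeta> x * \<beta> x) x (e x k) =
    jump a b \<beta> x (diag_op a \<zeta> x (e x k) - diag_op b \<zeta> x (e x k)) -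
    (diag_op a \<zeta> x (jump a b \<beta> x (e x k)) - diag_op b \<zeta> x (jump a b \<beta> x (e x k)))"
  proof -
    consider "k = a" | "k = b" | "k \<noteq> a" "k \<noteq> b" by blast
    then show ?thesis
    proof cases
      case 1
      then show ?thesis using assms x
        by (simp add: diag_op_basis t diag_op_hom jump_hom scaleC_scaleC scaleC_minus_left mult_ac flip: scaleC_add_left)
    next
      case 2
      then show ?thesis using assms x
        by (simp add: diag_op_basis t diag_op_hom jump_hom scaleC_scaleC scaleC_minus_left mult_ac flip: scaleC_add_left)
    next
      case 3
      then show ?thesis using assms x k by (simp add: diag_op_basis t diag_op_hom jump_hom)
    qed
  qed
qed (simp add: sum_nonneg)

text \<open>For three distinct indices only the path from \<open>a\<close> through \<open>b\<close>
  to \<open>c\<close> and its adjoint survive in the bracket, so strengths multiply along the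
  path.\<close>

lemma lie_jump_chain:
  assumes "lie (jump a b \<beta>)" "lie (jump b c \<gamma>)" "a \<ge> 1" "b \<ge> 1" "c \<ge> 1" "a \<noteq> b" "b \<noteq> c" "a \<noteq> c"
  shows "lie (jump a c (\<lambda>x. \<beta> x * \<gamma> x))"
proof (rule lie_jump_bracket[OF assms(2,4,5,7,1)])
  fix x assume x: "x \<in> I"
  show "lin_into (H x) (H x) (jump a b \<beta> x)" using x assms by (intro jump_lin)
  show "norm (jump a b \<beta> x \<psi>) \<le> (2 * (\<Sum>x\<in>I. cmod (\<beta> x))) * norm \<psi>" for \<psi>
    using x assms by (intro jump_bound)
  show "lin_into (H x) (H x) (jump a c (\<lambda>x. \<beta> x * \<gamma> x) x)" using x assms by (intro jump_lin)
  fix k :: nat assume k: "k \<ge> 1"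
  show "jump a c (\<lambda>x. \<beta> x * \<gamma> x) x (e x k) =
    jump b c \<gamma> x (jump a b \<beta> x (e x k)) - jump a b \<beta> x (jump b c \<gamma> x (e x k))"
    using assms x k
    by (auto simp: jump_basis jump_hom scaleC_scaleC scaleC_minus_left mult_ac)
qed (simp add: sum_nonneg)

end

section \<open>Isolating one transition of one system within its class\<close>

text \<open>Systems of the same class \<open>cl\<close> share the drift, so only the couplings can tell them apart.\<close>

locale phased_family = controlled_family I H e W U
  for I :: "'x set" and H :: "'x \<Rightarrow> 'h::complex_inner set" and e W U +
  fixes cl :: "'x \<Rightarrow> 'c" and B :: "'x \<Rightarrow> 'h \<Rightarrow> 'h"
  assumes phase_reach: "\<And>i m z. m \<ge> 1 \<Longrightarrow> cmod z = 1 \<Longrightarrow>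
      reach (\<lambda>x. ph (if cl x = i then e x m else 0) z) 0"
    and long_wait: "\<And>K \<eta> T. \<eta> > 0 \<Longrightarrow> \<exists>w. adm w \<and> dur w > T \<and> ctrl w \<eta> K \<and>
      (\<forall>x\<in>I. \<forall>k\<in>{1..K}. norm (ev x w (e x k) - e x k) \<le> \<eta>)"
    and lie_B: "lie B"
    and B_skew: "\<And>x k l. x \<in> I \<Longrightarrow> k \<ge> 1 \<Longrightarrow> l \<ge> 1 \<Longrightarrow>
      cinner (B x (e x l)) (e x k) = - cnj (cinner (B x (e x k)) (e x l))"
    and B_chain: "\<And>x. x \<in> I \<Longrightarrow> \<exists>S. connectedness_chain (\<lambda>(k, l). cinner (B x (e x k)) (e x l)) S \<and>
      (\<forall>(k, l)\<in>S. \<forall>y\<in>I. cl y = cl x \<longrightarrow> y \<noteq> x \<longrightarrow>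
        cmod (cinner (B x (e x k)) (e x l)) \<noteq> cmod (cinner (B y (e y k)) (e y l)))"
begin

abbreviation coup :: "'x \<Rightarrow> nat \<Rightarrow> nat \<Rightarrow> complex" where
  "coup x k l \<equiv> cinner (B x (e x k)) (e x l)"

text \<open>The phase acts on a whole class at once, as free evolution does not distinguish its
  members. It is reached with deviation 0, so conjugation by it preserves
  \<open>lie\<close>.\<close>

definition ph1 :: "'c \<Rightarrow> nat \<Rightarrow> complex \<Rightarrow> 'x \<Rightarrow> 'h \<Rightarrow> 'h" where
  "ph1 i m z x = ph (if cl x = i then e x m else 0) z"

lemma lie_ph1:
  assumes "lie M" "m \<ge> 1" "cmod z = 1"
  shows "lie (\<lambda>x \<psi>. ph1 i m z x (M x (ph1 i m (cnj z) x \<psi>)))"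
proof (rule lie_conj[OF _ _ assms(1)])
  show "reach (ph1 i m z) 0" "reach (ph1 i m (cnj z)) 0"
    unfolding ph1_def using phase_reach assms(2,3) by auto
  have "z * cnj z = 1" using assms(3) complex_norm_square[of z] by simp
  then show "ph1 i m z x (ph1 i m (cnj z) x \<psi>) = \<psi>" if "x \<in> I" for x \<psi>
    using e_norm[OF that assms(2)] by (simp add: ph1_def ph_mult)
  show "ph1 i m (cnj z) x \<psi> \<in> F x" if "x \<in> I" "\<psi> \<in> F x" for x \<psi>
    using that e_F[OF that(1) assms(2)] F_sub[of x]
    by (auto simp: ph1_def ph_def intro!: complex_vector.subspace_add complex_vector.subspace_scale)
qed

lemma ph1_uminus: "ph1 i m z x (- \<psi>) = - ph1 i m z x \<psi>"
  by (simp add: ph1_def ph_def cinner_minus_left scaleC_minus_left)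

lemma ph1_basis:
  assumes "x \<in> I" "m \<ge> 1" "k \<ge> 1"
  shows "ph1 i m z x (e x k) = (if cl x = i \<and> k = m then z else 1) *\<^sub>C e x k"
  using assms e_norm by (auto simp: ph1_def ph_self ph_orth e_cinner)

lemma ph1_basis_scaleC:
  assumes "x \<in> I" "m \<ge> 1" "k \<ge> 1"
  shows "ph1 i m z x (c *\<^sub>C e x k) = (c * (if cl x = i \<and> k = m then z else 1)) *\<^sub>C e x k"
proof -
  have "ph1 i m z x (c *\<^sub>C e x k) = c *\<^sub>C ph1 i m z x (e x k)"
    by (simp add: ph1_def ph_def cinner_scaleC_left scaleC_add_right scaleC_scaleC mult_ac)
  then show ?thesis using ph1_basis[OF assms] by (simp add: scaleC_scaleC)
qed

text \<open>Averaging over the sign of a basis vector removes all its transitions.\<close>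

lemma lie_decoupled:
  assumes "finite S" "S \<subseteq> UNIV \<times> {1..}"
  shows "\<exists>M. lie M \<and> (\<forall>x\<in>I. \<forall>k\<ge>1. M x (e x k) =
    (if (cl x, k) \<in> S then coup x k k *\<^sub>C e x k
     else B x (e x k) - (\<Sum>m | (cl x, m) \<in> S. coup x k m *\<^sub>C e x m)))"
  using assms
proof (induction S rule: finite_induct)
  case empty
  then show ?case using lie_B by auto
next
  case (insert p S)
  obtain i m where p: "p = (i, m)" by force
  have m: "m \<ge> 1" and new: "(i, m) \<notin> S" using insert p by auto
  obtain M where M: "lie M" and Mk: "\<And>x k. x \<in> I \<Longrightarrow> k \<ge> 1 \<Longrightarrow> M x (e x k) =
    (if (cl x, k) \<in> S then coup x k k *\<^sub>C e x k
     else B x (e x k) - (\<Sum>m | (cl x, m) \<in> S. coup x k m *\<^sub>C e x m))"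
    using insert by auto
  \<comment> \<open>\<open>cnj (- 1)\<close> is just \<open>- 1\<close>, written in the form in
    which \<open>lie_ph1\<close> produces it.\<close>
  define N where "N x \<psi> = (1/2) *\<^sub>R (M x \<psi> + ph1 i m (- 1) x (M x (ph1 i m (cnj (- 1)) x \<psi>)))" for x \<psi>
  have "lie N" unfolding N_def using M m by (intro lie_scale lie_add lie_ph1) auto
  moreover have "N x (e x k) = (if (cl x, k) \<in> insert p S then coup x k k *\<^sub>C e x k
     else B x (e x k) - (\<Sum>m | (cl x, m) \<in> insert p S. coup x k m *\<^sub>C e x m))" if x: "x \<in> I" and k: "k \<ge> 1" for x k
  proof (cases "cl x = i")
    case False
    then have "{m. (cl x, m) \<in> insert p S} = {m. (cl x, m) \<in> S}" "(cl x, k) \<in> insert p S \<longleftrightarrow> (cl x, k) \<in> S"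
      by (auto simp: p)
    moreover have "N x (e x k) = M x (e x k)" using False by (simp add: N_def ph1_def flip: scaleR_2)
    ultimately show ?thesis using Mk[OF x k] by simp
  next
    case True
    define S' where "S' = {m. (cl x, m) \<in> S}"
    have fin: "finite S'"
    proof -
      have "S' \<subseteq> snd ` S" unfolding S'_def by force
      then show ?thesis using insert(1) finite_subset by blast
    qed
    have S'1: "l \<ge> 1" if "l \<in> S'" for l using that insert by (auto simp: S'_def)
    have mS': "m \<notin> S'" using new True by (simp add: S'_def)
    have ins: "{l. (cl x, l) \<in> insert p S} = insert m S'" using True by (auto simp: p S'_def)
    define y where "y = M x (e x k)"
    have flip: "ph1 i m (- 1) x \<psi> = \<psi> - (2 * cinner \<psi> (e x m)) *\<^sub>C e x m" for \<psi>
      using True by (simp add: ph1_def ph_def scaleC_minus_left)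
    have Mlin: "lin_into (F x) (H x) (M x)" by (rule lie_lin[OF M x])
    have half: "(1/2) *\<^sub>R ((2 * c) *\<^sub>C w) = c *\<^sub>C w" for c and w :: 'h by (simp add: scaleR_scaleC scaleC_scaleC)
    show ?thesis
    proof (cases "k = m")
      case km: True
      have "ph1 i m (cnj (- 1)) x (e x k) = - e x k"
        using ph1_basis[OF x m k] True km by (simp add: scaleC_minus_left)
      then have "N x (e x k) = (1/2) *\<^sub>R (y - (y - (2 * cinner y (e x m)) *\<^sub>C e x m))"
        using lin_into_minus[OF Mlin e_F[OF x k]]
        by (simp add: N_def y_def flip cinner_minus_left scaleC_minus_left)
      then have N: "N x (e x k) = cinner y (e x m) *\<^sub>C e x m" by (simp add: half)
      have "(\<Sum>l\<in>S'. cinner (coup x k l *\<^sub>C e x l) (e x m)) = 0"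
        using mS' S'1 x m by (intro sum.neutral) (auto simp: cinner_scaleC_left e_cinner)
      then have "cinner y (e x m) = coup x m m"
        using Mk[OF x k] new km True
        by (simp add: y_def S'_def cinner_diff_left cinner_sum_left)
      then show ?thesis using N km True by (simp add: p)
    next
      case km: False
      have "ph1 i m (cnj (- 1)) x (e x k) = e x k"
        using ph1_basis[OF x m k] km by simp
      then have "N x (e x k) = (1/2) *\<^sub>R (y + ph1 i m (- 1) x y)" by (simp only: N_def y_def)
      then have "N x (e x k) = (1/2) *\<^sub>R (2 *\<^sub>R y - (2 * cinner y (e x m)) *\<^sub>C e x m)"
        by (simp add: flip scaleR_2)
      then have N: "N x (e x k) = y - cinner y (e x m) *\<^sub>C e x m"
        by (simp add: scaleR_diff_right half)
      show ?thesis
      proof (cases "(cl x, k) \<in> S")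
        case True
        then have "y = coup x k k *\<^sub>C e x k" using Mk[OF x k] by (simp add: y_def)
        then show ?thesis using N True km x k m by (simp add: cinner_scaleC_left e_cinner)
      next
        case kS: False
        then have y: "y = B x (e x k) - (\<Sum>l\<in>S'. coup x k l *\<^sub>C e x l)"
          using Mk[OF x k] by (simp add: y_def S'_def)
        have "(\<Sum>l\<in>S'. cinner (coup x k l *\<^sub>C e x l) (e x m)) = 0"
          using mS' S'1 x m by (intro sum.neutral) (auto simp: cinner_scaleC_left e_cinner)
        then have "cinner y (e x m) = coup x k m" by (simp add: y cinner_diff_left cinner_sum_left)
        then have "N x (e x k) = B x (e x k) - (\<Sum>l\<in>insert m S'. coup x k l *\<^sub>C e x l)"
          using N fin mS' by (simp add: y)
        then show ?thesis unfolding ins using kS km by (simp add: p)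
      qed
    qed
  qed
  ultimately show ?case by blast
qed

text \<open>Only finitely many signs can be averaged, so \<open>e x a\<close> stays coupled to high
  indices. What remains there is the tail of \<open>B x (e x a)\<close> beyond \<open>M0\<close>,
  which tends to 0; hence the passage to a limit. Skewness of \<open>B\<close> supplies the matching
  entry at \<open>e x b\<close>.\<close>

lemma lie_transition:
  assumes a: "a \<ge> 1" and b: "b \<ge> 1" and ab: "a \<noteq> b"
  shows "lie (jump a b (\<lambda>x. if cl x = i then coup x a b else 0))"
proof (rule lie_limit)
  let ?\<beta> = "\<lambda>x. if cl x = i then coup x a b else 0"
  show "lin_into (F x) (H x) (jump a b ?\<beta> x)" if "x \<in> I" for x
    using that a b by (intro lin_F jump_lin)
  fix K and \<eta> :: real assume \<eta>: "\<eta> > 0"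
  have BH: "B x (e x a) \<in> H x" if "x \<in> I" for x
    using lin_into_mem[OF lie_lin[OF lie_B that] e_F[OF that a]] .
  have "\<forall>\<^sub>F M0 in sequentially. \<forall>x\<in>I. norm (B x (e x a) - bproj (e x) M0 (B x (e x a))) < \<eta>"
  proof (intro eventually_ball_finite finite_I ballI)
    fix x assume x: "x \<in> I"
    show "\<forall>\<^sub>F M0 in sequentially. norm (B x (e x a) - bproj (e x) M0 (B x (e x a))) < \<eta>"
      using bproj_approx[OF hs[OF x] hb[OF x] BH[OF x] \<eta>] unfolding eventually_sequentially by metis
  qed
  then obtain M1 where M1: "\<And>M0 x. M0 \<ge> M1 \<Longrightarrow> x \<in> I \<Longrightarrow> norm (B x (e x a) - bproj (e x) M0 (B x (e x a))) < \<eta>"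
    unfolding eventually_sequentially by blast
  define M0 where "M0 = Max {M1, K, a, b}"
  have M0: "M0 \<ge> M1" "M0 \<ge> K" "M0 \<ge> a" "M0 \<ge> b" by (auto simp: M0_def)
  \<comment> \<open>All indices up to \<open>M0\<close> in all classes are decoupled, except the two
    that are to stay connected.\<close>
  define S where "S = (cl ` I) \<times> {1..M0} - {(i, a), (i, b)}"
  have "finite S" "S \<subseteq> UNIV \<times> {1..}" using finite_I by (auto simp: S_def)
  from lie_decoupled[OF this] obtain M where M: "lie M" and Mk: "\<And>x k. x \<in> I \<Longrightarrow> k \<ge> 1 \<Longrightarrow> M x (e x k) =
    (if (cl x, k) \<in> S then coup x k k *\<^sub>C e x k
     else B x (e x k) - (\<Sum>m | (cl x, m) \<in> S. coup x k m *\<^sub>C e x m))"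
    by blast
  \<comment> \<open>The odd part under the sign flip of \<open>e x a\<close> in class
    \<open>i\<close>: it keeps the entries with exactly one index equal to \<open>a\<close> and
    annihilates the other classes.\<close>
  define N where "N x \<psi> = (1/2) *\<^sub>R (M x \<psi> - ph1 i a (- 1) x (M x (ph1 i a (cnj (- 1)) x \<psi>)))" for x \<psi>
  have "lie N" unfolding N_def using M a by (intro lie_scale lie_minus lie_ph1) auto
  moreover have "norm (N x (e x k) - jump a b ?\<beta> x (e x k)) \<le> \<eta>" if x: "x \<in> I" and k: "k \<in> {1..K}" for x k
  proof (cases "cl x = i")
    case False
    then show ?thesis using \<eta> by (simp add: N_def ph1_def jump_def)
  next
    case True
    have k1: "k \<ge> 1" and kM: "k \<le> M0" using k M0 by auto
    define y where "y = M x (e x k)"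
    have flip: "ph1 i a (- 1) x \<psi> = \<psi> - (2 * cinner \<psi> (e x a)) *\<^sub>C e x a" for \<psi>
      using True by (simp add: ph1_def ph_def scaleC_minus_left)
    have Mlin: "lin_into (F x) (H x) (M x)" by (rule lie_lin[OF M x])
    have half: "(1/2) *\<^sub>R ((2 * c) *\<^sub>C w) = c *\<^sub>C w" for c and w :: 'h by (simp add: scaleR_scaleC scaleC_scaleC)
    have Sx: "{m. (cl x, m) \<in> S} = {1..M0} - {a, b}" using True x by (auto simp: S_def)
    have sum0: "(\<Sum>l\<in>{1..M0} - {a, b}. cinner (coup x k l *\<^sub>C e x l) (e x a)) = 0"
      using x a by (intro sum.neutral) (auto simp: cinner_scaleC_left e_cinner)
    note jb = jump_basis[OF x a b ab k1]
    consider "k = a" | "k = b" | "k \<noteq> a" "k \<noteq> b" by blast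
    then show ?thesis
    proof cases
      case 1
      then have "ph1 i a (cnj (- 1)) x (e x k) = - e x k"
        using ph1_basis[OF x a k1] True by (simp add: scaleC_minus_left)
      then have "N x (e x k) = (1/2) *\<^sub>R (2 *\<^sub>R y - (2 * cinner y (e x a)) *\<^sub>C e x a)"
        using lin_into_minus[OF Mlin e_F[OF x k1]]
        by (simp add: N_def y_def flip cinner_minus_left scaleC_minus_left scaleR_2)
      then have N: "N x (e x k) = y - cinner y (e x a) *\<^sub>C e x a"
        by (simp add: scaleR_diff_right half)
      have nS: "(cl x, k) \<notin> S" using 1 True by (simp add: S_def)
      have y: "y = B x (e x a) - (\<Sum>l\<in>{1..M0} - {a, b}. coup x a l *\<^sub>C e x l)"
        unfolding y_def Mk[OF x k1] Sx using nS 1 by simp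
      have "cinner y (e x a) = coup x a a" using sum0 1 by (simp add: y cinner_diff_left cinner_sum_left)
      moreover have "bproj (e x) M0 (B x (e x a)) = coup x a a *\<^sub>C e x a + (coup x a b *\<^sub>C e x b +
        (\<Sum>l\<in>{1..M0} - {a, b}. coup x a l *\<^sub>C e x l))"
      proof -
        define T where "T = {1..M0} - {a, b}"
        have "{1..M0} = insert a (insert b T)" "a \<notin> T" "b \<notin> T" "finite T"
          using M0 a b by (auto simp: T_def)
        then show ?thesis using ab unfolding bproj_def T_def[symmetric] by simp
      qed
      ultimately have "N x (e x k) - jump a b ?\<beta> x (e x k) = B x (e x a) - bproj (e x) M0 (B x (e x a))"
        using N 1 True jb by (simp add: y algebra_simps)
      then show ?thesis using M1[OF M0(1) x] by simp
    next
      case 2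
      then have "ph1 i a (cnj (- 1)) x (e x k) = e x k"
        using ph1_basis[OF x a k1] ab by simp
      then have "N x (e x k) = (1/2) *\<^sub>R (y - ph1 i a (- 1) x y)" by (simp only: N_def y_def)
      then have N: "N x (e x k) = cinner y (e x a) *\<^sub>C e x a"
        by (simp add: flip half)
      have nS: "(cl x, k) \<notin> S" using 2 True by (simp add: S_def)
      have y: "y = B x (e x b) - (\<Sum>l\<in>{1..M0} - {a, b}. coup x b l *\<^sub>C e x l)"
        unfolding y_def Mk[OF x k1] Sx using nS 2 by simp
      have "cinner y (e x a) = coup x b a" using sum0 2 by (simp add: y cinner_diff_left cinner_sum_left)
      then show ?thesis using N 2 True ab jb B_skew[OF x a b] \<eta> by simp
    next
      case 3
      then have "ph1 i a (cnj (- 1)) x (e x k) = e x k"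
        using ph1_basis[OF x a k1] by simp
      then have "N x (e x k) = (1/2) *\<^sub>R (y - ph1 i a (- 1) x y)" by (simp only: N_def y_def)
      then have N: "N x (e x k) = cinner y (e x a) *\<^sub>C e x a"
        by (simp add: flip half)
      have "(cl x, k) \<in> S" using 3 x k1 kM by (auto simp: S_def)
      then have "y = coup x k k *\<^sub>C e x k" using Mk[OF x k1] by (simp add: y_def)
      then have "cinner y (e x a) = 0" using 3 x a k1 by (simp add: cinner_scaleC_left e_cinner)
      then show ?thesis using N 3 jb \<eta> by simp
    qed
  qed
  ultimately show "\<exists>M'. lie M' \<and> (\<forall>x\<in>I. \<forall>k\<in>{1..K}. norm (M' x (e x k) - jump a b ?\<beta> x (e x k)) \<le> \<eta>)"
    by blast
qed

text \<open>Conjugation by a phase on \<open>e x a\<close> rotates the strength and a real factor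
  rescales it. The phase acts in class \<open>i\<close> alone, hence the condition on the support of
  \<open>\<beta>\<close>.\<close>

lemma lie_jump_mult:
  assumes "lie (jump a b \<beta>)" "a \<ge> 1" "b \<ge> 1" "a \<noteq> b" and supp: "\<And>x. cl x \<noteq> i \<Longrightarrow> \<beta> x = 0"
  shows "lie (jump a b (\<lambda>x. z * \<beta> x))"
proof (cases "z = 0")
  case True
  then show ?thesis using lie_zero by (simp add: jump_def[abs_def])
next
  case False
  define w where "w = cnj (z / cmod z)"
  have w: "cmod w = 1" "cmod z * cnj w = z" using False by (auto simp: w_def norm_divide)
  have "lie (jump a b (\<lambda>x. cnj w * \<beta> x))"
  proof (rule lie_cong[OF lie_ph1[OF assms(1,2) w(1)]])
    fix x assume x: "x \<in> I"
    show "lin_into (F x) (H x) (jump a b (\<lambda>x. cnj w * \<beta> x) x)" using x assms by (intro lin_F jump_lin)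
    fix k :: nat assume k: "k \<ge> 1"
    note jb = jump_basis[OF x assms(2,3,4)]
    have p0: "ph1 i a w x 0 = 0" by (simp add: ph1_def ph_def)
    show "jump a b (\<lambda>x. cnj w * \<beta> x) x (e x k) = ph1 i a w x (jump a b \<beta> x (ph1 i a (cnj w) x (e x k)))"
      unfolding ph1_basis[OF x assms(2) k] jump_hom jb[OF k]
      using assms x supp[of x]
      by (auto simp: p0 ph1_uminus ph1_basis_scaleC scaleC_scaleC scaleC_minus_left mult_ac ph1_basis)
  qed
  from lie_jump_mult_real[OF this, of "cmod z"] show ?thesis
    by (simp add: w(2) flip: mult.assoc)
qed

text \<open>A double bracket multiplies the coupling of each system by its squared modulus.\<close>

lemma lie_jump_poly:
  assumes a: "a \<ge> 1" and b: "b \<ge> 1" and ab: "a \<noteq> b" and "finite J"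
    and \<beta>: "\<And>z. lie (jump a b (\<lambda>x. z * \<beta> x))"
  shows "lie (jump a b (\<lambda>x. z * (of_real (\<Prod>c\<in>J. (cmod (\<beta> x))\<^sup>2 - c) * \<beta> x)))"
  using assms(4)
proof (induction J arbitrary: z rule: finite_induct)
  case empty
  then show ?case using \<beta> by simp
next
  case (insert c J)
  define q where "q x = (\<Prod>c\<in>J. (cmod (\<beta> x))\<^sup>2 - c)" for x
  have IH: "lie (jump a b (\<lambda>x. z * (of_real (q x) * \<beta> x)))" for z
    using insert.IH by (simp add: q_def)
  define \<zeta> where "\<zeta> x = 2 * q x * (cmod (\<beta> x))\<^sup>2" for x
  have "lie (\<lambda>x \<psi>. diag_op a \<zeta> x \<psi> - diag_op b \<zeta> x \<psi>)"
  proof (rule lie_diag_diff[OF \<beta>[of \<i>] IH[of 1] a b ab])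
    fix x
    show "\<zeta> x = 2 * Im (\<i> * \<beta> x * cnj (1 * (of_real (q x) * \<beta> x)))"
      unfolding \<zeta>_def cmod_power2 by (simp add: algebra_simps power2_eq_square)
  qed
  \<comment> \<open>The divisor \<open>4 * \<i>\<close> cancels the factor \<open>2 * \<i>\<close>
    of \<open>lie_jump_diag\<close> and the 2 in \<open>\<zeta>\<close>.\<close>
  from lie_jump_diag[OF \<beta>[of "z / (4 * \<i>)"] this a b ab]
  have "lie (jump a b (\<lambda>x. z * (of_real (q x * (cmod (\<beta> x))\<^sup>2) * \<beta> x)))"
    by (simp add: \<zeta>_def mult_ac)
  from lie_jump_diff[OF this IH[of "z * of_real c"]]
  show ?case using insert by (simp add: q_def algebra_simps)
qed

definition indep_pair :: "'x \<Rightarrow> nat \<Rightarrow> nat \<Rightarrow> bool" where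
  "indep_pair x0 a b \<longleftrightarrow> (\<forall>\<gamma>. lie (jump a b (\<lambda>x. if x = x0 then \<gamma> else 0)))"

text \<open>Lagrange interpolation in the squared moduli: the product over \<open>J\<close> vanishes
  at every other system of the class and, the moduli being distinct, not at \<open>x0\<close>. The
  other classes are already absent from \<open>\<beta>\<close>.\<close>

lemma indep_pair_edge:
  assumes x0: "x0 \<in> I" and a: "a \<ge> 1" and b: "b \<ge> 1" and ab: "a \<noteq> b" and nz: "coup x0 a b \<noteq> 0"
    and dist: "\<And>y. y \<in> I \<Longrightarrow> cl y = cl x0 \<Longrightarrow> y \<noteq> x0 \<Longrightarrow> cmod (coup x0 a b) \<noteq> cmod (coup y a b)"
  shows "indep_pair x0 a b"
  unfolding indep_pair_def
proof
  fix \<gamma>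
  define \<beta> where "\<beta> x = (if cl x = cl x0 then coup x a b else 0)" for x
  have "lie (jump a b \<beta>)" unfolding \<beta>_def by (rule lie_transition[OF a b ab])
  then have \<beta>: "lie (jump a b (\<lambda>x. z * \<beta> x))" for z
    using a b ab by (rule lie_jump_mult[where i = "cl x0"]) (simp add: \<beta>_def)
  define J where "J = (\<lambda>y. (cmod (coup y a b))\<^sup>2) ` {y\<in>I. cl y = cl x0 \<and> y \<noteq> x0}"
  have fin: "finite J" using finite_I by (simp add: J_def)
  define q where "q x = (\<Prod>c\<in>J. (cmod (\<beta> x))\<^sup>2 - c)" for x
  have q0: "q x0 \<noteq> 0"
    unfolding q_def using fin dist by (auto simp: J_def \<beta>_def power2_eq_iff_nonneg)
  \<comment> \<open>Normalises the interpolation so that the strength at \<open>x0\<close> becomes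
    exactly \<open>\<gamma>\<close>.\<close>
  define z where "z = \<gamma> / (of_real (q x0) * \<beta> x0)"
  have "lie (jump a b (\<lambda>x. z * (of_real (q x) * \<beta> x)))"
    unfolding q_def by (rule lie_jump_poly[OF a b ab fin \<beta>])
  moreover
  have "z * (of_real (q x) * \<beta> x) = (if x = x0 then \<gamma> else 0)" if "x \<in> I" for x
  proof -
    consider "x = x0" | "x \<noteq> x0" "cl x = cl x0" | "cl x \<noteq> cl x0" by blast
    then show ?thesis
    proof cases
      case 1
      then show ?thesis using q0 nz by (simp add: z_def \<beta>_def)
    next
      case 2
      then have "(cmod (\<beta> x))\<^sup>2 \<in> J" using that by (auto simp: J_def \<beta>_def)
      then have "q x = 0" unfolding q_def using fin by auto
      then show ?thesis using 2 by simp
    next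
      case 3
      then show ?thesis by (auto simp: \<beta>_def)
    qed
  qed
  then have "jump a b (\<lambda>x. if x = x0 then \<gamma> else 0) x \<psi> = jump a b (\<lambda>x. z * (of_real (q x) * \<beta> x)) x \<psi>"
    if "x \<in> I" for x \<psi>
    using that by (simp add: jump_def)
  ultimately show "lie (jump a b (\<lambda>x. if x = x0 then \<gamma> else 0))"
    using a b by (elim lie_cong) (auto intro!: lin_F jump_lin)
qed

lemma indep_pair_chain:
  assumes "indep_pair x0 a b" "indep_pair x0 b c" "a \<ge> 1" "b \<ge> 1" "c \<ge> 1" "a \<noteq> b" "b \<noteq> c" "a \<noteq> c"
  shows "indep_pair x0 a c"
  unfolding indep_pair_def
proof
  fix \<gamma>
  have 1: "lie (jump a b (\<lambda>x. if x = x0 then \<gamma> else 0))" using assms(1) by (simp add: indep_pair_def)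
  have 2: "lie (jump b c (\<lambda>x. if x = x0 then 1 else 0))" using assms(2) by (simp add: indep_pair_def)
  have "(\<lambda>x. (if x = x0 then \<gamma> else 0) * (if x = x0 then 1 else 0)) = (\<lambda>x. if x = x0 then \<gamma> else 0)"
    by auto
  then show "lie (jump a c (\<lambda>x. if x = x0 then \<gamma> else 0))"
    using lie_jump_chain[OF 1 2 assms(3-8)] by simp
qed

text \<open>Induction along a path of the chain, with the invariant that the path stands at
  \<open>a\<close> or at an index to which the transition from \<open>a\<close> can be driven in
  \<open>x0\<close> alone. Each edge of the path is independent by
  \<open>indep_pair_edge\<close>.\<close>

lemma indep_pair_all:
  assumes x0: "x0 \<in> I" and a: "a \<ge> 1" and b: "b \<ge> 1" and ab: "a \<noteq> b"
  shows "indep_pair x0 a b"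
proof -
  let ?b = "\<lambda>(k, l). coup x0 k l"
  obtain S where S: "connectedness_chain ?b S" and
    dist: "\<And>k l y. (k, l) \<in> S \<Longrightarrow> y \<in> I \<Longrightarrow> cl y = cl x0 \<Longrightarrow> y \<noteq> x0 \<Longrightarrow> cmod (coup x0 k l) \<noteq> cmod (coup y k l)"
    using B_chain[OF x0] by fast
  obtain N' where "N' \<ge> max a b" and path: "\<forall>k\<in>{1..N'}. \<forall>k'\<in>{1..N'}. \<exists>qs.
        set qs \<subseteq> {1..N'} \<and> connects ?b qs k k' \<and> (\<forall>r<length qs - 1. (qs ! r, qs ! Suc r) \<in> S)"
    using S unfolding connectedness_chain_def by blast
  then have "a \<in> {1..N'}" "b \<in> {1..N'}" using a b by auto
  then obtain qs where qs: "set qs \<subseteq> {1..N'}" "connects ?b qs a b"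
    "\<forall>r<length qs - 1. (qs ! r, qs ! Suc r) \<in> S"
    using path by blast
  have ne: "qs \<noteq> []" and hd: "qs ! 0 = a" and la: "qs ! (length qs - 1) = b"
    and prod: "(\<Prod>r<length qs - 1. ?b (qs ! r, qs ! Suc r)) \<noteq> 0"
    using qs(2) by (auto simp: connects_def hd_conv_nth last_conv_nth)
  have ge1: "qs ! r \<ge> 1" if "r < length qs" for r
    using qs(1) nth_mem[OF that] by auto
  have "r < length qs \<Longrightarrow> qs ! r = a \<or> indep_pair x0 a (qs ! r)" for r
  proof (induction r)
    case 0
    then show ?case using hd by simp
  next
    case (Suc r)
    let ?k = "qs ! r" and ?l = "qs ! Suc r"
    have r: "r < length qs - 1" using Suc by simp
    have kl: "?k \<ge> 1" "?l \<ge> 1" using ge1 Suc.prems by auto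
    have "coup x0 ?k ?l \<noteq> 0"
    proof
      assume "coup x0 ?k ?l = 0"
      then have "(\<Prod>r<length qs - 1. ?b (qs ! r, qs ! Suc r)) = 0" using r by (intro prod_zero) auto
      then show False using prod by contradiction
    qed
    moreover have "(?k, ?l) \<in> S" using qs(3) r by blast
    ultimately have edge: "?k \<noteq> ?l \<Longrightarrow> indep_pair x0 ?k ?l"
      using dist by (intro indep_pair_edge[OF x0 kl]) auto
    have IH: "?k = a \<or> indep_pair x0 a ?k" using Suc by simp
    show ?case
    \<comment> \<open>A path may stand still, return to \<open>a\<close> or leave from
      \<open>a\<close>; only in the remaining case are the three indices distinct, as the bracket
      requires.\<close>
    proof (cases "?k = ?l \<or> ?l = a \<or> ?k = a")
      case True
      then show ?thesis using IH edge by metis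
    next
      case False
      then show ?thesis using IH edge kl a by (metis indep_pair_chain)
    qed
  qed
  from this[of "length qs - 1"] show ?thesis using la ab ne by simp
qed

section \<open>Rank-one generators and phases on arbitrary unit vectors\<close>

text \<open>Brackets only give differences of diagonal operators; the second term vanishes strongly as its
  index \<open>b\<close> goes to infinity.\<close>

lemma lie_diag_single:
  assumes x0: "x0 \<in> I" and a: "a \<ge> 1"
  shows "lie (diag_op a (\<lambda>x. if x = x0 then t else 0))"
proof (rule lie_limit)
  let ?\<zeta> = "\<lambda>x. if x = x0 then t else 0"
  show "lin_into (F x) (H x) (diag_op a ?\<zeta> x)" if "x \<in> I" for x
    using that a by (intro lin_F diag_op_lin)
  fix K and \<eta> :: real assume \<eta>: "\<eta> > 0"
  define b where "b = Suc (max K a)"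
  have b: "b \<ge> 1" "a \<noteq> b" "b > K" by (auto simp: b_def)
  have 1: "lie (jump a b (\<lambda>x. if x = x0 then \<i> * of_real (t/2) else 0))"
    and 2: "lie (jump a b (\<lambda>x. if x = x0 then 1 else 0))"
    using indep_pair_all[OF x0 a b(1,2)] by (auto simp: indep_pair_def)
  have "lie (\<lambda>x \<psi>. diag_op a ?\<zeta> x \<psi> - diag_op b ?\<zeta> x \<psi>)"
    by (rule lie_diag_diff[OF 1 2 a b(1,2)]) auto
  moreover have "diag_op b ?\<zeta> x (e x k) = 0" if "x \<in> I" "k \<in> {1..K}" for x k
    using that b by (subst diag_op_basis) auto
  ultimately show "\<exists>M'. lie M' \<and> (\<forall>x\<in>I. \<forall>k\<in>{1..K}. norm (M' x (e x k) - diag_op a ?\<zeta> x (e x k)) \<le> \<eta>)"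
    using \<eta> by (intro exI[of _ "\<lambda>x \<psi>. diag_op a ?\<zeta> x \<psi> - diag_op b ?\<zeta> x \<psi>"]) auto
qed

text \<open>Includes the diagonal case \<open>a = b\<close>, so that double sums over basis vectors
  can be formed from jumps alone.\<close>

lemma lie_jump_single:
  assumes x0: "x0 \<in> I" and a: "a \<ge> 1" and b: "b \<ge> 1"
  shows "lie (jump a b (\<lambda>x. if x = x0 then \<gamma> else 0))"
proof (cases "a = b")
  case True
  have "\<gamma> - cnj \<gamma> = \<i> * complex_of_real (2 * Im \<gamma>)" by (rule complex_eqI) auto
  then have "\<gamma> * c - cnj \<gamma> * c = \<i> * complex_of_real (2 * Im \<gamma>) * c" for c
    by (metis left_diff_distrib)
  then have "jump a b (\<lambda>x. if x = x0 then \<gamma> else 0) = diag_op a (\<lambda>x. if x = x0 then 2 * Im \<gamma> else 0)"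
    unfolding True by (auto simp: jump_def diag_op_def fun_eq_iff simp flip: scaleC_diff_left)
  then show ?thesis using lie_diag_single[OF x0 a] by simp
next
  case False
  then show ?thesis using indep_pair_all[OF x0 a b] by (simp add: indep_pair_def)
qed

text \<open>Expanding \<open>v\<close> makes i |v><v| a double sum of matrix entries. The jump
  \<open>X k l\<close> of half strength contributes the entry at (k, l) and its mirror image;
  exchanging the two sums shows that both halves agree.\<close>

lemma lie_rank_one:
  assumes x0: "x0 \<in> I" and v: "v \<in> F x0"
  shows "lie (\<lambda>x \<psi>. if x = x0 then (\<i> * cinner \<psi> v) *\<^sub>C v else 0)"
proof -
  obtain n where n: "v \<in> cspan (e x0 ` {1..n})"
    using F_expand[OF hs[OF x0] hb[OF x0]] v unfolding F_def by blast
  have v_eq: "v = (\<Sum>k\<in>{1..n}. cinner v (e x0 k) *\<^sub>C e x0 k)"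
    using bproj_fix[OF hs[OF x0] hb[OF x0] n] unfolding bproj_def by (rule sym)
  define c where "c k = cinner v (e x0 k)" for k
  define X where "X k l = jump l k (\<lambda>x. if x = x0 then \<i> * c k * cnj (c l) / 2 else 0)" for k l
  have lie_X: "lie (\<lambda>x \<psi>. \<Sum>k\<in>{1..n}. \<Sum>l\<in>{1..n}. X k l x \<psi>)"
    unfolding X_def using x0 by (intro lie_sum lie_jump_single) auto
  have "(\<Sum>k\<in>{1..n}. \<Sum>l\<in>{1..n}. X k l x \<psi>) = (if x = x0 then (\<i> * cinner \<psi> v) *\<^sub>C v else 0)" for x \<psi>
  proof (cases "x = x0")
    case False
    then show ?thesis by (simp add: X_def jump_def)
  next
    case True
    define p where "p k = cinner \<psi> (e x0 k)" for k
    have pv: "cinner \<psi> v = (\<Sum>l\<in>{1..n}. cnj (c l) * p l)"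
    proof -
      have "cinner \<psi> v = cnj (cinner v \<psi>)" by (rule cinner_commute)
      also have "cinner v \<psi> = (\<Sum>l\<in>{1..n}. c l * cinner (e x0 l) \<psi>)"
        by (subst v_eq) (simp add: cinner_sum_left cinner_scaleC_left c_def)
      finally show ?thesis by (simp add: p_def cinner_commute[of \<psi>])
    qed
    have 1: "(\<Sum>k\<in>{1..n}. \<Sum>l\<in>{1..n}. (\<i> * c k * cnj (c l) / 2 * p l) *\<^sub>C e x0 k) = (\<i> / 2 * cinner \<psi> v) *\<^sub>C v"
    proof -
      have "(\<Sum>l\<in>{1..n}. (\<i> * c k * cnj (c l) / 2 * p l) *\<^sub>C e x0 k) = (\<i> / 2 * cinner \<psi> v) *\<^sub>C (c k *\<^sub>C e x0 k)" for k
        unfolding pv by (simp add: scaleC_scaleC sum_distrib_left sum_distrib_right mult_ac flip: complex_vector.scale_sum_left)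
      then have "(\<Sum>k\<in>{1..n}. \<Sum>l\<in>{1..n}. (\<i> * c k * cnj (c l) / 2 * p l) *\<^sub>C e x0 k) =
        (\<i> / 2 * cinner \<psi> v) *\<^sub>C (\<Sum>k\<in>{1..n}. c k *\<^sub>C e x0 k)"
        by (simp only: complex_vector.scale_sum_right)
      then show ?thesis using v_eq by (simp add: c_def)
    qed
    have "X k l x \<psi> = (\<i> * c k * cnj (c l) / 2 * p l) *\<^sub>C e x0 k + (\<i> * c l * cnj (c k) / 2 * p k) *\<^sub>C e x0 l" for k l
      using True by (simp add: X_def jump_def p_def mult_ac scaleC_minus_left)
    then have "(\<Sum>k\<in>{1..n}. \<Sum>l\<in>{1..n}. X k l x \<psi>) =
      (\<Sum>k\<in>{1..n}. \<Sum>l\<in>{1..n}. (\<i> * c k * cnj (c l) / 2 * p l) *\<^sub>C e x0 k) +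
      (\<Sum>k\<in>{1..n}. \<Sum>l\<in>{1..n}. (\<i> * c l * cnj (c k) / 2 * p k) *\<^sub>C e x0 l)"
      by (simp add: sum.distrib)
    also have "(\<Sum>k\<in>{1..n}. \<Sum>l\<in>{1..n}. (\<i> * c l * cnj (c k) / 2 * p k) *\<^sub>C e x0 l) =
      (\<Sum>k\<in>{1..n}. \<Sum>l\<in>{1..n}. (\<i> * c k * cnj (c l) / 2 * p l) *\<^sub>C e x0 k)"
      by (rule sum.swap)
    finally show ?thesis unfolding 1 using True by (simp flip: scaleC_add_left)
  qed
  then show ?thesis using lie_X by simp
qed

text \<open>The constant 12 is \<open>3 * (1 + 1)\<^sup>2\<close> from
  \<open>flow_two_phases\<close>, as only \<open>x0\<close> carries a phase, with coefficient 1. A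
  negative angle is a positive time along the reversed flow.\<close>

lemma reach_phase_F:
  assumes x0: "x0 \<in> I" and v: "v \<in> F x0" and n1: "norm v = 1"
  shows "reach (\<lambda>x. if x = x0 then ph v (cis \<theta>) else (\<lambda>\<psi>. \<psi>)) (12 * \<bar>\<theta>\<bar>)"
proof -
  define v' where "v' x = (if x = x0 then v else 0)" for x
  define a :: "'x \<Rightarrow> real" where "a x = (if x = x0 then 1 else 0)" for x
  have I_sum: "(\<Sum>x\<in>I. \<bar>a x\<bar> + \<bar>0\<bar>) = 1"
  proof -
    have "(\<Sum>x\<in>I. \<bar>a x\<bar> + \<bar>0\<bar>) = (\<Sum>x\<in>I. if x = x0 then 1 else 0)" by (rule sum.cong) (auto simp: a_def)
    then show ?thesis using finite_I x0 by simp
  qed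
  obtain K\<^sub>0 where fl: "flow (\<lambda>x s \<psi>. ph (v' x) (cis (a x * s)) (ph 0 (cis (0 * s)) \<psi>))
    (\<lambda>x \<psi>. (\<i> * complex_of_real (a x) * cinner \<psi> (v' x)) *\<^sub>C v' x + (\<i> * complex_of_real 0 * cinner \<psi> 0) *\<^sub>C 0)
    (3 * (1 + (\<Sum>x\<in>I. \<bar>a x\<bar> + \<bar>0\<bar>))\<^sup>2) K\<^sub>0"
    by (rule flow_two_phases[of v' "\<lambda>_. 0" a "\<lambda>_. 0"])
       (use v n1 complex_vector.subspace_0[OF F_sub] in \<open>auto simp: v'_def\<close>)
  have X: "(\<lambda>x \<psi>. (\<i> * complex_of_real (a x) * cinner \<psi> (v' x)) *\<^sub>C v' x + (\<i> * complex_of_real 0 * cinner \<psi> 0) *\<^sub>C 0)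
    = (\<lambda>x \<psi>. if x = x0 then (\<i> * cinner \<psi> v) *\<^sub>C v else 0)"
    by (auto simp: fun_eq_iff a_def v'_def)
  have C: "3 * (1 + (\<Sum>x\<in>I. \<bar>a x\<bar> + \<bar>0\<bar>))\<^sup>2 = 12" unfolding I_sum by simp
  have fl': "flow (\<lambda>x s. if x = x0 then ph v (cis s) else (\<lambda>\<psi>. \<psi>))
    (\<lambda>x \<psi>. if x = x0 then (\<i> * cinner \<psi> v) *\<^sub>C v else 0) 12 K\<^sub>0"
  proof -
    have "(\<lambda>x s \<psi>. ph (v' x) (cis (a x * s)) (ph 0 (cis (0 * s)) \<psi>)) = (\<lambda>x s. if x = x0 then ph v (cis s) else (\<lambda>\<psi>. \<psi>))"
      by (auto simp: fun_eq_iff a_def v'_def)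
    then show ?thesis using fl unfolding X C by simp
  qed
  note L = lie_rank_one[OF x0 v, unfolded lie_def]
  consider "\<theta> > 0" | "\<theta> = 0" | "\<theta> < 0" by linarith
  then show ?thesis
  proof cases
    case 1
    then show ?thesis using reach_flow[OF fl' L[THEN conjunct1] 1] by simp
  next
    case 2
    then show ?thesis by (rule_tac reach_cong[OF reach_mono[OF reach_id]]) auto
  next
    case 3
    then have "reach (\<lambda>x. if x = x0 then ph v (cis (- (- \<theta>))) else (\<lambda>\<psi>. \<psi>)) (12 * - \<theta>)"
      by (intro reach_flow[OF flow_rev[OF fl'] L[THEN conjunct2], of "- \<theta>"]) simp
    then show ?thesis unfolding minus_minus using 3 by simp
  qed
qed

lemma ph_vector_diff:
  assumes "norm v = 1" "norm v' = 1" "cmod z = 1"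
  shows "norm (ph v' z \<psi> - ph v z (\<psi>::'h)) \<le> 4 * norm (v' - v) * norm \<psi>"
proof -
  have "ph v' z \<psi> - ph v z \<psi> = (z - 1) *\<^sub>C (cinner \<psi> v' *\<^sub>C (v' - v) + cinner \<psi> (v' - v) *\<^sub>C v)"
    by (simp add: ph_def scaleC_add_right scaleC_diff_right scaleC_scaleC cinner_diff_right left_diff_distrib
        right_diff_distrib scaleC_diff_left)
  moreover have "cmod (z - 1) \<le> 2" using norm_triangle_ineq4[of z 1] assms(3) by simp
  moreover have "norm (cinner \<psi> v' *\<^sub>C (v' - v) + cinner \<psi> (v' - v) *\<^sub>C v) \<le>
    norm \<psi> * norm (v' - v) + norm \<psi> * norm (v' - v)"
    using cinner_cauchy_schwarz[of \<psi> v'] cinner_cauchy_schwarz[of \<psi> "v' - v"] assms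
    by (intro norm_triangle_mono) (auto simp: norm_scaleC mult_right_mono)
  ultimately have "norm (ph v' z \<psi> - ph v z \<psi>) \<le> 2 * (norm \<psi> * norm (v' - v) + norm \<psi> * norm (v' - v))"
    by (simp only: norm_scaleC) (rule mult_mono, auto)
  then show ?thesis by (simp add: mult_ac)
qed

text \<open>The cost \<open>12 * \<bar>\<theta>\<bar>\<close> is the same for all unit vectors of
  the algebraic span, so it survives the approximation of \<open>v\<close> by such vectors.\<close>

lemma reach_phase:
  assumes x0: "x0 \<in> I" and v: "v \<in> H x0" and n1: "norm v = 1"
  shows "reach (\<lambda>x. if x = x0 then ph v (cis \<theta>) else (\<lambda>\<psi>. \<psi>)) (12 * \<bar>\<theta>\<bar>)"
proof (rule reach_limit)
  show "isom_on (H x) (if x = x0 then ph v (cis \<theta>) else (\<lambda>\<psi>. \<psi>))" if "x \<in> I" for x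
    using ph_isom[OF H_sub[OF x0] v] n1 isom_id by auto
  fix K and \<eta> :: real assume \<eta>: "\<eta> > 0"
  \<comment> \<open>Normalising an approximant moves it by less than a further
    \<open>\<delta>\<close>, and \<open>ph_vector_diff\<close> multiplies the total
    \<open>2 * \<delta>\<close> by 4. The bound \<open>1/2\<close> keeps the approximant away from
    0.\<close>
  define \<delta> where "\<delta> = min (1/2) (\<eta> / 8)"
  have \<delta>: "\<delta> > 0" "\<delta> \<le> 1/2" "8 * \<delta> \<le> \<eta>" using \<eta> by (auto simp: \<delta>_def)
  obtain \<xi> where \<xi>: "\<xi> \<in> F x0" "norm (v - \<xi>) < \<delta>"
  proof -
    obtain K where "norm (v - bproj (e x0) K v) < \<delta>"
      using bproj_approx[OF hs[OF x0] hb[OF x0] v \<delta>(1)] by blast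
    then show ?thesis using that bproj_in_F[OF hs[OF x0] hb[OF x0], of K v] by (simp add: F_def)
  qed
  have nx: "\<bar>norm \<xi> - 1\<bar> < \<delta>"
    using norm_triangle_ineq3[of v \<xi>] \<xi>(2) n1 by linarith
  then have pos: "norm \<xi> > 0" using \<delta> by linarith
  define v' where "v' = (1 / norm \<xi>) *\<^sub>R \<xi>"
  have v'F: "v' \<in> F x0" using \<xi>(1) by (simp add: v'_def csubspace_scaleR[OF F_sub])
  have n': "norm v' = 1" using pos by (simp add: v'_def)
  have "v' - \<xi> = (1 / norm \<xi> - 1) *\<^sub>R \<xi>" by (simp add: v'_def scaleR_diff_left)
  then have "norm (v' - \<xi>) = \<bar>(1 / norm \<xi> - 1) * norm \<xi>\<bar>" by (simp add: abs_mult)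
  also have "(1 / norm \<xi> - 1) * norm \<xi> = 1 - norm \<xi>" using pos by (simp add: field_simps)
  finally have "norm (v' - \<xi>) < \<delta>" using nx by linarith
  then have d: "norm (v' - v) \<le> 2 * \<delta>"
    using norm_diff_triangle_le[of v' \<xi> \<delta> v \<delta>] \<xi>(2) by (simp add: norm_minus_commute)
  have est: "norm ((if x = x0 then ph v' (cis \<theta>) else (\<lambda>\<psi>. \<psi>)) (e x k) - (if x = x0 then ph v (cis \<theta>) else (\<lambda>\<psi>. \<psi>)) (e x k)) \<le> \<eta>"
    if "x \<in> I" "k \<in> {1..K}" for x k
  proof (cases "x = x0")
    case True
    have "norm (e x k) = 1" using e_norm that by auto
    then have "norm (ph v' (cis \<theta>) (e x k) - ph v (cis \<theta>) (e x k)) \<le> 4 * norm (v' - v)"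
      using ph_vector_diff[OF n1 n', of "cis \<theta>" "e x k"] by simp
    then show ?thesis using d \<delta>(3) True by simp
  qed (use \<eta> in auto)
  then show "\<exists>g' \<rho>'. reach g' \<rho>' \<and> \<rho>' \<le> 12 * \<bar>\<theta>\<bar> + \<eta> \<and> (\<forall>x\<in>I. \<forall>k\<in>{1..K}.
    norm (g' x (e x k) - (if x = x0 then ph v (cis \<theta>) else (\<lambda>\<psi>. \<psi>)) (e x k)) \<le> \<eta>)"
    using reach_phase_F[OF x0 v'F n', of \<theta>] \<eta>
    by (intro exI[of _ "\<lambda>x. if x = x0 then ph v' (cis \<theta>) else (\<lambda>\<psi>. \<psi>)"] exI[of _ "12 * \<bar>\<theta>\<bar>"] conjI ballI est)
       auto
qed simp

end

section \<open>Moving orthonormal frames\<close>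

text \<open>Polarisation: equal norms of sums give equal real parts, and the imaginary part is
  obtained by replacing \<open>x\<close> with \<open>\<i> *\<^sub>C x\<close>.\<close>

lemma isom_cinner:
  assumes "isom_on V f" "csubspace V" "x \<in> V" "y \<in> V"
  shows "cinner (f x) (f y) = cinner x y"
proof -
  have Re: "Re (cinner (f u) (f w)) = Re (cinner u w)" if "u \<in> V" "w \<in> V" for u w
  proof -
    have "norm (f (u + w)) = norm (u + w)"
      using assms that by (intro isom_norm) (auto simp: complex_vector.subspace_add)
    then have "norm (f u + f w) = norm (u + w)"
      using lin_into_add[OF isom_lin[OF assms(1)] that] by simp
    then have "(norm (f u + f w))\<^sup>2 = (norm (u + w))\<^sup>2" by simp
    then show ?thesis
      unfolding norm_add_sq using isom_norm[OF assms(1)] that by simp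
  qed
  have "Re (cinner (f (\<i> *\<^sub>C x)) (f y)) = Re (cinner (\<i> *\<^sub>C x) y)"
    using assms by (intro Re) (auto simp: complex_vector.subspace_scale)
  then have "Im (cinner (f x) (f y)) = Im (cinner x y)"
    using lin_into_scaleC[OF isom_lin[OF assms(1)] assms(3), of \<i>] by (simp add: cinner_scaleC_left)
  then show ?thesis using Re[OF assms(3,4)] by (intro complex_eqI)
qed

text \<open>Continuity of \<open>Arg\<close> at 1 and of \<open>arcsin\<close> at 0. In the
  application the component orthogonal to the old vector has norm at most
  \<open>2 * \<delta>\<close>, and \<open>\<delta> < 1/2\<close> keeps it below 1.\<close>

lemma small_angles:
  assumes "\<rho> > (0::real)"
  obtains \<delta> where "\<delta> > 0" "\<delta> < 1/2" "\<And>a. cmod (a - 1) \<le> \<delta> \<Longrightarrow> \<bar>Arg a\<bar> \<le> \<rho>"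
    "\<And>b. \<bar>b\<bar> \<le> 2 * \<delta> \<Longrightarrow> \<bar>arcsin b\<bar> \<le> \<rho>"
proof -
  have "isCont Arg 1" by (rule continuous_at_Arg) auto
  then obtain d1 where d1: "d1 > 0" "\<And>a. dist a 1 < d1 \<Longrightarrow> dist (Arg a) (Arg 1) < \<rho>"
    using assms unfolding continuous_at_eps_delta by metis
  have "isCont arcsin 0" by (rule isCont_arcsin) auto
  then obtain d2 where d2: "d2 > 0" "\<And>b. dist b 0 < d2 \<Longrightarrow> dist (arcsin b) (arcsin 0) < \<rho>"
    using assms unfolding continuous_at_eps_delta by metis
  define \<delta> where "\<delta> = min (1/4) (min (d1/2) (d2/4))"
  have "\<delta> > 0" "\<delta> < 1/2" using d1(1) d2(1) by (auto simp: \<delta>_def)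
  moreover have "\<bar>Arg a\<bar> \<le> \<rho>" if "cmod (a - 1) \<le> \<delta>" for a
    using d1(1) d1(2)[of a] that by (auto simp: \<delta>_def dist_norm)
  moreover have "\<bar>arcsin b\<bar> \<le> \<rho>" if "\<bar>b\<bar> \<le> 2 * \<delta>" for b
  proof -
    have "\<delta> \<le> d2/4" by (simp add: \<delta>_def)
    then have "\<bar>b\<bar> < d2" using that d2(1) by linarith
    then show ?thesis using d2(2)[of b] by (simp add: dist_norm)
  qed
  ultimately show ?thesis using that by blast
qed

context controlled_family
begin

text \<open>The modulus of a coefficient does not see the diagonal phases.\<close>

lemma track_bound:
  assumes x: "x \<in> I" and P: "isom_on (H x) P"
    and diag: "\<And>k. k \<in> {1..K} \<Longrightarrow> near_diag \<sigma> x k (P (e x k))"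
    and f: "f \<in> H x" "norm f \<le> 1" "norm (f - bproj (e x) K f) \<le> \<epsilon>\<^sub>0"
    and \<psi>: "\<psi> \<in> H x" "norm (\<psi> - f) \<le> \<eta>" and k: "k \<ge> 1"
  shows "\<bar>cmod (cinner (P \<psi>) (e x k)) - cmod (cinner f (e x k))\<bar> \<le> \<eta> + 2 * \<epsilon>\<^sub>0 + K * \<sigma>"
proof -
  note sub = H_sub[OF x]
  let ?p = "bproj (e x) K f"
  have pH: "?p \<in> H x" by (rule bproj_in_H[OF hs[OF x] hb[OF x]])
  obtain z where z: "\<And>l. l \<in> {1..K} \<Longrightarrow> cmod (z l) = 1 \<and> norm (P (e x l) - z l *\<^sub>C e x l) \<le> \<sigma>"
    using diag unfolding near_diag_def by metis
  \<comment> \<open>The truncation of \<open>f\<close> moved by the ideal diagonal phases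
    \<open>z l\<close>: up to index \<open>K\<close> its coefficients have exactly the moduli of
    those of \<open>f\<close>, and beyond \<open>K\<close> they vanish.\<close>
  define D where "D = (\<Sum>l\<in>{1..K}. cinner f (e x l) *\<^sub>C (z l *\<^sub>C e x l))"
  have \<sigma>0: "\<sigma> \<ge> 0 \<or> K = 0"
    using z[of K] norm_ge_zero[of "P (e x K) - z K *\<^sub>C e x K"] by (cases K) (auto simp del: norm_ge_zero intro: order_trans)
  have Pp: "P ?p = (\<Sum>l\<in>{1..K}. cinner f (e x l) *\<^sub>C P (e x l))"
    unfolding bproj_def by (rule lin_into_sum[OF isom_lin[OF P] sub]) (use e_H[OF x] in auto)
  have "P ?p - D = (\<Sum>l\<in>{1..K}. cinner f (e x l) *\<^sub>C (P (e x l) - z l *\<^sub>C e x l))"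
    unfolding Pp D_def by (simp add: sum_subtractf scaleC_diff_right)
  then have "norm (P ?p - D) \<le> (\<Sum>l\<in>{1..K}. cmod (cinner f (e x l))) * \<sigma>"
    using norm_sum_scaleC_le[of "{1..K}" "\<lambda>l. P (e x l) - z l *\<^sub>C e x l" \<sigma>] z by simp
  also have "\<dots> \<le> K * \<sigma>"
  proof -
    have "(\<Sum>l\<in>{1..K}. cmod (cinner f (e x l))) \<le> (\<Sum>l\<in>{1..K}. 1)"
      using hb_coeff_le[OF hs[OF x] hb[OF x], of _ f] f(2) by (intro sum_mono) (auto intro: order_trans)
    then show ?thesis using \<sigma>0 by (auto intro: mult_right_mono)
  qed
  finally have 1: "norm (P ?p - D) \<le> K * \<sigma>" .
  have 2: "norm (P \<psi> - P f) \<le> \<eta>" using isom_dist[OF P sub \<psi>(1) f(1)] \<psi>(2) by simp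
  have 3: "norm (P f - P ?p) \<le> \<epsilon>\<^sub>0" using isom_dist[OF P sub f(1) pH] f(3) by simp
  have "P \<psi> - D = (P \<psi> - P f) + ((P f - P ?p) + (P ?p - D))" by simp
  then have "norm (P \<psi> - D) \<le> \<eta> + (\<epsilon>\<^sub>0 + K * \<sigma>)"
    by (simp only:) (intro norm_triangle_mono 1 2 3)
  moreover have ek: "norm (e x k) = 1" by (rule e_norm[OF x k])
  ultimately have "cmod (cinner (P \<psi> - D) (e x k)) \<le> \<eta> + (\<epsilon>\<^sub>0 + K * \<sigma>)"
    using cinner_cauchy_schwarz[of "P \<psi> - D" "e x k"] by simp
  then have A: "\<bar>cmod (cinner (P \<psi>) (e x k)) - cmod (cinner D (e x k))\<bar> \<le> \<eta> + (\<epsilon>\<^sub>0 + K * \<sigma>)"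
    unfolding cinner_diff_left using norm_triangle_ineq3 order_trans by blast
  have "cinner D (e x k) = (\<Sum>l\<in>{1..K}. if l = k then cinner f (e x k) * z k else 0)"
    unfolding D_def cinner_sum_left
    using k by (intro sum.cong) (auto simp: cinner_scaleC_left e_cinner[OF x])
  then have "cmod (cinner D (e x k)) = (if k \<le> K then cmod (cinner f (e x k)) else 0)"
    using z k by (auto simp: norm_mult)
  \<comment> \<open>Coefficients beyond \<open>K\<close> are lost in \<open>D\<close>, but
    \<open>f\<close> itself has only small ones there.\<close>
  moreover have "cmod (cinner f (e x k)) \<le> \<epsilon>\<^sub>0" if "k > K"
  proof -
    have "cinner (f - ?p) (e x k) = cinner f (e x k)"
      using that k bproj_cinner[OF hs[OF x] hb[OF x] k] by (simp add: cinner_diff_left)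
    then show ?thesis using cinner_cauchy_schwarz[of "f - ?p" "e x k"] ek f(3) by simp
  qed
  moreover have "\<epsilon>\<^sub>0 \<ge> 0" using f(3) norm_ge_zero order_trans by blast
  ultimately have "\<bar>cmod (cinner D (e x k)) - cmod (cinner f (e x k))\<bar> \<le> \<epsilon>\<^sub>0" by auto
  with A show ?thesis by linarith
qed

text \<open>A finite net reduces the claim to finitely many vectors, and taking remainders does not
  increase the distance to the net.\<close>

lemma compact_bproj_uniform:
  assumes x: "x \<in> I" and S: "compact S" "S \<subseteq> H x" and "\<epsilon> > 0"
  obtains K0 where "\<And>K \<psi>. K \<ge> K0 \<Longrightarrow> \<psi> \<in> S \<Longrightarrow> norm (\<psi> - bproj (e x) K \<psi>) \<le> \<epsilon>"
proof -
  have "S \<subseteq> (\<Union>c\<in>S. ball c (\<epsilon>/2))" using assms by auto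
  then obtain S' where S': "S' \<subseteq> S" "finite S'" "S \<subseteq> (\<Union>c\<in>S'. ball c (\<epsilon>/2))"
    using compactE_image[OF S(1), of S "\<lambda>c. ball c (\<epsilon>/2)"] by auto
  have "\<forall>\<^sub>F K in sequentially. \<forall>c\<in>S'. norm (c - bproj (e x) K c) < \<epsilon>/2"
  proof (intro eventually_ball_finite S' ballI)
    fix c assume "c \<in> S'"
    then have "c \<in> H x" using S' S by auto
    then show "\<forall>\<^sub>F K in sequentially. norm (c - bproj (e x) K c) < \<epsilon>/2"
      using bproj_approx[OF hs[OF x] hb[OF x], of c "\<epsilon>/2"] assms(4) unfolding eventually_sequentially
      by (metis half_gt_zero)
  qed
  then obtain K0 where K0: "\<And>K c. K \<ge> K0 \<Longrightarrow> c \<in> S' \<Longrightarrow> norm (c - bproj (e x) K c) < \<epsilon>/2"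
    unfolding eventually_sequentially by blast
  have "norm (\<psi> - bproj (e x) K \<psi>) \<le> \<epsilon>" if K: "K \<ge> K0" and \<psi>: "\<psi> \<in> S" for K \<psi>
  proof -
    obtain c where c: "c \<in> S'" "norm (\<psi> - c) < \<epsilon>/2"
      using S'(3) \<psi> by (auto simp: dist_norm norm_minus_commute)
    have "\<psi> - bproj (e x) K \<psi> = ((\<psi> - c) - bproj (e x) K (\<psi> - c)) + (c - bproj (e x) K c)"
      by (simp add: lin_into_diff[OF bproj_lin[OF hs[OF x] hb[OF x], of UNIV]])
    moreover have "norm ((\<psi> - c) - bproj (e x) K (\<psi> - c)) \<le> \<epsilon>/2"
      using bproj_norm_diff[OF hs[OF x] hb[OF x], of "\<psi> - c" K] c(2) by linarith
    moreover have "norm (c - bproj (e x) K c) \<le> \<epsilon>/2" using K0[OF K c(1)] by simp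
    ultimately have "norm (\<psi> - bproj (e x) K \<psi>) \<le> \<epsilon>/2 + \<epsilon>/2" by (metis norm_triangle_mono)
    then show ?thesis by simp
  qed
  then show ?thesis using that by blast
qed

end

context phased_family
begin

text \<open>With \<open>f' = a f + b g\<close>, \<open>b = sin (\<theta>/2)\<close> and \<open>v = (f + \<omega> g) / \<surd>2\<close>, the phase \<open>\<theta>\<close> on \<open>v\<close> produces
  the component along \<open>g\<close>, and a previous phase on \<open>f\<close> adjusts the argument of \<open>a\<close>.\<close>

lemma two_phases_move:
  fixes f f' :: 'h
  assumes V: "csubspace V" "f \<in> V" "f' \<in> V" and n: "norm f = 1" "norm f' = 1"
    and a: "a = cinner f' f" "a \<noteq> 0" and b: "b = norm (f' - a *\<^sub>C f)" "b < 1"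
  obtains v where "v \<in> V" "norm v = 1"
    "ph v (cis (2 * arcsin b)) (ph f (cis (Arg a - arcsin b)) f) = f'"
    "\<And>\<psi>. cinner \<psi> f = 0 \<Longrightarrow> cinner \<psi> f' = 0 \<Longrightarrow> cinner \<psi> v = 0"
proof (cases "b = 0")
  \<comment> \<open>Here \<open>f'\<close> is a multiple of \<open>f\<close> and there is no
    direction \<open>g\<close>. The choice \<open>v = f\<close> serves, the phases adding up to
    \<open>Arg a\<close> because \<open>arcsin 0 = 0\<close>.\<close>
  case True
  then have f': "f' = a *\<^sub>C f" using b by simp
  then have "cmod a = 1" using n by (simp add: norm_scaleC)
  then have "cis (Arg a) = a" using rcis_cmod_Arg[of a] by (simp add: rcis_def)
  then have "ph f (cis (2 * arcsin b)) (ph f (cis (Arg a - arcsin b)) f) = f'"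
    using True f' n by (simp add: ph_self)
  then show ?thesis using that[of f] V n by blast
next
  case False
  then have b0: "b > 0" using b by simp
  define g where "g = (1 / b) *\<^sub>R (f' - a *\<^sub>C f)"
  have gn: "norm g = 1" using b0 b by (simp add: g_def)
  have ff: "cinner f f = 1" using n by (simp add: cinner_self)
  have gf: "cinner g f = 0"
    by (simp add: g_def cinner_scaleR_left cinner_diff_left cinner_scaleC_left ff flip: a(1))
  then have fg: "cinner f g = 0" using cinner_commute[of f g] by simp
  have gg: "cinner g g = 1" using gn by (simp add: cinner_self)
  have f': "f' = a *\<^sub>C f + complex_of_real b *\<^sub>C g"
    using b0 by (simp add: g_def scaleR_scaleC scaleC_scaleC)
  have "1 = cinner f' f'" using n by (simp add: cinner_self)
  also have "\<dots> = a * cnj a + complex_of_real (b * b)"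
    by (simp add: f' cinner_add_left cinner_add_right cinner_scaleC_left cinner_scaleC_right ff gg fg gf)
  also have "\<dots> = complex_of_real ((cmod a)\<^sup>2 + b\<^sup>2)" using complex_norm_square[of a] by (simp add: power2_eq_square)
  finally have ab: "(cmod a)\<^sup>2 + b\<^sup>2 = 1" using of_real_eq_1_iff by metis
  define h where "h = arcsin b"
  have sh: "sin h = b" using b(2) b0 unfolding h_def by (intro sin_arcsin) auto
  have "cos h = sqrt (1 - b\<^sup>2)" using b(2) b0 unfolding h_def by (intro cos_arcsin) auto
  also have "1 - b\<^sup>2 = (cmod a)\<^sup>2" using ab by simp
  finally have ch: "cos h = cmod a" by simp
  \<comment> \<open>Chosen to make the coefficient of \<open>g\<close> real and positive: it meets
    the factors \<open>cis (Arg a)\<close> and \<open>\<i>\<close>, and the product of the three is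
    1.\<close>
  define \<omega> where "\<omega> = - \<i> * cis (- Arg a)"
  have \<omega>: "\<omega> * cnj \<omega> = 1" by (simp add: \<omega>_def cis_cnj cis_mult flip: mult.assoc) (simp add: cis_mult mult.commute)
  define c where "c = complex_of_real (1 / sqrt 2)"
  have cc: "c * c = 1/2" "cnj c = c" "c * (c * z) = z / 2" for z
    by (auto simp: c_def simp flip: of_real_mult mult.assoc)
  define v where "v = c *\<^sub>C f + (c * \<omega>) *\<^sub>C g"
  have gV: "g \<in> V" unfolding g_def using V
    by (intro csubspace_scaleR complex_vector.subspace_diff complex_vector.subspace_scale)
  have vV: "v \<in> V" unfolding v_def using V gV
    by (intro complex_vector.subspace_add complex_vector.subspace_scale)
  have "cinner v v = 1"
    using \<omega> by (simp add: v_def cinner_add_left cinner_add_right cinner_scaleC_left cinner_scaleC_right ff gg fg gf cc mult_ac)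
  then have vn: "norm v = 1"
    using cinner_self[of v] by (metis norm_ge_zero of_real_eq_1_iff power2_eq_1_iff
        neg_0_le_iff_le not_one_le_zero zero_le_one dual_order.trans)
  have fv: "cinner f v = c" by (simp add: v_def cinner_add_right cinner_scaleC_right ff fg cc)
  define \<tau> where "\<tau> = cis (Arg a - h)"
  \<comment> \<open>Half-angle forms: up to phases, the phase \<open>2 * h\<close> on
    \<open>v\<close> keeps \<open>cos h\<close> along \<open>f\<close> and sends
    \<open>sin h\<close> to \<open>g\<close>. These are \<open>cmod a\<close> and
    \<open>b\<close>.\<close>
  have half1: "1 + cis (2 * h) = 2 * cis h * complex_of_real (cos h)"
    by (rule complex_eqI) (simp_all add: cos_double_cos sin_double power2_eq_square)
  have half2: "cis (2 * h) - 1 = 2 * \<i> * cis h * complex_of_real (sin h)"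
    by (rule complex_eqI) (simp_all add: cos_double_sin sin_double power2_eq_square)
  have rc: "complex_of_real (cmod a) * cis (Arg a) = a" using rcis_cmod_Arg[of a] by (simp add: rcis_def)
  have th: "\<tau> * cis h = cis (Arg a)" by (simp add: \<tau>_def cis_mult)
  have "ph v (cis (2 * h)) (ph f \<tau> f) = \<tau> *\<^sub>C f + ((cis (2 * h) - 1) * (\<tau> * c)) *\<^sub>C v"
    unfolding ph_self[OF n(1)] by (simp add: ph_def cinner_scaleC_left fv)
  also have "\<dots> = (\<tau> * (1 + (cis (2 * h) - 1) / 2)) *\<^sub>C f + (\<tau> * ((cis (2 * h) - 1) / 2) * \<omega>) *\<^sub>C g"
    unfolding v_def by (simp add: scaleC_add_right scaleC_scaleC cc mult_ac distrib_left scaleC_add_left)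
  also have "\<tau> * (1 + (cis (2 * h) - 1) / 2) = a"
  proof -
    have "1 + (cis (2 * h) - 1) / 2 = (1 + cis (2 * h)) / 2" by (simp add: field_simps)
    also have "\<dots> = cis h * complex_of_real (cos h)" unfolding half1 by simp
    finally have "\<tau> * (1 + (cis (2 * h) - 1) / 2) = (\<tau> * cis h) * complex_of_real (cos h)" by (simp add: mult_ac)
    then show ?thesis using rc by (simp add: th ch mult.commute)
  qed
  also have "\<tau> * ((cis (2 * h) - 1) / 2) * \<omega> = complex_of_real b"
  proof -
    have "\<tau> * ((cis (2 * h) - 1) / 2) * \<omega> = (\<tau> * cis h) * \<i> * \<omega> * complex_of_real (sin h)"
      unfolding half2 by simp
    also have "(\<tau> * cis h) * \<i> * \<omega> = 1" unfolding th by (simp add: \<omega>_def cis_mult flip: mult.assoc) (simp add: cis_mult mult.commute mult.left_commute)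
    finally show ?thesis by (simp add: sh)
  qed
  finally have "ph v (cis (2 * h)) (ph f \<tau> f) = f'" by (simp add: f')
  moreover have "cinner \<psi> v = 0" if "cinner \<psi> f = 0" "cinner \<psi> f' = 0" for \<psi>
    using that b0 by (simp add: v_def g_def cinner_add_right cinner_scaleC_right cinner_scaleR_right cinner_diff_right)
  ultimately show ?thesis using that[of v] vV vn by (simp add: h_def \<tau>_def)
qed

text \<open>Two clauses prepare the induction over a frame: fixing the vectors orthogonal to
  \<open>f\<close> and \<open>f'\<close> preserves those already placed, and closeness to the
  identity keeps the next vector near its target. The radius \<open>\<delta>\<close> depends on
  \<open>\<rho>\<close> only.\<close>

lemma reach_move_vector:
  assumes "\<rho> > 0"
  shows "\<exists>\<delta>>0. \<forall>x0\<in>I. \<forall>f\<in>H x0. \<forall>f'\<in>H x0. norm f = 1 \<longrightarrow> norm f' = 1 \<longrightarrow> norm (f' - f) \<le> \<delta> \<longrightarrow>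
    (\<exists>g. reach g \<rho> \<and> (\<forall>x \<psi>. x \<noteq> x0 \<longrightarrow> g x \<psi> = \<psi>) \<and> g x0 f = f' \<and>
      (\<forall>\<psi>. cinner \<psi> f = 0 \<longrightarrow> cinner \<psi> f' = 0 \<longrightarrow> g x0 \<psi> = \<psi>) \<and>
      (\<forall>\<psi>. norm (g x0 \<psi> - \<psi>) \<le> \<rho> * norm \<psi>))"
proof -
  \<comment> \<open>Each phase costs 12 times its angle, and the two angles sum to at most
    \<open>4 * \<rho>1\<close>: one share for \<open>Arg a\<close> and three for
    \<open>arcsin b\<close>.\<close>
  define \<rho>1 where "\<rho>1 = \<rho> / 48"
  have \<rho>1: "\<rho>1 > 0" using assms by (simp add: \<rho>1_def)
  obtain \<delta> where \<delta>: "\<delta> > 0" "\<delta> < 1/2" "\<And>a. cmod (a - 1) \<le> \<delta> \<Longrightarrow> \<bar>Arg a\<bar> \<le> \<rho>1"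
    "\<And>b. \<bar>b\<bar> \<le> 2 * \<delta> \<Longrightarrow> \<bar>arcsin b\<bar> \<le> \<rho>1"
    using small_angles[OF \<rho>1] by blast
  have "\<exists>g. reach g \<rho> \<and> (\<forall>x \<psi>. x \<noteq> x0 \<longrightarrow> g x \<psi> = \<psi>) \<and> g x0 f = f' \<and>
      (\<forall>\<psi>. cinner \<psi> f = 0 \<longrightarrow> cinner \<psi> f' = 0 \<longrightarrow> g x0 \<psi> = \<psi>) \<and>
      (\<forall>\<psi>. norm (g x0 \<psi> - \<psi>) \<le> \<rho> * norm \<psi>)"
    if x0: "x0 \<in> I" and f: "f \<in> H x0" "f' \<in> H x0" "norm f = 1" "norm f' = 1" "norm (f' - f) \<le> \<delta>" for x0 f f'
  proof -
    define a where "a = cinner f' f"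
    define b where "b = norm (f' - a *\<^sub>C f)"
    have "a - 1 = cinner (f' - f) f" using f by (simp add: a_def cinner_diff_left cinner_self)
    then have a1: "cmod (a - 1) \<le> \<delta>"
      using cinner_cauchy_schwarz[of "f' - f" f] f by simp
    then have a0: "a \<noteq> 0" using \<delta>(2) by auto
    have "f' - a *\<^sub>C f = (f' - f) - (a - 1) *\<^sub>C f" by (simp add: scaleC_diff_left)
    then have "b \<le> norm (f' - f) + norm ((a - 1) *\<^sub>C f)" unfolding b_def by (metis norm_triangle_ineq4)
    then have b1: "b \<le> 2 * \<delta>" using a1 f by (simp add: norm_scaleC)
    then have "b < 1" using \<delta>(2) by simp
    then obtain v where v: "v \<in> H x0" "norm v = 1"
      "ph v (cis (2 * arcsin b)) (ph f (cis (Arg a - arcsin b)) f) = f'"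
      "\<And>\<psi>. cinner \<psi> f = 0 \<Longrightarrow> cinner \<psi> f' = 0 \<Longrightarrow> cinner \<psi> v = 0"
      using two_phases_move[OF H_sub[OF x0] f(1-4) a_def a0 b_def] by blast
    define \<theta>1 \<theta>2 where "\<theta>1 = Arg a - arcsin b" and "\<theta>2 = 2 * arcsin b"
    have "\<bar>arcsin b\<bar> \<le> \<rho>1" using \<delta>(4)[of b] b1 by (simp add: b_def)
    moreover have "\<bar>Arg a\<bar> \<le> \<rho>1" by (rule \<delta>(3)[OF a1])
    ultimately have \<theta>: "\<bar>\<theta>1\<bar> + \<bar>\<theta>2\<bar> \<le> \<rho> / 12" unfolding \<theta>1_def \<theta>2_def \<rho>1_def by linarith
    define g where "g x \<psi> = (if x = x0 then ph v (cis \<theta>2) else (\<lambda>\<psi>. \<psi>)) ((if x = x0 then ph f (cis \<theta>1) else (\<lambda>\<psi>. \<psi>)) \<psi>)" for x \<psi>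
    have "reach g (12 * \<bar>\<theta>1\<bar> + 12 * \<bar>\<theta>2\<bar>)"
      unfolding g_def by (intro reach_compose reach_phase x0 f v)
    then have "reach g \<rho>" by (rule reach_mono) (use \<theta> in simp)
    moreover have "norm (g x0 \<psi> - \<psi>) \<le> \<rho> * norm \<psi>" for \<psi>
    proof -
      let ?\<xi> = "ph f (cis \<theta>1) \<psi>"
      have "norm (?\<xi> - \<psi>) \<le> \<bar>\<theta>1\<bar> * norm \<psi>"
        using ph_near[of f "cis \<theta>1" \<psi>] mult_right_mono[OF cmod_cis_minus_1_le[of \<theta>1], of "norm \<psi>"] f by simp
      moreover have "norm (ph v (cis \<theta>2) ?\<xi> - ?\<xi>) \<le> \<bar>\<theta>2\<bar> * norm \<psi>"
        using ph_near[of v "cis \<theta>2" ?\<xi>] mult_right_mono[OF cmod_cis_minus_1_le[of \<theta>2], of "norm \<psi>"]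
          v ph_norm[of f "cis \<theta>1" \<psi>] f by simp
      ultimately have "norm (ph v (cis \<theta>2) ?\<xi> - \<psi>) \<le> \<bar>\<theta>2\<bar> * norm \<psi> + \<bar>\<theta>1\<bar> * norm \<psi>"
        by (rule norm_diff_triangle_le[rotated])
      also have "\<dots> \<le> \<rho> * norm \<psi>"
        using mult_right_mono[of "\<bar>\<theta>2\<bar> + \<bar>\<theta>1\<bar>" \<rho> "norm \<psi>"] \<theta> assms by (simp add: distrib_right)
      finally show ?thesis by (simp add: g_def)
    qed
    moreover have "g x0 \<psi> = \<psi>" if "cinner \<psi> f = 0" "cinner \<psi> f' = 0" for \<psi>
      using that v(4)[OF that] by (simp add: g_def ph_orth)
    ultimately show ?thesis using v(3) by (intro exI[of _ g]) (auto simp: g_def \<theta>1_def \<theta>2_def)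
  qed
  then show ?thesis using \<delta>(1) by blast
qed

definition frame :: "nat \<Rightarrow> 'x \<Rightarrow> (nat \<Rightarrow> 'h) \<Rightarrow> bool" where
  "frame N x f \<longleftrightarrow> (\<forall>l\<in>{1..N}. f l \<in> H x) \<and>
     (\<forall>l\<in>{1..N}. \<forall>m\<in>{1..N}. cinner (f l) (f m) = (if l = m then 1 else 0))"

lemma frame_norm: "frame N x f \<Longrightarrow> l \<in> {1..N} \<Longrightarrow> norm (f l) = 1"
proof -
  assume "frame N x f" "l \<in> {1..N}"
  then have "cinner (f l) (f l) = 1" by (auto simp: frame_def)
  then have "(norm (f l))\<^sup>2 = 1" unfolding cinner_self using of_real_eq_1_iff by blast
  then show ?thesis using norm_ge_zero[of "f l"] by (simp add: power2_eq_1_iff)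
qed

text \<open>After the first \<open>n\<close> vectors are placed, the moved vector \<open>h\<close>
  is orthogonal to them by isometry, and so is its target. Moving \<open>h\<close> to the target
  therefore leaves them in place.\<close>

lemma reach_move_frame:
  assumes "n \<le> N" "\<rho> > 0"
  shows "\<exists>\<delta>>0. \<forall>x0\<in>I. \<forall>f f'. frame N x0 f \<longrightarrow> frame N x0 f' \<longrightarrow> (\<forall>l\<in>{1..N}. norm (f' l - f l) \<le> \<delta>) \<longrightarrow>
    (\<exists>g. reach g \<rho> \<and> (\<forall>x \<psi>. x \<noteq> x0 \<longrightarrow> g x \<psi> = \<psi>) \<and> (\<forall>l\<in>{1..n}. g x0 (f l) = f' l) \<and>
      (\<forall>\<psi>\<in>H x0. norm (g x0 \<psi> - \<psi>) \<le> \<rho> * norm \<psi>))"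
  using assms
proof (induction n arbitrary: \<rho>)
  case 0
  have "reach (\<lambda>x \<psi>. \<psi>) \<rho>" using reach_mono[OF reach_id] 0 by simp
  then show ?case using 0
    by (intro exI[of _ 1] conjI ballI allI impI exI[of _ "\<lambda>x \<psi>. \<psi>"]) auto
next
  case (Suc n)
  then have \<rho>2: "\<rho>/2 > 0" by simp
  obtain \<delta>v where \<delta>v: "\<delta>v > 0" and mv': "\<forall>x0\<in>I. \<forall>f\<in>H x0. \<forall>f'\<in>H x0. norm f = 1 \<longrightarrow> norm f' = 1 \<longrightarrow> norm (f' - f) \<le> \<delta>v \<longrightarrow>
    (\<exists>g. reach g (\<rho>/2) \<and> (\<forall>x \<psi>. x \<noteq> x0 \<longrightarrow> g x \<psi> = \<psi>) \<and> g x0 f = f' \<and>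
      (\<forall>\<psi>. cinner \<psi> f = 0 \<longrightarrow> cinner \<psi> f' = 0 \<longrightarrow> g x0 \<psi> = \<psi>) \<and>
      (\<forall>\<psi>. norm (g x0 \<psi> - \<psi>) \<le> \<rho>/2 * norm \<psi>))"
    using reach_move_vector[OF \<rho>2] by (elim exE conjE) (rule that)
  note mv = mv'[THEN bspec, THEN bspec, THEN bspec, THEN mp, THEN mp, THEN mp]
  \<comment> \<open>The target is within \<open>\<delta>v/2\<close> of \<open>f (Suc n)\<close>, and
    the earlier moves shift that vector by at most \<open>\<rho>1 \<le> \<delta>v/2\<close>;
    together they stay in the range of \<open>mv\<close>.\<close>
  define \<rho>1 where "\<rho>1 = min (\<rho>/2) (\<delta>v/2)"
  have \<rho>1: "\<rho>1 > 0" "\<rho>1 \<le> \<rho>/2" "\<rho>1 \<le> \<delta>v/2" using \<rho>2 \<delta>v by (auto simp: \<rho>1_def)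
  have nN: "n \<le> N" using Suc.prems by simp
  obtain \<delta>1 where \<delta>1: "\<delta>1 > 0" and mf': "\<forall>x0\<in>I. \<forall>f f'. frame N x0 f \<longrightarrow> frame N x0 f' \<longrightarrow> (\<forall>l\<in>{1..N}. norm (f' l - f l) \<le> \<delta>1) \<longrightarrow>
    (\<exists>g. reach g \<rho>1 \<and> (\<forall>x \<psi>. x \<noteq> x0 \<longrightarrow> g x \<psi> = \<psi>) \<and> (\<forall>l\<in>{1..n}. g x0 (f l) = f' l) \<and>
      (\<forall>\<psi>\<in>H x0. norm (g x0 \<psi> - \<psi>) \<le> \<rho>1 * norm \<psi>))"
    using Suc.IH[OF nN \<rho>1(1)] by (elim exE conjE) (rule that)
  note mf = mf'[THEN bspec, THEN spec, THEN spec, THEN mp, THEN mp, THEN mp]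
  define \<delta> where "\<delta> = min \<delta>1 (\<delta>v/2)"
  have \<delta>: "\<delta> > 0" "\<delta> \<le> \<delta>1" "\<delta> \<le> \<delta>v/2" using \<delta>1 \<delta>v by (auto simp: \<delta>_def)
  have "\<exists>g. reach g \<rho> \<and> (\<forall>x \<psi>. x \<noteq> x0 \<longrightarrow> g x \<psi> = \<psi>) \<and> (\<forall>l\<in>{1..Suc n}. g x0 (f l) = f' l) \<and>
      (\<forall>\<psi>\<in>H x0. norm (g x0 \<psi> - \<psi>) \<le> \<rho> * norm \<psi>)"
    if x0: "x0 \<in> I" and f: "frame N x0 f" and f': "frame N x0 f'" and le: "\<forall>l\<in>{1..N}. norm (f' l - f l) \<le> \<delta>" for x0 f f'
  proof -
    have "\<forall>l\<in>{1..N}. norm (f' l - f l) \<le> \<delta>1" using le \<delta>(2) order_trans by blast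
    then obtain g1 where g1: "reach g1 \<rho>1" "\<And>x \<psi>. x \<noteq> x0 \<Longrightarrow> g1 x \<psi> = \<psi>" "\<And>l. l\<in>{1..n} \<Longrightarrow> g1 x0 (f l) = f' l"
      "\<And>\<psi>. \<psi>\<in>H x0 \<Longrightarrow> norm (g1 x0 \<psi> - \<psi>) \<le> \<rho>1 * norm \<psi>"
      using mf[OF x0 f f'] by metis
    have g1i: "isom_on (H x0) (g1 x0)" by (rule reach_isom[OF g1(1) x0])
    have SnN: "Suc n \<in> {1..N}" using Suc.prems by simp
    have fH: "f l \<in> H x0" "f' l \<in> H x0" if "l \<in> {1..N}" for l using f f' that by (auto simp: frame_def)
    define h where "h = g1 x0 (f (Suc n))"
    have hH: "h \<in> H x0" using isom_mem[OF g1i fH(1)[OF SnN]] by (simp add: h_def)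
    have hn: "norm h = 1" using isom_norm[OF g1i fH(1)[OF SnN]] frame_norm[OF f SnN] by (simp add: h_def)
    have d1: "norm (f' (Suc n) - f (Suc n)) \<le> \<delta>v/2" using le SnN \<delta>(3) order_trans by blast
    have "norm (h - f (Suc n)) \<le> \<delta>v/2"
      using g1(4)[OF fH(1)[OF SnN]] frame_norm[OF f SnN] \<rho>1(3) by (simp add: h_def)
    then have d2: "norm (f (Suc n) - h) \<le> \<delta>v/2" by (simp add: norm_minus_commute)
    have "norm (f' (Suc n) - h) \<le> \<delta>v" using norm_diff_triangle_le[OF d1 d2] by simp
    then obtain g2 where g2: "reach g2 (\<rho>/2)" "\<And>x \<psi>. x \<noteq> x0 \<Longrightarrow> g2 x \<psi> = \<psi>" "g2 x0 h = f' (Suc n)"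
      "\<And>\<psi>. cinner \<psi> h = 0 \<Longrightarrow> cinner \<psi> (f' (Suc n)) = 0 \<Longrightarrow> g2 x0 \<psi> = \<psi>"
      "\<And>\<psi>. norm (g2 x0 \<psi> - \<psi>) \<le> \<rho>/2 * norm \<psi>"
      using mv[OF x0 hH fH(2)[OF SnN] hn frame_norm[OF f' SnN]] by metis
    define g where "g x \<psi> = g2 x (g1 x \<psi>)" for x \<psi>
    have "reach g (\<rho>1 + \<rho>/2)" unfolding g_def by (rule reach_compose[OF g1(1) g2(1)])
    then have "reach g \<rho>" by (rule reach_mono) (use \<rho>1 in simp)
    moreover have "g x0 (f l) = f' l" if l: "l \<in> {1..Suc n}" for l
    proof (cases "l = Suc n")
      case True
      then show ?thesis using g2(3) by (simp add: g_def h_def)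
    next
      case False
      then have l: "l \<in> {1..n}" "l \<in> {1..N}" using l nN by auto
      have "cinner (f' l) h = cinner (g1 x0 (f l)) (g1 x0 (f (Suc n)))" using g1(3)[OF l(1)] by (simp add: h_def)
      also have "\<dots> = cinner (f l) (f (Suc n))"
        by (rule isom_cinner[OF g1i H_sub[OF x0] fH(1)[OF l(2)] fH(1)[OF SnN]])
      also have "\<dots> = 0" using f l SnN False unfolding frame_def by auto
      finally have "cinner (f' l) h = 0" .
      moreover have "cinner (f' l) (f' (Suc n)) = 0" using f' l SnN False unfolding frame_def by auto
      ultimately show ?thesis using g2(4) g1(3)[OF l(1)] by (simp add: g_def)
    qed
    moreover have "norm (g x0 \<psi> - \<psi>) \<le> \<rho> * norm \<psi>" if \<psi>: "\<psi> \<in> H x0" for \<psi>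
    proof -
      have "norm (g2 x0 (g1 x0 \<psi>) - g1 x0 \<psi>) \<le> \<rho>/2 * norm \<psi>"
        using g2(5)[of "g1 x0 \<psi>"] isom_norm[OF g1i \<psi>] by simp
      from norm_diff_triangle_le[OF this g1(4)[OF \<psi>]]
      have "norm (g x0 \<psi> - \<psi>) \<le> \<rho>/2 * norm \<psi> + \<rho>1 * norm \<psi>" by (simp add: g_def)
      also have "\<dots> \<le> \<rho>/2 * norm \<psi> + \<rho>/2 * norm \<psi>" using \<rho>1(2) by (intro add_left_mono mult_right_mono) auto
      finally show ?thesis by simp
    qed
    ultimately show ?thesis using g1(2) g2(2) by (intro exI[of _ g]) (auto simp: g_def)
  qed
  then show ?case using \<delta>(1) by blast
qed

text \<open>The systems are treated one at a time, since each move is the identity on all others;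
  the allowance \<open>\<rho>\<close> is halved at every turn. The radius \<open>\<delta>\<close> is
  uniform in the frames, so one step size serves a whole curve.\<close>

lemma reach_move_frames:
  assumes "finite J" "J \<subseteq> I" "\<rho> > 0"
  shows "\<exists>\<delta>>0. \<forall>f f'. (\<forall>x\<in>I. frame N x (f x) \<and> frame N x (f' x) \<and> (\<forall>l\<in>{1..N}. norm (f' x l - f x l) \<le> \<delta>)) \<longrightarrow>
    (\<exists>g. reach g \<rho> \<and> (\<forall>x \<psi>. x \<notin> J \<longrightarrow> g x \<psi> = \<psi>) \<and> (\<forall>x\<in>J. \<forall>l\<in>{1..N}. g x (f x l) = f' x l))"
  using assms
proof (induction J arbitrary: \<rho> rule: finite_induct)
  case empty
  have "reach (\<lambda>x \<psi>. \<psi>) \<rho>" using reach_mono[OF reach_id] empty by simp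
  then show ?case by (intro exI[of _ 1] conjI allI impI exI[of _ "\<lambda>x \<psi>. \<psi>"]) auto
next
  case (insert x0 J)
  then have \<rho>2: "\<rho>/2 > 0" and x0: "x0 \<in> I" and JI: "J \<subseteq> I" by auto
  obtain \<delta>1 where \<delta>1: "\<delta>1 > 0" and m1': "\<forall>f f'. (\<forall>x\<in>I. frame N x (f x) \<and> frame N x (f' x) \<and> (\<forall>l\<in>{1..N}. norm (f' x l - f x l) \<le> \<delta>1)) \<longrightarrow>
    (\<exists>g. reach g (\<rho>/2) \<and> (\<forall>x \<psi>. x \<notin> J \<longrightarrow> g x \<psi> = \<psi>) \<and> (\<forall>x\<in>J. \<forall>l\<in>{1..N}. g x (f x l) = f' x l))"
    using insert.IH[OF JI \<rho>2] by (elim exE conjE) (rule that)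
  note m1 = m1'[THEN spec, THEN spec, THEN mp]
  obtain \<delta>2 where \<delta>2: "\<delta>2 > 0" and m2': "\<forall>x0\<in>I. \<forall>f f'. frame N x0 f \<longrightarrow> frame N x0 f' \<longrightarrow> (\<forall>l\<in>{1..N}. norm (f' l - f l) \<le> \<delta>2) \<longrightarrow>
    (\<exists>g. reach g (\<rho>/2) \<and> (\<forall>x \<psi>. x \<noteq> x0 \<longrightarrow> g x \<psi> = \<psi>) \<and> (\<forall>l\<in>{1..N}. g x0 (f l) = f' l) \<and>
      (\<forall>\<psi>\<in>H x0. norm (g x0 \<psi> - \<psi>) \<le> \<rho>/2 * norm \<psi>))"
    using reach_move_frame[OF order_refl \<rho>2, of N] by (elim exE conjE) (rule that)
  note m2 = m2'[THEN bspec, THEN spec, THEN spec, THEN mp, THEN mp, THEN mp]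
  have "\<exists>g. reach g \<rho> \<and> (\<forall>x \<psi>. x \<notin> insert x0 J \<longrightarrow> g x \<psi> = \<psi>) \<and> (\<forall>x\<in>insert x0 J. \<forall>l\<in>{1..N}. g x (f x l) = f' x l)"
    if ff: "\<forall>x\<in>I. frame N x (f x) \<and> frame N x (f' x) \<and> (\<forall>l\<in>{1..N}. norm (f' x l - f x l) \<le> min \<delta>1 \<delta>2)" for f f'
  proof -
    have "\<forall>x\<in>I. frame N x (f x) \<and> frame N x (f' x) \<and> (\<forall>l\<in>{1..N}. norm (f' x l - f x l) \<le> \<delta>1)"
      using ff by simp
    then obtain g1 where g1: "reach g1 (\<rho>/2)" "\<And>x \<psi>. x \<notin> J \<Longrightarrow> g1 x \<psi> = \<psi>" "\<And>x l. x\<in>J \<Longrightarrow> l\<in>{1..N} \<Longrightarrow> g1 x (f x l) = f' x l"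
      using m1[of f f'] by metis
    have "frame N x0 (f x0)" "frame N x0 (f' x0)" "\<forall>l\<in>{1..N}. norm (f' x0 l - f x0 l) \<le> \<delta>2"
      using ff x0 by auto
    then obtain g2 where g2: "reach g2 (\<rho>/2)" "\<And>x \<psi>. x \<noteq> x0 \<Longrightarrow> g2 x \<psi> = \<psi>" "\<And>l. l\<in>{1..N} \<Longrightarrow> g2 x0 (f x0 l) = f' x0 l"
      using m2[OF x0, of "f x0" "f' x0"] by metis
    have "reach (\<lambda>x \<psi>. g2 x (g1 x \<psi>)) (\<rho>/2 + \<rho>/2)" by (rule reach_compose[OF g1(1) g2(1)])
    then have "reach (\<lambda>x \<psi>. g2 x (g1 x \<psi>)) \<rho>" by simp
    moreover have "g2 x (g1 x \<psi>) = \<psi>" if "x \<notin> insert x0 J" for x \<psi> using that g1(2) g2(2) by simp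
    moreover have "g2 x (g1 x (f x l)) = f' x l" if "x \<in> insert x0 J" "l \<in> {1..N}" for x l
    proof (cases "x = x0")
      case True
      then show ?thesis using g1(2)[of x0 "f x0 l"] g2(3)[OF that(2)] insert(2) by simp
    next
      case False
      then show ?thesis using g1(3)[of x l] g2(2) that by simp
    qed
    ultimately show ?thesis by blast
  qed
  then show ?case using \<delta>1 \<delta>2 by (intro exI[of _ "min \<delta>1 \<delta>2"]) auto
qed

section \<open>Tracking a curve of frames\<close>

text \<open>The error does not grow with \<open>m\<close>. During a step the moduli are compared
  with those of the frame from which the step starts, so only the deviation of that step enters, and
  the error left by the previous steps can be prescribed in advance.\<close>

lemma track_path:
  assumes NK: "N \<le> K" and \<epsilon>0: "\<epsilon>\<^sub>0 \<ge> 0"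
    and f0: "\<And>x l. x \<in> I \<Longrightarrow> l \<in> {1..N} \<Longrightarrow> f 0 x l = e x l"
    and fH: "\<And>r x l. r \<le> m \<Longrightarrow> x \<in> I \<Longrightarrow> l \<in> {1..N} \<Longrightarrow> f r x l \<in> H x"
    and fn: "\<And>r x l. r \<le> m \<Longrightarrow> x \<in> I \<Longrightarrow> l \<in> {1..N} \<Longrightarrow> norm (f r x l) = 1"
    and fp: "\<And>r x l. r \<le> m \<Longrightarrow> x \<in> I \<Longrightarrow> l \<in> {1..N} \<Longrightarrow> norm (f r x l - bproj (e x) K (f r x l)) \<le> \<epsilon>\<^sub>0"
    and g: "\<And>r. r < m \<Longrightarrow> reach (g r) \<rho>"
    and gf: "\<And>r x l. r < m \<Longrightarrow> x \<in> I \<Longrightarrow> l \<in> {1..N} \<Longrightarrow> g r x (f r x l) = f (Suc r) x l"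
    and \<rho>: "\<rho> \<ge> 0" and \<eta>: "\<eta> > 0"
  shows "\<exists>w. adm w \<and> dur w > T \<and> (\<forall>x\<in>I. \<forall>l\<in>{1..N}. norm (ev x w (e x l) - f m x l) \<le> \<eta>) \<and>
    (\<forall>t\<in>{0..dur w}. \<exists>r\<le>m. \<forall>x\<in>I. \<forall>l\<in>{1..N}. \<forall>k\<ge>1.
      \<bar>cmod (cinner (propagator (W x) w t (e x l)) (e x k)) - cmod (cinner (f r x l) (e x k))\<bar> \<le> 2 * \<epsilon>\<^sub>0 + K * \<rho> + \<eta>)"
  using fH fn fp g gf \<eta>
proof (induction m arbitrary: \<eta>)
  case 0
  define \<eta>' where "\<eta>' = \<eta> / (K + 1)"
  have \<eta>': "\<eta>' > 0" "K * \<eta>' \<le> \<eta>" "\<eta>' \<le> \<eta>" using 0 by (auto simp: \<eta>'_def field_simps)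
  \<comment> \<open>A long free evolution at the start secures a total duration above
    \<open>T\<close> without visible motion.\<close>
  obtain w where w: "adm w" "dur w > T" "ctrl w \<eta>' K"
    "\<And>x k. x\<in>I \<Longrightarrow> k\<in>{1..K} \<Longrightarrow> norm (ev x w (e x k) - e x k) \<le> \<eta>'"
    using long_wait[OF \<eta>'(1)] by blast
  have "norm (ev x w (e x l) - f 0 x l) \<le> \<eta>" if "x \<in> I" "l \<in> {1..N}" for x l
    using w(4)[of x l] f0[OF that] that NK \<eta>'(3) by simp
  moreover have "\<bar>cmod (cinner (propagator (W x) w t (e x l)) (e x k)) - cmod (cinner (f 0 x l) (e x k))\<bar>
      \<le> 2 * \<epsilon>\<^sub>0 + K * \<rho> + \<eta>"
    if t: "t \<in> {0..dur w}" and x: "x \<in> I" and l: "l \<in> {1..N}" and k: "k \<ge> 1" for t x l k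
  proof -
    have "\<bar>cmod (cinner (propagator (W x) w t (e x l)) (e x k)) - cmod (cinner (f 0 x l) (e x k))\<bar> \<le> 0 + 2 * \<epsilon>\<^sub>0 + K * \<eta>'"
    proof (rule track_bound[OF x prop_isom[OF x w(1)]])
      show "near_diag \<eta>' x k (propagator (W x) w t (e x k))" if "k \<in> {1..K}" for k
        using w(3) t x that unfolding ctrl_def by blast
    qed (use 0 x l k f0 e_H in auto)
    moreover have "K * \<rho> \<ge> 0" using \<rho> by simp
    ultimately show ?thesis using \<eta>'(2) by linarith
  qed
  ultimately show ?case using w(1,2) by blast
next
  case (Suc m)
  \<comment> \<open>\<open>\<eta>' + \<eta>'\<close> covers the final errors of the old and the new
    word, and \<open>(K + 1) * \<eta>'\<close> covers the error at the junction plus the excess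
    deviation on \<open>K\<close> basis vectors.\<close>
  define \<eta>' where "\<eta>' = \<eta> / (2 * (K + 1))"
  have \<eta>'_pos: "\<eta>' > 0" using Suc.prems(6) by (simp add: \<eta>'_def)
  have "(real K + 1) * (\<eta>' + \<eta>') = \<eta>" by (simp add: \<eta>'_def divide_simps)
  moreover have "1 * (\<eta>' + \<eta>') \<le> (real K + 1) * (\<eta>' + \<eta>')" using \<eta>'_pos by (intro mult_right_mono) auto
  moreover have "(real K + 1) * \<eta>' \<le> (real K + 1) * (\<eta>' + \<eta>')" using \<eta>'_pos by (intro mult_left_mono) auto
  ultimately have \<eta>': "\<eta>' > 0" "(K + 1) * \<eta>' \<le> \<eta>" "\<eta>' + \<eta>' \<le> \<eta>" using \<eta>'_pos by (simp_all add: add.commute)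
  have "\<exists>w. adm w \<and> dur w > T \<and> (\<forall>x\<in>I. \<forall>l\<in>{1..N}. norm (ev x w (e x l) - f m x l) \<le> \<eta>') \<and>
    (\<forall>t\<in>{0..dur w}. \<exists>r\<le>m. \<forall>x\<in>I. \<forall>l\<in>{1..N}. \<forall>k\<ge>1.
      \<bar>cmod (cinner (propagator (W x) w t (e x l)) (e x k)) - cmod (cinner (f r x l) (e x k))\<bar> \<le> 2 * \<epsilon>\<^sub>0 + K * \<rho> + \<eta>')"
    using Suc.prems \<eta>'(1) by (intro Suc.IH) auto
  then obtain w where w: "adm w" "dur w > T" "\<And>x l. x\<in>I \<Longrightarrow> l\<in>{1..N} \<Longrightarrow> norm (ev x w (e x l) - f m x l) \<le> \<eta>'"
    and tr: "\<And>t. t\<in>{0..dur w} \<Longrightarrow> \<exists>r\<le>m. \<forall>x\<in>I. \<forall>l\<in>{1..N}. \<forall>k\<ge>1.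
      \<bar>cmod (cinner (propagator (W x) w t (e x l)) (e x k)) - cmod (cinner (f r x l) (e x k))\<bar> \<le> 2 * \<epsilon>\<^sub>0 + K * \<rho> + \<eta>'"
    by blast
  have fm: "f m x l \<in> H x" if "x \<in> I" "l \<in> {1..N}" for x l using Suc.prems(1) that by simp
  obtain w' where w': "adm w'" "ctrl w' (\<rho> + \<eta>') K"
    "\<And>x \<psi>. x \<in> I \<Longrightarrow> \<psi> \<in> f m x ` {1..N} \<Longrightarrow> norm (ev x w' \<psi> - g m x \<psi>) \<le> \<eta>'"
    using reach_apply[OF Suc.prems(4)[of m], of "\<lambda>x. f m x ` {1..N}" \<eta>' K] fm \<eta>'(1) by blast
  have "norm (ev x (w @ w') (e x l) - f (Suc m) x l) \<le> \<eta>" if x: "x \<in> I" and l: "l \<in> {1..N}" for x l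
  proof -
    have el: "e x l \<in> H x" using e_H x l by auto
    have "norm (ev x w' (ev x w (e x l)) - ev x w' (f m x l)) \<le> \<eta>'"
      using w(3)[OF x l] isom_dist[OF ev_isom[OF x w'(1)] H_sub[OF x] isom_mem[OF ev_isom[OF x w(1)] el] fm[OF x l]] by simp
    moreover have "norm (ev x w' (f m x l) - f (Suc m) x l) \<le> \<eta>'"
      using w'(3)[OF x, of "f m x l"] l Suc.prems(5)[OF _ x l, of m] by simp
    ultimately have "norm (ev x w' (ev x w (e x l)) - f (Suc m) x l) \<le> \<eta>' + \<eta>'"
      by (rule norm_diff_triangle_le)
    then show ?thesis using ev_append[OF x w(1) w'(1) el] \<eta>'(3) by simp
  qed
  moreover have "\<exists>r\<le>Suc m. \<forall>x\<in>I. \<forall>l\<in>{1..N}. \<forall>k\<ge>1.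
      \<bar>cmod (cinner (propagator (W x) (w @ w') t (e x l)) (e x k)) - cmod (cinner (f r x l) (e x k))\<bar> \<le> 2 * \<epsilon>\<^sub>0 + K * \<rho> + \<eta>"
    if t: "t \<in> {0..dur (w @ w')}" for t
  proof (cases "t \<le> dur w")
    case True
    then obtain r where r: "r \<le> m" "\<forall>x\<in>I. \<forall>l\<in>{1..N}. \<forall>k\<ge>1.
      \<bar>cmod (cinner (propagator (W x) w t (e x l)) (e x k)) - cmod (cinner (f r x l) (e x k))\<bar> \<le> 2 * \<epsilon>\<^sub>0 + K * \<rho> + \<eta>'"
      using tr[of t] t by auto
    have "\<bar>cmod (cinner (propagator (W x) (w @ w') t (e x l)) (e x k)) - cmod (cinner (f r x l) (e x k))\<bar> \<le> 2 * \<epsilon>\<^sub>0 + K * \<rho> + \<eta>"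
      if "x \<in> I" "l \<in> {1..N}" "k \<ge> 1" for x l k
    proof -
      have "propagator (W x) (w @ w') t (e x l) = propagator (W x) w t (e x l)"
        using True t prop_append[OF that(1) w(1) w'(1) e_H[OF that(1)], of l t] that(2) by auto
      moreover have "\<bar>cmod (cinner (propagator (W x) w t (e x l)) (e x k)) - cmod (cinner (f r x l) (e x k))\<bar> \<le> 2 * \<epsilon>\<^sub>0 + K * \<rho> + \<eta>'"
        using r(2) that by blast
      ultimately show ?thesis using \<eta>'(1,3) by simp
    qed
    then show ?thesis using r(1) le_SucI by blast
  next
    case False
    then have t': "t - dur w \<in> {0..dur w'}" using t by auto
    have "\<bar>cmod (cinner (propagator (W x) (w @ w') t (e x l)) (e x k)) - cmod (cinner (f m x l) (e x k))\<bar> \<le> 2 * \<epsilon>\<^sub>0 + K * \<rho> + \<eta>"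
      if x: "x \<in> I" and l: "l \<in> {1..N}" and k: "k \<ge> 1" for x l k
    proof -
      have el: "e x l \<in> H x" using e_H x l by auto
      have "\<bar>cmod (cinner (propagator (W x) w' (t - dur w) (ev x w (e x l))) (e x k)) - cmod (cinner (f m x l) (e x k))\<bar>
        \<le> \<eta>' + 2 * \<epsilon>\<^sub>0 + K * (\<rho> + \<eta>')"
      proof (rule track_bound[OF x prop_isom[OF x w'(1)] _ fm[OF x l] _ _ _ w(3)[OF x l] k])
        show "near_diag (\<rho> + \<eta>') x k (propagator (W x) w' (t - dur w) (e x k))" if "k \<in> {1..K}" for k
          using w'(2) t' x that unfolding ctrl_def by blast
        show "norm (f m x l) \<le> 1" using Suc.prems(2)[of m x l] x l by simp
        show "norm (f m x l - bproj (e x) K (f m x l)) \<le> \<epsilon>\<^sub>0" using Suc.prems(3)[of m x l] x l by simp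
        show "ev x w (e x l) \<in> H x" by (rule isom_mem[OF ev_isom[OF x w(1)] el])
      qed
      also have "\<dots> \<le> 2 * \<epsilon>\<^sub>0 + K * \<rho> + \<eta>" using \<eta>'(2) by (simp add: algebra_simps)
      finally show ?thesis
        using False t prop_append[OF x w(1) w'(1) el, of t] by auto
    qed
    then show ?thesis using le_SucI by blast
  qed
  ultimately show ?case using w(1,2) w'(1) dur_nonneg[OF w'(1)] by (intro exI[of _ "w @ w'"]) auto
qed

text \<open>Compactness of the time interval is used twice: it yields one truncation
  \<open>K\<close> for all times, and through uniform continuity a partition whose consecutive
  frames are within \<open>\<delta>\<close>.\<close>

lemma track_curve:
  assumes T: "T > 0" and \<epsilon>: "\<epsilon> > 0"
    and fr: "\<And>x t. x \<in> I \<Longrightarrow> t \<in> {0..T} \<Longrightarrow> frame N x (\<lambda>l. \<gamma> x l t)"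
    and cont: "\<And>x l. x \<in> I \<Longrightarrow> l \<in> {1..N} \<Longrightarrow> continuous_on {0..T} (\<gamma> x l)"
    and \<gamma>0: "\<And>x l. x \<in> I \<Longrightarrow> l \<in> {1..N} \<Longrightarrow> \<gamma> x l 0 = e x l"
  shows "\<exists>w. adm w \<and> dur w > T \<and> (\<forall>x\<in>I. \<forall>l\<in>{1..N}. norm (ev x w (e x l) - \<gamma> x l T) < \<epsilon>) \<and>
    (\<forall>t\<in>{0..dur w}. \<exists>s\<in>{0..T}. \<forall>x\<in>I. \<forall>l\<in>{1..N}. \<forall>k\<ge>1.
      \<bar>cmod (cinner (propagator (W x) w t (e x l)) (e x k)) - cmod (cinner (\<gamma> x l s) (e x k))\<bar> < \<epsilon>)"
proof -
  define \<epsilon>0 where "\<epsilon>0 = \<epsilon> / 8"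
  have \<epsilon>0: "\<epsilon>0 > 0" using \<epsilon> by (simp add: \<epsilon>0_def)
  have \<gamma>H: "\<gamma> x l t \<in> H x" if "x \<in> I" "l \<in> {1..N}" "t \<in> {0..T}" for x l t
    using fr[OF that(1,3)] that(2) by (auto simp: frame_def)
  have "\<forall>\<^sub>F K in sequentially. \<forall>x\<in>I. \<forall>l\<in>{1..N}. \<forall>t\<in>{0..T}. norm (\<gamma> x l t - bproj (e x) K (\<gamma> x l t)) \<le> \<epsilon>0"
  proof (rule eventually_ball_finite[OF finite_I, OF ballI], rule eventually_ball_finite[OF finite_atLeastAtMost, OF ballI])
    fix x l assume x: "x \<in> I" and l: "l \<in> {1..N}"
    have "compact (\<gamma> x l ` {0..T})" by (rule compact_continuous_image[OF cont[OF x l]]) simp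
    moreover have "\<gamma> x l ` {0..T} \<subseteq> H x" using \<gamma>H x l by auto
    ultimately obtain K0 where "\<And>K \<psi>. K \<ge> K0 \<Longrightarrow> \<psi> \<in> \<gamma> x l ` {0..T} \<Longrightarrow> norm (\<psi> - bproj (e x) K \<psi>) \<le> \<epsilon>0"
      using compact_bproj_uniform[OF x _ _ \<epsilon>0] by blast
    then show "\<forall>\<^sub>F K in sequentially. \<forall>t\<in>{0..T}. norm (\<gamma> x l t - bproj (e x) K (\<gamma> x l t)) \<le> \<epsilon>0"
      unfolding eventually_sequentially by blast
  qed
  then obtain K0 where K0: "\<And>K x l t. K \<ge> K0 \<Longrightarrow> x \<in> I \<Longrightarrow> l \<in> {1..N} \<Longrightarrow> t \<in> {0..T} \<Longrightarrow>
      norm (\<gamma> x l t - bproj (e x) K (\<gamma> x l t)) \<le> \<epsilon>0"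
    unfolding eventually_sequentially by blast
  define K where "K = max K0 N"
  \<comment> \<open>\<open>K\<close> truncates the whole curve at once, so that \<open>\<rho>\<close>, and with it the partition, may depend on \<open>K\<close>.\<close>
  define \<rho> where "\<rho> = \<epsilon> / (8 * (K + 1))"
  have \<rho>: "\<rho> > 0" "K * \<rho> \<le> \<epsilon> / 8" using \<epsilon> by (auto simp: \<rho>_def field_simps)
  obtain \<delta> where \<delta>: "\<delta> > 0" and mv': "\<forall>f f'. (\<forall>x\<in>I. frame N x (f x) \<and> frame N x (f' x) \<and>
      (\<forall>l\<in>{1..N}. norm (f' x l - f x l) \<le> \<delta>)) \<longrightarrow>
    (\<exists>g. reach g \<rho> \<and> (\<forall>x \<psi>. x \<notin> I \<longrightarrow> g x \<psi> = \<psi>) \<and> (\<forall>x\<in>I. \<forall>l\<in>{1..N}. g x (f x l) = f' x l))"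
    using reach_move_frames[OF finite_I order_refl \<rho>(1), of N] by (elim exE conjE) (rule that)
  note mv = mv'[THEN spec, THEN spec, THEN mp]
  have "\<forall>\<^sub>F n in sequentially. \<forall>x\<in>I. \<forall>l\<in>{1..N}. \<forall>s\<in>{0..T}. \<forall>t\<in>{0..T}. dist t s \<le> T / Suc n \<longrightarrow> norm (\<gamma> x l t - \<gamma> x l s) \<le> \<delta>"
  proof (rule eventually_ball_finite[OF finite_I, OF ballI], rule eventually_ball_finite[OF finite_atLeastAtMost, OF ballI])
    fix x l assume x: "x \<in> I" and l: "l \<in> {1..N}"
    have "uniformly_continuous_on {0..T} (\<gamma> x l)"
      by (rule compact_uniformly_continuous[OF cont[OF x l]]) simp
    then obtain d where d: "d > 0" "\<And>s t. s \<in> {0..T} \<Longrightarrow> t \<in> {0..T} \<Longrightarrow> dist t s < d \<Longrightarrow> dist (\<gamma> x l t) (\<gamma> x l s) < \<delta>"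
      using \<delta> unfolding uniformly_continuous_on_def by blast
    obtain n0 :: nat where n0: "T / d < n0" using reals_Archimedean2 by blast
    have "norm (\<gamma> x l t - \<gamma> x l s) \<le> \<delta>" if n: "n \<ge> n0" and st: "s \<in> {0..T}" "t \<in> {0..T}" "dist t s \<le> T / Suc n" for n s t
    proof -
      have "T / d < Suc n" using n0 n by linarith
      then have "T / Suc n < d" using d(1) by (simp add: field_simps)
      then show ?thesis using d(2)[OF st(1,2)] st(3) by (simp add: dist_norm)
    qed
    then show "\<forall>\<^sub>F n in sequentially. \<forall>s\<in>{0..T}. \<forall>t\<in>{0..T}. dist t s \<le> T / Suc n \<longrightarrow> norm (\<gamma> x l t - \<gamma> x l s) \<le> \<delta>"
      unfolding eventually_sequentially by blast
  qed
  then obtain n where n: "\<And>x l s t. x\<in>I \<Longrightarrow> l\<in>{1..N} \<Longrightarrow> s\<in>{0..T} \<Longrightarrow> t\<in>{0..T} \<Longrightarrow> dist t s \<le> T / Suc n \<Longrightarrow> norm (\<gamma> x l t - \<gamma> x l s) \<le> \<delta>"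
    unfolding eventually_sequentially by blast
  define m where "m = Suc n"
  define s where "s r = r * (T / m)" for r :: nat
  have m0: "m > 0" by (simp add: m_def)
  have sT: "s r \<in> {0..T}" if "r \<le> m" for r
  proof -
    have "s r \<le> m * (T / m)" unfolding s_def using that T by (intro mult_right_mono) auto
    then show ?thesis using T m0 by (simp add: s_def)
  qed
  have sm: "s m = T" using m0 by (simp add: s_def)
  define f where "f r x l = \<gamma> x l (s r)" for r x l
  have "\<exists>g. reach g \<rho> \<and> (\<forall>x \<psi>. x \<notin> I \<longrightarrow> g x \<psi> = \<psi>) \<and> (\<forall>x\<in>I. \<forall>l\<in>{1..N}. g x (f r x l) = f (Suc r) x l)" if r: "r < m" for r
  proof (rule mv, intro ballI conjI)
    fix x assume x: "x \<in> I"
    show "frame N x (f r x)" "frame N x (f (Suc r) x)" unfolding f_def using r by (intro fr x sT; simp)+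
    show "norm (f (Suc r) x l - f r x l) \<le> \<delta>" if "l \<in> {1..N}" for l
      unfolding f_def using r T by (intro n x that sT) (auto simp: s_def m_def dist_real_def algebra_simps add_divide_distrib)
  qed
  then obtain g where g: "\<And>r. r < m \<Longrightarrow> reach (g r) \<rho>"
    "\<And>r x l. r < m \<Longrightarrow> x \<in> I \<Longrightarrow> l \<in> {1..N} \<Longrightarrow> g r x (f r x l) = f (Suc r) x l"
    by metis
  have \<epsilon>2: "\<epsilon> / 4 > 0" using \<epsilon> by simp
  have "\<exists>w. adm w \<and> dur w > T \<and> (\<forall>x\<in>I. \<forall>l\<in>{1..N}. norm (ev x w (e x l) - f m x l) \<le> \<epsilon> / 4) \<and>
    (\<forall>t\<in>{0..dur w}. \<exists>r\<le>m. \<forall>x\<in>I. \<forall>l\<in>{1..N}. \<forall>k\<ge>1.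
      \<bar>cmod (cinner (propagator (W x) w t (e x l)) (e x k)) - cmod (cinner (f r x l) (e x k))\<bar> \<le> 2 * \<epsilon>0 + K * \<rho> + \<epsilon> / 4)"
  proof (rule track_path[where f = f and g = g and m = m and N = N and K = K and \<rho> = \<rho> and \<epsilon>\<^sub>0 = \<epsilon>0])
    show "f 0 x l = e x l" if "x \<in> I" "l \<in> {1..N}" for x l using \<gamma>0[OF that] by (simp add: f_def s_def)
    fix r x l assume r: "r \<le> m" and x: "x \<in> I" and l: "l \<in> {1..N}"
    show "f r x l \<in> H x" unfolding f_def by (rule \<gamma>H[OF x l sT[OF r]])
    show "norm (f r x l) = 1" unfolding f_def using frame_norm[OF fr[OF x sT[OF r]] l] .
    show "norm (f r x l - bproj (e x) K (f r x l)) \<le> \<epsilon>0"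
      unfolding f_def by (rule K0[OF _ x l sT[OF r]]) (simp add: K_def)
  qed (use \<epsilon>0 \<rho> \<epsilon>2 g in \<open>auto simp: K_def\<close>)
  then obtain w where w: "adm w" "dur w > T" "\<And>x l. x\<in>I \<Longrightarrow> l\<in>{1..N} \<Longrightarrow> norm (ev x w (e x l) - f m x l) \<le> \<epsilon> / 4"
    and tr: "\<And>t. t\<in>{0..dur w} \<Longrightarrow> \<exists>r\<le>m. \<forall>x\<in>I. \<forall>l\<in>{1..N}. \<forall>k\<ge>1.
      \<bar>cmod (cinner (propagator (W x) w t (e x l)) (e x k)) - cmod (cinner (f r x l) (e x k))\<bar> \<le> 2 * \<epsilon>0 + K * \<rho> + \<epsilon> / 4"
    by blast
  have "\<exists>s\<in>{0..T}. \<forall>x\<in>I. \<forall>l\<in>{1..N}. \<forall>k\<ge>1.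
      \<bar>cmod (cinner (propagator (W x) w t (e x l)) (e x k)) - cmod (cinner (\<gamma> x l s) (e x k))\<bar> < \<epsilon>"
    if t: "t \<in> {0..dur w}" for t
  proof -
    obtain r where r: "r \<le> m" "\<And>x l k. x\<in>I \<Longrightarrow> l\<in>{1..N} \<Longrightarrow> k\<ge>1 \<Longrightarrow>
      \<bar>cmod (cinner (propagator (W x) w t (e x l)) (e x k)) - cmod (cinner (f r x l) (e x k))\<bar> \<le> 2 * \<epsilon>0 + K * \<rho> + \<epsilon> / 4"
      using tr[OF t] by blast
    \<comment> \<open>The three shares are at most \<open>\<epsilon> / 4\<close>,
      \<open>\<epsilon> / 8\<close> and \<open>\<epsilon> / 4\<close>.\<close>
    have "2 * \<epsilon>0 + K * \<rho> + \<epsilon> / 4 < \<epsilon>" using \<rho>(2) \<epsilon> by (simp add: \<epsilon>0_def)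
    then show ?thesis using r(2) sT[OF r(1)] unfolding f_def by (meson le_less_trans)
  qed
  moreover have "norm (ev x w (e x l) - \<gamma> x l T) < \<epsilon>" if "x \<in> I" "l \<in> {1..N}" for x l
    using w(3)[OF that] \<epsilon> by (simp add: f_def sm)
  ultimately show ?thesis using w(1,2) by blast
qed

end

section \<open>Free evolution and Kronecker's theorem\<close>

lemma bounded_bilinear_scaleC: "bounded_bilinear (\<lambda>a (x::'h::complex_inner). a *\<^sub>C x)"
proof
  show "\<exists>K. \<forall>a b. norm (a *\<^sub>C (b::'h)) \<le> norm a * norm b * K"
    by (rule exI[of _ 1]) (simp add: norm_scaleC)
qed (auto simp: scaleC_add_left scaleC_add_right scaleR_scaleC scaleC_scaleC mult.commute scaleR_conv_of_real)

lemma dense_orthogonal_zero: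
  assumes "w \<in> closure D" "\<And>x. x \<in> D \<Longrightarrow> cinner x w = 0"
  shows "w = (0::'h::complex_inner)"
proof (rule ccontr)
  assume "w \<noteq> 0"
  then obtain x where x: "x \<in> D" "norm (w - x) < norm w"
    using closure_approx[OF assms(1), of "norm w"] by auto
  have "complex_of_real ((norm w)\<^sup>2) = cinner (w - x) w"
    using assms(2)[OF x(1)] by (simp add: cinner_diff_left cinner_self)
  then have "cmod (complex_of_real ((norm w)\<^sup>2)) \<le> norm (w - x) * norm w"
    using cinner_cauchy_schwarz[of "w - x" w] by metis
  then have "(norm w)\<^sup>2 \<le> norm (w - x) * norm w" by (simp add: norm_power)
  then show False using x(2) \<open>w \<noteq> 0\<close> by (simp add: power2_eq_square)
qed

text \<open>The adjoint is given by a definite description. Density of the domain makes the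
  representing vector unique, after which the defining relation can be read off.\<close>

lemma skew_adjoint_cinner:
  assumes "skew_adjoint H A" "A x = Some a" "A y = Some b"
  shows "cinner a y = - cinner x b"
proof -
  have dd: "densely_defined_operator H A" and adj: "op_adjoint H A = op_uminus A"
    using assms(1) by (auto simp: skew_adjoint_def)
  let ?P = "\<lambda>z. z \<in> H \<and> (\<forall>x\<in>dom A. cinner (the (A x)) y = cinner x z)"
  have Some: "op_adjoint H A y = Some (- b)" using adj assms(3) by (simp add: op_uminus_def)
  then have y: "y \<in> H" and ex: "\<exists>z. ?P z" and the: "(THE z. ?P z) = - b"
    unfolding op_adjoint_def by (auto split: if_splits)
  have uniq: "z = z'" if "?P z" "?P z'" for z z'
  proof -
    have "cinner x (z - z') = 0" if "x \<in> dom A" for x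
      using \<open>?P z\<close> \<open>?P z'\<close> that by (simp add: cinner_diff_right)
    moreover have "z - z' \<in> closure (dom A)"
    proof -
      have dom: "csubspace (dom A)" and H: "H \<subseteq> closure (dom A)"
        using dd by (auto simp: densely_defined_operator_def)
      have "z \<in> closure (dom A)" "z' \<in> closure (dom A)" using that H by auto
      then show ?thesis
      proof (unfold closure_approachable, intro allI impI)
        fix \<epsilon> :: real assume "\<epsilon> > 0"
        then have e2: "\<epsilon>/2 > 0" by simp
        assume "\<forall>e>0. \<exists>y\<in>dom A. dist y z < e" "\<forall>e>0. \<exists>y\<in>dom A. dist y z' < e"
        then obtain q q' where q: "q \<in> dom A" "dist q z < \<epsilon>/2" "q' \<in> dom A" "dist q' z' < \<epsilon>/2"
          using e2 by meson
        have "dist (q - q') (z - z') < \<epsilon>"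
          using q norm_triangle_ineq4[of "q - z" "q' - z'"] by (simp add: dist_norm algebra_simps)
        then show "\<exists>y\<in>dom A. dist y (z - z') < \<epsilon>"
          using q complex_vector.subspace_diff[OF dom q(1,3)] by blast
      qed
    qed
    ultimately have "z - z' = 0" using dense_orthogonal_zero by blast
    then show ?thesis by simp
  qed
  have "\<exists>!z. ?P z" using ex uniq by (intro ex_ex1I)
  then have "?P (THE z. ?P z)" by (rule theI')
  then have "cinner (the (A x)) y = cinner x (- b)" using assms(2) unfolding the by blast
  then show ?thesis using assms(2) by (simp add: cinner_minus_right)
qed

text \<open>Kronecker's theorem yields a real time of unknown sign. Dirichlet's simultaneous
  approximation yields an almost-period, and adding it carries the time beyond \<open>T\<close>
  while hardly changing the phases.\<close>

lemma kronecker_positive: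
  fixes \<nu> \<theta> :: "'a \<Rightarrow> real"
  assumes fin: "finite S" and inj: "inj_on \<nu> S"
    and ind: "\<And>F q. F \<subseteq> S \<Longrightarrow> (\<Sum>x\<in>F. real_of_int (q x) * \<nu> x) = 0 \<Longrightarrow> \<forall>x\<in>F. q x = 0"
    and \<eta>: "\<eta> > 0"
  obtains t where "t > T" "\<And>x. x \<in> S \<Longrightarrow> cmod (cis (t * \<nu> x) - cis (\<theta> x)) \<le> \<eta>"
proof -
  obtain h where h: "bij_betw h {0..<card S} S" using ex_bij_betw_nat_finite[OF fin] by blast
  define n where "n = card S"
  have h: "bij_betw h {..<n} S" using h by (simp add: n_def atLeast0LessThan)
  define \<kappa> where "\<kappa> i = \<nu> (h i) / (2 * pi)" for i
  have \<nu>\<kappa>: "\<nu> (h i) = 2 * pi * \<kappa> i" for i by (simp add: \<kappa>_def)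
  have inj\<kappa>: "inj_on \<kappa> {..<n}"
  proof (rule inj_onI)
    fix i j assume ij: "i \<in> {..<n}" "j \<in> {..<n}" and eq: "\<kappa> i = \<kappa> j"
    then have "\<nu> (h i) = \<nu> (h j)" using \<nu>\<kappa> by simp
    moreover have "h i \<in> S" "h j \<in> S" using h ij by (auto simp: bij_betw_def)
    ultimately have "h i = h j" using inj by (simp add: inj_on_def)
    then show "i = j" using h ij by (simp add: bij_betw_def inj_on_def)
  qed
  \<comment> \<open>The reals as a module over the integers, which gives the notion of independence
    required by \<open>Kronecker_thm_1\<close>.\<close>
  interpret Modules.module "(\<lambda>r. (*) (real_of_int r))"
    by (simp add: Modules.module.intro distrib_left mult.commute)
  have indep: "independent (\<kappa> ` {..<n})"
  proof
    assume "dependent (\<kappa> ` {..<n})"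
    then obtain V u where V: "finite V" "V \<subseteq> \<kappa> ` {..<n}" and sum: "(\<Sum>v\<in>V. real_of_int (u v) * v) = 0"
      and nz: "\<exists>v\<in>V. u v \<noteq> 0"
      unfolding dependent_explicit by blast
    define F where "F = {x\<in>S. \<nu> x / (2 * pi) \<in> V}"
    have V_eq: "V = (\<lambda>x. \<nu> x / (2 * pi)) ` F"
    proof
      show "V \<subseteq> (\<lambda>x. \<nu> x / (2 * pi)) ` F"
      proof
        fix v assume v: "v \<in> V"
        then obtain i where i: "i < n" "v = \<kappa> i" using V by auto
        then have "h i \<in> F" using h v by (auto simp: F_def bij_betw_def \<kappa>_def)
        then show "v \<in> (\<lambda>x. \<nu> x / (2 * pi)) ` F" using i by (auto simp: \<kappa>_def)
      qed
    qed (auto simp: F_def)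
    have "inj_on (\<lambda>x. \<nu> x / (2 * pi)) F"
      using inj by (auto simp: F_def inj_on_def)
    then have "(\<Sum>v\<in>V. real_of_int (u v) * v) = (\<Sum>x\<in>F. real_of_int (u (\<nu> x / (2 * pi))) * (\<nu> x / (2 * pi)))"
      unfolding V_eq by (simp add: sum.reindex)
    also have "\<dots> = (\<Sum>x\<in>F. real_of_int (u (\<nu> x / (2 * pi))) * \<nu> x) / (2 * pi)"
      by (simp add: sum_divide_distrib)
    finally have "(\<Sum>x\<in>F. real_of_int (u (\<nu> x / (2 * pi))) * \<nu> x) = 0" using sum by simp
    then have "\<forall>x\<in>F. u (\<nu> x / (2 * pi)) = 0" by (intro ind) (auto simp: F_def)
    then show False using nz V_eq by auto
  qed
  \<comment> \<open>Kronecker and Dirichlet contribute at most \<open>\<delta>\<close> each, and an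
    error measured in full turns becomes an angle by the factor \<open>2 * pi\<close>.\<close>
  define \<delta> where "\<delta> = \<eta> / (4 * pi)"
  have \<delta>: "\<delta> > 0" using \<eta> by (simp add: \<delta>_def)
  obtain t g where t: "\<And>i. i < n \<Longrightarrow> \<bar>t * \<kappa> i - of_int (g i) - \<theta> (h i) / (2 * pi)\<bar> < \<delta>"
    using Kronecker_thm_1[OF indep inj\<kappa> \<delta>, of "\<lambda>i. \<theta> (h i) / (2 * pi)"] by blast
  \<comment> \<open>Dirichlet's multiplier \<open>q\<close> is known only to be at least 1, so
    \<open>L\<close> alone must already carry \<open>t\<close> past \<open>T\<close>.\<close>
  define L where "L = max (T - t) 0 + 1"
  have L: "L > 0" "t + L > T" by (auto simp: L_def)
  obtain N :: nat where N: "1 / \<delta> < N" using reals_Archimedean2 by blast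
  have N0: "N > 0" using N \<delta> by (metis divide_pos_pos gr0I of_nat_0 less_asym zero_less_one)
  obtain q :: int and r where q: "0 < q" and r: "\<And>i. i < n \<Longrightarrow> \<bar>of_int q * (L * \<kappa> i) - of_int (r i)\<bar> < 1 / N"
    using Dirichlet_approx_simult[OF N0, of n "\<lambda>i. L * \<kappa> i"] by blast
  have Nd: "1 / N < \<delta>" using N N0 \<delta> by (simp add: field_simps)
  have "1 * L \<le> of_int q * L" using q L by (intro mult_right_mono) auto
  then have tT: "t + of_int q * L > T" using L(2) by simp
  have "cmod (cis ((t + of_int q * L) * \<nu> x) - cis (\<theta> x)) \<le> \<eta>" if x: "x \<in> S" for x
  proof -
    obtain i where i: "i < n" "x = h i" using h x by (auto simp: bij_betw_def)
    define m where "m = g i + r i"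
    define d where "d = (t + of_int q * L) * \<kappa> i - of_int m - \<theta> x / (2 * pi)"
    have "d = (t * \<kappa> i - of_int (g i) - \<theta> (h i) / (2 * pi)) + (of_int q * (L * \<kappa> i) - of_int (r i))"
      by (simp add: d_def m_def i algebra_simps)
    then have d: "\<bar>d\<bar> \<le> 2 * \<delta>" using t[OF i(1)] r[OF i(1)] Nd by linarith
    have "(t + of_int q * L) * \<nu> x = 2 * pi * d + (2 * pi * of_int m + \<theta> x)"
      unfolding d_def i(2) \<nu>\<kappa> by (simp add: field_simps)
    then have "cis ((t + of_int q * L) * \<nu> x) = cis (2 * pi * d) * (cis (2 * pi * of_int m) * cis (\<theta> x))"
      by (simp only: cis_mult)
    also have "cis (2 * pi * of_int m) = 1" by simp
    finally have "cis ((t + of_int q * L) * \<nu> x) - cis (\<theta> x) = (cis (2 * pi * d) - 1) * cis (\<theta> x)"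
      by (simp add: algebra_simps)
    then have "cmod (cis ((t + of_int q * L) * \<nu> x) - cis (\<theta> x)) \<le> \<bar>2 * pi * d\<bar>"
      using cmod_cis_minus_1_le[of "2 * pi * d"] by (simp add: norm_mult)
    also have "\<dots> = 2 * pi * \<bar>d\<bar>" by (simp add: abs_mult)
    also have "\<dots> \<le> 2 * pi * (2 * \<delta>)" using d by (intro mult_left_mono) auto
    also have "\<dots> = \<eta>" by (simp add: \<delta>_def)
    finally show ?thesis .
  qed
  then show ?thesis using that tT by blast
qed

section \<open>Controls that realise words, and curves continuous in operator norm\<close>

lemma piecewise_constant_control_exists:
  assumes "\<forall>(\<tau>, v) \<in> set w. \<tau> > 0 \<and> v \<in> U" "0 \<in> U"
  shows "\<exists>u. piecewise_constant_control U (sum_list (map fst w)) u w"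
proof -
  have "\<exists>u. (\<forall>t. u t \<in> U) \<and> (\<forall>k<length w. \<forall>t. sum_list (map fst (take k w)) \<le> t \<and>
     t < sum_list (map fst (take (Suc k) w)) \<longrightarrow> u t = snd (w ! k))"
    using assms(1)
  proof (induction w)
    case Nil
    \<comment> \<open>The default value 0 is taken from the final time on; that time belongs to no
      half-open piece but must still be mapped into \<open>U\<close>.\<close>
    then show ?case using assms(2) by (intro exI[of _ "\<lambda>_. 0"]) auto
  next
    case (Cons a w)
    obtain \<tau> v where a: "a = (\<tau>, v)" by force
    from Cons obtain u where "(\<forall>t. u t \<in> U) \<and> (\<forall>k<length w. \<forall>t. sum_list (map fst (take k w)) \<le> t \<and>
       t < sum_list (map fst (take (Suc k) w)) \<longrightarrow> u t = snd (w ! k))" by auto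
    then have u: "\<And>t. u t \<in> U" "\<And>k t. k<length w \<Longrightarrow> sum_list (map fst (take k w)) \<le> t \<Longrightarrow>
     t < sum_list (map fst (take (Suc k) w)) \<Longrightarrow> u t = snd (w ! k)" by blast+
    define u' where "u' t = (if t < \<tau> then v else u (t - \<tau>))" for t
    have "u' t = snd ((a # w) ! k)"
      if k: "k < length (a # w)" and t: "sum_list (map fst (take k (a # w))) \<le> t" "t < sum_list (map fst (take (Suc k) (a # w)))" for k t
    proof (cases k)
      case 0
      then show ?thesis using t by (simp add: a u'_def)
    next
      case (Suc l)
      have "sum_list (map fst (take l w)) \<ge> 0"
        using Cons.prems by (intro sum_list_nonneg) (force dest: in_set_takeD)
      then have "\<not> t < \<tau>" using t(1) by (simp add: Suc a)
      moreover have "u (t - \<tau>) = snd (w ! l)" using k t by (intro u(2)) (auto simp: Suc a)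
      ultimately show ?thesis by (simp add: u'_def Suc)
    qed
    moreover have "\<forall>t. u' t \<in> U" using u(1) Cons.prems by (auto simp: u'_def a)
    ultimately show ?case by blast
  qed
  then show ?thesis using assms(1) unfolding piecewise_constant_control_def by blast
qed

text \<open>A supremum of reals bounds its members only if the set is bounded above; for two
  isometries 2 is a bound, the quotient at the zero vector being 0 by convention.\<close>

lemma opnorm_bound:
  assumes "isom_on H f" "isom_on H g" "x \<in> H"
  shows "norm (f x - g x) \<le> opnorm_on H (\<lambda>x. f x - g x) * norm x"
proof -
  have "norm (f y - g y) / norm y \<le> 2" if "y \<in> H" for y
  proof -
    have "norm (f y - g y) \<le> 2 * norm y"
      using norm_triangle_ineq4[of "f y" "g y"] isom_norm[OF assms(1) that] isom_norm[OF assms(2) that] by simp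
    then show ?thesis by (cases "norm y = 0") (auto simp: divide_simps)
  qed
  then have "bdd_above ((\<lambda>y. norm (f y - g y) / norm y) ` H)" by (intro bdd_aboveI2)
  then have le: "norm (f x - g x) / norm x \<le> opnorm_on H (\<lambda>x. f x - g x)"
    unfolding opnorm_on_def by (intro cSUP_upper assms)
  show ?thesis
  proof (cases "norm x = 0")
    case True
    then have "norm (f x) = 0" "norm (g x) = 0" using isom_norm assms by metis+
    then show ?thesis using True by simp
  next
    case False
    then have "norm x > 0" by simp
    then show ?thesis using le by (simp add: divide_le_eq)
  qed
qed

lemma opnorm_continuous_imp:
  assumes "opnorm_continuous_on H J c" "\<And>t. t \<in> J \<Longrightarrow> isom_on H (c t)" "x \<in> H"
  shows "continuous_on J (\<lambda>t. c t x)"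
  unfolding continuous_on_def
proof
  fix t assume t: "t \<in> J"
  have "((\<lambda>s. opnorm_on H (\<lambda>x. c s x - c t x)) \<longlongrightarrow> 0) (at t within J)"
    using assms(1) t by (simp add: opnorm_continuous_on_def)
  from tendsto_mult_right[OF this, of "norm x"]
  have "((\<lambda>s. opnorm_on H (\<lambda>x. c s x - c t x) * norm x) \<longlongrightarrow> 0) (at t within J)" by simp
  moreover have "\<forall>\<^sub>F s in at t within J. norm (c s x - c t x) \<le> opnorm_on H (\<lambda>x. c s x - c t x) * norm x"
    using opnorm_bound assms t unfolding eventually_at_filter by (intro always_eventually) blast
  ultimately have "((\<lambda>s. c s x - c t x) \<longlongrightarrow> 0) (at t within J)" by (rule Lim_null_comparison[rotated])
  then show "((\<lambda>s. c s x) \<longlongrightarrow> c t x) (at t within J)" by (rule LIM_zero_cancel)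
qed

section \<open>The given control systems as an instance of the abstract family\<close>

locale tracked_system = control_system_family p n H A B U \<phi> \<mu> C W
  for p n and H :: "nat \<Rightarrow> 'h::complex_inner set" and A B U \<phi> \<mu> C W +
  assumes spectra: "rat_independent_family ({1..p} \<times> {1..}) (\<lambda>(i, k). \<mu> i k)"
    and chains: "\<And>i\<^sub>0 j\<^sub>0. \<lbrakk>i\<^sub>0 \<in> {1..p}; j\<^sub>0 \<in> {1..n i\<^sub>0}\<rbrakk> \<Longrightarrow>
      \<exists>S. connectedness_chain (mcoeff (B i\<^sub>0 j\<^sub>0) (\<phi> i\<^sub>0)) S \<and>
          (\<forall>s\<in>S. \<forall>j\<in>{1..n i\<^sub>0} - {j\<^sub>0}.
             cmod (mcoeff (B i\<^sub>0 j\<^sub>0) (\<phi> i\<^sub>0) s) \<noteq> cmod (mcoeff (B i\<^sub>0 j) (\<phi> i\<^sub>0) s))"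
    and U_nhd: "0 \<in> interior U"
begin

definition Ix :: "(nat \<times> nat) set" where
  "Ix = (SIGMA i:{1..p}. {1..n i})"

lemma Ix_iff: "x \<in> Ix \<longleftrightarrow> fst x \<in> {1..p} \<and> snd x \<in> {1..n (fst x)}"
  by (cases x) (auto simp: Ix_def)

lemma zero_U: "0 \<in> U"
  using U_nhd interior_subset by blast

sublocale cf: controlled_family Ix "\<lambda>x. H (fst x)" "\<lambda>x. \<phi> (fst x)" "\<lambda>x. W (fst x) (snd x)" U
  by unfold_locales (auto simp: Ix_def intro: hilbert basis W_unitary_group)

definition Aop :: "nat \<times> nat \<Rightarrow> 'h \<Rightarrow> 'h" where
  "Aop x \<psi> = the (A (fst x) \<psi>)"

definition Bop :: "nat \<times> nat \<Rightarrow> 'h \<Rightarrow> 'h" where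
  "Bop x \<psi> = the (B (fst x) (snd x) \<psi>)"

lemma A_basis: "x \<in> Ix \<Longrightarrow> k \<ge> 1 \<Longrightarrow> Aop x (\<phi> (fst x) k) = \<mu> (fst x) k *\<^sub>C \<phi> (fst x) k"
  using eigenvector[of "fst x" k] by (simp add: Aop_def Ix_iff)

lemma densely_defined_lin_into:
  assumes "densely_defined_operator V M" "e ` {1..} \<subseteq> dom M"
  shows "lin_into (cspan (e ` {1..})) V (\<lambda>x. the (M x))"
proof -
  have "cspan (e ` {1..}) \<subseteq> dom M"
    using assms by (intro complex_vector.span_minimal) (auto simp: densely_defined_operator_def)
  moreover have "lin_into (dom M) V (\<lambda>x. the (M x))"
    using assms(1) by (auto simp: densely_defined_operator_def lin_into_def ran_def)
  ultimately show ?thesis by (rule lin_into_subset[rotated])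
qed

lemma Aop_lin: "x \<in> Ix \<Longrightarrow> lin_into (cf.F x) (H (fst x)) (Aop x)"
  unfolding cf.F_def Aop_def[abs_def]
  using A_skew_adjoint[of "fst x"] eigenvector[of "fst x"]
  by (intro densely_defined_lin_into) (auto simp: Ix_iff skew_adjoint_def)

lemma Bop_lin: "x \<in> Ix \<Longrightarrow> lin_into (cf.F x) (H (fst x)) (Bop x)"
  unfolding cf.F_def Bop_def[abs_def]
  using B_skew_adjoint[of "fst x" "snd x"] basis_in_dom_B[of "fst x" "snd x"]
  by (intro densely_defined_lin_into) (auto simp: Ix_iff skew_adjoint_def)

text \<open>Basis vectors lie in the domain of A + u B, hence in that of the extension
  \<open>C\<close>, which is the generator of the group and agrees with A + u B there.\<close>

lemma W_deriv:
  assumes x: "x \<in> Ix" and k: "k \<ge> 1" and u: "u \<in> U"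
  shows "((\<lambda>t. W (fst x) (snd x) u t (\<phi> (fst x) k)) has_vector_derivative
    (Aop x (\<phi> (fst x) k) + u *\<^sub>R Bop x (\<phi> (fst x) k))) (at 0)"
proof -
  let ?i = "fst x" and ?j = "snd x"
  let ?e = "\<phi> ?i k"
  have ij: "?i \<in> {1..p}" "?j \<in> {1..n ?i}" using x by (auto simp: Ix_iff)
  obtain b where b: "B ?i ?j ?e = Some b" using basis_in_dom_B[OF ij k] by auto
  have "op_add_scaled (A ?i) u (B ?i ?j) ?e = Some (\<mu> ?i k *\<^sub>C ?e + u *\<^sub>R b)"
    using eigenvector[OF ij(1) k] b by (simp add: op_add_scaled_def)
  then have "C ?i ?j u ?e = Some (\<mu> ?i k *\<^sub>C ?e + u *\<^sub>R b)"
    using C_extends[OF ij u] by (metis domI map_le_def)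
  then have "infinitesimal_generator (H ?i) (W ?i ?j u) ?e = Some (\<mu> ?i k *\<^sub>C ?e + u *\<^sub>R b)"
    using W_generator[OF ij u] by simp
  then have "(\<lambda>t. W ?i ?j u t ?e) differentiable (at 0)"
    "vector_derivative (\<lambda>t. W ?i ?j u t ?e) (at 0) = \<mu> ?i k *\<^sub>C ?e + u *\<^sub>R b"
    unfolding infinitesimal_generator_def by (auto split: if_splits)
  then have "((\<lambda>t. W ?i ?j u t ?e) has_vector_derivative (\<mu> ?i k *\<^sub>C ?e + u *\<^sub>R b)) (at 0)"
    by (simp add: vector_derivative_works)
  then show ?thesis using b A_basis[OF x k] by (simp add: Bop_def)
qed

lemma W_zero_basis: "x \<in> Ix \<Longrightarrow> k \<ge> 1 \<Longrightarrow> u \<in> U \<Longrightarrow> W (fst x) (snd x) u 0 (\<phi> (fst x) k) = \<phi> (fst x) k"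
  using W_unitary_group[of "fst x" "snd x" u] cf.e_H[of x k] by (simp add: unitary_group_def Ix_iff)

text \<open>The group law carries the derivative at 0 to all times, so the orbit of an eigenvector
  solves a linear equation, and multiplying by the inverse exponential gives a constant. The result
  is independent of the second index: on the basis, systems of one class evolve freely
  alike.\<close>

lemma W_free_exp:
  assumes x: "x \<in> Ix" and k: "k \<ge> 1"
  shows "W (fst x) (snd x) 0 t (\<phi> (fst x) k) = exp (t * \<mu> (fst x) k) *\<^sub>C \<phi> (fst x) k"
proof -
  let ?e = "\<phi> (fst x) k" and ?m = "\<mu> (fst x) k"
  define G where "G t = W (fst x) (snd x) 0 t" for t
  have Gi: "isom_on (H (fst x)) (G t)" for t unfolding G_def by (rule cf.W_isom[OF x zero_U])
  have sub: "csubspace (H (fst x))" by (rule cf.H_sub[OF x])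
  have e: "?e \<in> H (fst x)" by (rule cf.e_H[OF x k])
  have G0: "G 0 ?e = ?e" using W_zero_basis[OF x k zero_U] by (simp add: G_def)
  have Gadd: "G (s + t) ?e = G s (G t ?e)" for s t
    using W_unitary_group[of "fst x" "snd x" 0] zero_U x e by (simp add: G_def unitary_group_def Ix_iff)
  have "((\<lambda>t. G t ?e) has_vector_derivative ?m *\<^sub>C ?e) (at 0)"
    using W_deriv[OF x k zero_U] A_basis[OF x k] by (simp add: G_def)
  then have d0: "((\<lambda>h. norm (G h ?e - ?e - h *\<^sub>R (?m *\<^sub>C ?e)) / norm h) \<longlongrightarrow> 0) (at 0)"
    unfolding has_vector_derivative_def has_derivative_at by (simp add: G0)
  have dG: "((\<lambda>t. G t ?e) has_vector_derivative ?m *\<^sub>C G t ?e) (at t)" for t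
  proof -
    have "norm (G (t + h) ?e - G t ?e - h *\<^sub>R (?m *\<^sub>C G t ?e)) = norm (G h ?e - ?e - h *\<^sub>R (?m *\<^sub>C ?e))" for h
    proof -
      have m: "?m *\<^sub>C ?e \<in> H (fst x)" "G h ?e \<in> H (fst x)"
        using e sub isom_mem[OF Gi] by (auto simp: complex_vector.subspace_scale)
      then have m2: "G h ?e - ?e \<in> H (fst x)" "h *\<^sub>R (?m *\<^sub>C ?e) \<in> H (fst x)"
        using e sub by (auto simp: complex_vector.subspace_diff csubspace_scaleR)
      have "G t (G h ?e - ?e - h *\<^sub>R (?m *\<^sub>C ?e)) = G (t + h) ?e - G t ?e - h *\<^sub>R (?m *\<^sub>C G t ?e)"
        by (simp add: lin_into_diff[OF isom_lin[OF Gi] sub] lin_into_scaleR[OF isom_lin[OF Gi]]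
            lin_into_scaleC[OF isom_lin[OF Gi]] Gadd m m2 e)
      moreover have "norm (G t (G h ?e - ?e - h *\<^sub>R (?m *\<^sub>C ?e))) = norm (G h ?e - ?e - h *\<^sub>R (?m *\<^sub>C ?e))"
        by (rule isom_norm[OF Gi complex_vector.subspace_diff[OF sub m2]])
      ultimately show ?thesis by simp
    qed
    then show ?thesis
      unfolding has_vector_derivative_def has_derivative_at using d0 bounded_linear_scaleR_left by simp
  qed
  have dE: "((\<lambda>t. exp (- (complex_of_real t * ?m))) has_vector_derivative - (?m * exp (- (complex_of_real t * ?m)))) (at t)" for t
    by (auto intro!: derivative_eq_intros has_vector_derivative_real_field)
  have "((\<lambda>t. exp (- (complex_of_real t * ?m)) *\<^sub>C G t ?e) has_vector_derivative
      (exp (- (complex_of_real t * ?m)) *\<^sub>C (?m *\<^sub>C G t ?e) + (- (?m * exp (- (complex_of_real t * ?m)))) *\<^sub>C G t ?e)) (at t)" for t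
    by (rule bounded_bilinear.has_vector_derivative[OF bounded_bilinear_scaleC dE dG])
  then have "((\<lambda>t. exp (- (complex_of_real t * ?m)) *\<^sub>C G t ?e) has_vector_derivative 0) (at t within UNIV)" for t
    by (simp add: scaleC_scaleC scaleC_minus_left mult.commute)
  then obtain c where c: "\<And>t. exp (- (complex_of_real t * ?m)) *\<^sub>C G t ?e = c"
    using has_vector_derivative_zero_constant[of UNIV "\<lambda>t. exp (- (complex_of_real t * ?m)) *\<^sub>C G t ?e"] by auto
  have "c = ?e" using c[of 0] by (simp add: G0)
  then have "exp (complex_of_real t * ?m) *\<^sub>C (exp (- (complex_of_real t * ?m)) *\<^sub>C G t ?e) = exp (complex_of_real t * ?m) *\<^sub>C ?e"
    using c by simp
  then show ?thesis by (simp add: G_def scaleC_scaleC flip: exp_add)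
qed

definition lam :: "nat \<Rightarrow> nat \<Rightarrow> real" where
  "lam i k = Im (\<mu> i k)"

text \<open>Free evolution is isometric, and in unit time it multiplies the eigenvector by the
  exponential of the eigenvalue; the real part must therefore be 0.\<close>

lemma mu_lam:
  assumes "x \<in> Ix" "k \<ge> 1"
  shows "\<mu> (fst x) k = \<i> * lam (fst x) k"
proof -
  have "norm (exp (\<mu> (fst x) k) *\<^sub>C \<phi> (fst x) k) = 1"
    using W_free_exp[OF assms, of 1] isom_norm[OF cf.W_isom[OF assms(1) zero_U] cf.e_H[OF assms], of 1]
      cf.e_norm[OF assms] by simp
  then have "exp (Re (\<mu> (fst x) k)) = 1" using cf.e_norm[OF assms] by (simp add: norm_scaleC)
  then have "Re (\<mu> (fst x) k) = 0" by simp
  then show ?thesis by (intro complex_eqI) (auto simp: lam_def)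
qed

lemma W_free:
  assumes "x \<in> Ix" "k \<ge> 1"
  shows "W (fst x) (snd x) 0 t (\<phi> (fst x) k) = cis (t * lam (fst x) k) *\<^sub>C \<phi> (fst x) k"
  using W_free_exp[OF assms, of t] by (simp add: mu_lam[OF assms] cis_conv_exp mult_ac)

text \<open>An integer relation among the numbers \<open>lam i k\<close> becomes, after
  multiplication by \<open>\<i>\<close>, a rational relation among the eigenvalues, so independence
  of the spectra gives what Kronecker's theorem requires on a finite set of indices.\<close>

lemma kron:
  assumes "\<eta> > 0"
  obtains t where "t > T" "\<And>x k. x \<in> Ix \<Longrightarrow> k \<in> {1..K} \<Longrightarrow> cmod (cis (t * lam (fst x) k) - cis (\<theta> (fst x) k)) \<le> \<eta>"
proof -
  let ?S = "{1..p} \<times> {1..K}"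
  have mu: "\<mu> i k = \<i> * lam i k" if "(i, k) \<in> ?S" for i k
  proof -
    have "(i, 1) \<in> Ix" using that n_ge_1[of i] by (auto simp: Ix_iff)
    from mu_lam[OF this, of k] show ?thesis using that by simp
  qed
  have ind: "\<forall>x\<in>F. q x = 0" if F: "F \<subseteq> ?S" and sum: "(\<Sum>x\<in>F. real_of_int (q x) * (\<lambda>(i, k). lam i k) x) = 0"
    for F and q :: "nat \<times> nat \<Rightarrow> int"
  proof -
    have fin: "finite F" using F finite_subset by blast
    have "(\<Sum>x\<in>F. of_rat (of_int (q x)) * (\<lambda>(i, k). \<mu> i k) x) =
      (\<Sum>x\<in>F. \<i> * complex_of_real (real_of_int (q x) * (\<lambda>(i, k). lam i k) x))"
      using mu F by (intro sum.cong) auto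
    also have "\<dots> = \<i> * complex_of_real (\<Sum>x\<in>F. real_of_int (q x) * (\<lambda>(i, k). lam i k) x)"
      by (simp only: sum_distrib_left of_real_sum)
    finally have "(\<Sum>x\<in>F. of_rat (of_int (q x)) * (\<lambda>(i, k). \<mu> i k) x) = 0" using sum by simp
    moreover have "F \<subseteq> {1..p} \<times> {1..}" using F by auto
    ultimately have "finite F \<and> F \<subseteq> {1..p} \<times> {1..} \<and> (\<Sum>x\<in>F. of_rat (of_int (q x)) * (\<lambda>(i, k). \<mu> i k) x) = 0"
      using fin by blast
    then have "\<forall>x\<in>F. (of_int (q x) :: rat) = 0"
      by (rule spectra[unfolded rat_independent_family_def, THEN spec, THEN spec, THEN mp])
    then show ?thesis by simp
  qed
  have inj: "inj_on (\<lambda>(i, k). lam i k) ?S"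
  proof (rule inj_onI, rule ccontr)
    fix a b assume ab: "a \<in> ?S" "b \<in> ?S" "(\<lambda>(i, k). lam i k) a = (\<lambda>(i, k). lam i k) b" "a \<noteq> b"
    \<comment> \<open>Two equal values would form a relation with coefficients 1 and -1.\<close>
    have "\<forall>x\<in>{a, b}. (\<lambda>x. if x = a then 1 else - 1 :: int) x = 0"
      using ab by (intro ind) auto
    then show False by simp
  qed
  obtain t where "t > T" "\<And>x. x \<in> ?S \<Longrightarrow> cmod (cis (t * (\<lambda>(i, k). lam i k) x) - cis ((\<lambda>(i, k). \<theta> i k) x)) \<le> \<eta>"
    by (rule kronecker_positive[OF _ inj ind assms, where T = T and \<theta> = "\<lambda>(i, k). \<theta> i k"]) simp_all
  then show ?thesis using that[of t] by (force simp: Ix_iff)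
qed

lemma free_word:
  assumes "s > 0"
  shows "cf.adm [(s, 0)]" "cf.dur [(s, 0)] = s" "\<rho> \<ge> 0 \<Longrightarrow> cf.ctrl [(s, 0)] \<rho> K"
    "\<And>x k. x \<in> Ix \<Longrightarrow> k \<ge> 1 \<Longrightarrow> cf.ev x [(s, 0)] (\<phi> (fst x) k) = cis (s * lam (fst x) k) *\<^sub>C \<phi> (fst x) k"
proof -
  show "cf.adm [(s, 0)]" "cf.dur [(s, 0)] = s" using assms zero_U by (auto simp: cf.adm_def cf.dur_def)
  then show "cf.ev x [(s, 0)] (\<phi> (fst x) k) = cis (s * lam (fst x) k) *\<^sub>C \<phi> (fst x) k" if "x \<in> Ix" "k \<ge> 1" for x k
    using W_free[OF that] by (simp add: cf.ev_def)
  show "cf.ctrl [(s, 0)] \<rho> K" if "\<rho> \<ge> 0"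
    unfolding cf.ctrl_def cf.near_diag_def cf.dur_def
  proof (intro ballI)
    fix t x k assume "t \<in> {0..sum_list (map fst [(s, 0::real)])}" "x \<in> Ix" "k \<in> {1..K}"
    then show "\<exists>z. cmod z = 1 \<and> norm (propagator (W (fst x) (snd x)) [(s, 0)] t (\<phi> (fst x) k) - z *\<^sub>C \<phi> (fst x) k) \<le> \<rho>"
      using W_free[of x k t] that by (intro exI[of _ "cis (t * lam (fst x) k)"]) auto
  qed
qed

lemma phase_word:
  assumes "\<eta> > 0"
  shows "\<exists>w. cf.adm w \<and> cf.dur w > T \<and> (\<forall>\<rho>\<ge>0. \<forall>K. cf.ctrl w \<rho> K) \<and>
    (\<forall>x\<in>Ix. \<forall>k\<in>{1..K}. norm (cf.ev x w (\<phi> (fst x) k) - cis (\<theta> (fst x) k) *\<^sub>C \<phi> (fst x) k) \<le> \<eta>)"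
proof -
  obtain s where s: "s > max T 0" "\<And>x k. x \<in> Ix \<Longrightarrow> k \<in> {1..K} \<Longrightarrow> cmod (cis (s * lam (fst x) k) - cis (\<theta> (fst x) k)) \<le> \<eta>"
    using kron[OF assms] by blast
  have s0: "s > 0" using s(1) by simp
  have "norm (cf.ev x [(s, 0)] (\<phi> (fst x) k) - cis (\<theta> (fst x) k) *\<^sub>C \<phi> (fst x) k) \<le> \<eta>" if "x \<in> Ix" "k \<in> {1..K}" for x k
    using free_word(4)[OF s0, of x k] that s(2)[OF that] cf.e_norm[of x k]
    by (simp add: norm_scaleC flip: scaleC_diff_left)
  then show ?thesis using free_word[OF s0] s(1) by (intro exI[of _ "[(s, 0)]"]) auto
qed

lemma reach_phase1:
  assumes "m \<ge> 1" "cmod z = 1"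
  shows "cf.reach (\<lambda>x. ph (if fst x = i then \<phi> (fst x) m else 0) z) 0"
  unfolding cf.reach_def
proof (intro conjI ballI allI impI)
  show "isom_on (H (fst x)) (ph (if fst x = i then \<phi> (fst x) m else 0) z)" if "x \<in> Ix" for x
    using assms cf.e_H[OF that assms(1)] cf.e_norm[OF that assms(1)] complex_vector.subspace_0[OF cf.H_sub[OF that]]
    by (intro ph_isom[OF cf.H_sub[OF that]]) auto
  fix K and \<eta> :: real assume \<eta>: "\<eta> > 0"
  define \<theta> where "\<theta> i' k = (if i' = i \<and> k = m then Arg z else 0)" for i' k
  obtain w where w: "cf.adm w" "\<forall>\<rho>\<ge>0. \<forall>K. cf.ctrl w \<rho> K"
    "\<And>x k. x\<in>Ix \<Longrightarrow> k\<in>{1..K} \<Longrightarrow> norm (cf.ev x w (\<phi> (fst x) k) - cis (\<theta> (fst x) k) *\<^sub>C \<phi> (fst x) k) \<le> \<eta>"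
    using phase_word[OF \<eta>, of 0 K \<theta>] by blast
  have "cis (Arg z) = z" using rcis_cmod_Arg[of z] assms(2) by (simp add: rcis_def)
  then have "ph (if fst x = i then \<phi> (fst x) m else 0) z (\<phi> (fst x) k) = cis (\<theta> (fst x) k) *\<^sub>C \<phi> (fst x) k"
    if "x \<in> Ix" "k \<ge> 1" for x k
    using that assms cf.e_norm[OF that] cf.e_cinner[OF that(1,2) assms(1)] by (auto simp: \<theta>_def ph_self ph_orth)
  then show "\<exists>w. cf.adm w \<and> cf.ctrl w (0 + \<eta>) K \<and> (\<forall>x\<in>Ix. \<forall>k\<in>{1..K}.
     norm (cf.ev x w (\<phi> (fst x) k) - ph (if fst x = i then \<phi> (fst x) m else 0) z (\<phi> (fst x) k)) \<le> \<eta>)"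
    using w \<eta> by (intro exI[of _ w]) auto
qed simp

text \<open>Time cannot run backwards, but the phases that the reversed drift would produce are
  realised by a long forward free evolution, which causes no deviation.\<close>

lemma ach_minus_A: "cf.ach (\<lambda>x \<psi>. - Aop x \<psi>) 0"
  unfolding cf.ach_def
proof (intro conjI ballI allI impI)
  show "lin_into (cf.F x) (H (fst x)) (\<lambda>\<psi>. - Aop x \<psi>)" if "x \<in> Ix" for x
    using Aop_lin[OF that] cf.H_sub[OF that] by (rule lin_into_uminus)
  fix K and \<eta> :: real assume \<eta>: "\<eta> > 0"
  define L where "L = (\<Sum>x\<in>Ix. \<Sum>k\<in>{1..K}. (lam (fst x) k)\<^sup>2)"
  have L0: "L \<ge> 0" by (simp add: L_def sum_nonneg)
  have L: "(lam (fst x) k)\<^sup>2 \<le> L" if "x \<in> Ix" "k \<in> {1..K}" for x k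
  proof -
    have "(lam (fst x) k)\<^sup>2 \<le> (\<Sum>k\<in>{1..K}. (lam (fst x) k)\<^sup>2)"
      using that by (intro member_le_sum) auto
    also have "\<dots> \<le> L"
      unfolding L_def using that cf.finite_I
      by (intro member_le_sum[of x Ix "\<lambda>x. \<Sum>k\<in>{1..K}. (lam (fst x) k)\<^sup>2"]) (auto simp: sum_nonneg)
    finally show ?thesis .
  qed
  \<comment> \<open>Makes the second-order error, at most \<open>\<tau>\<^sup>2 * L\<close>, at most
    half of \<open>\<eta> * \<tau>\<close>.\<close>
  define \<tau>0 where "\<tau>0 = \<eta> / (2 * (L + 1))"
  have \<tau>0: "\<tau>0 > 0" using \<eta> L0 by (simp add: \<tau>0_def)
  have "\<exists>w. cf.adm w \<and> cf.ctrl w (0 + \<eta>) K \<and> (\<forall>x\<in>Ix. \<forall>k\<in>{1..K}.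
    norm (cf.ev x w (\<phi> (fst x) k) - \<phi> (fst x) k - \<tau> *\<^sub>R - Aop x (\<phi> (fst x) k)) \<le> \<eta> * \<tau>)" if \<tau>: "\<tau> \<in> {0<..\<tau>0}" for \<tau>
  proof -
    have \<tau>p: "\<tau> > 0" and "\<tau> \<le> \<tau>0" using \<tau> by auto
    then have "\<tau> * (2 * (L + 1)) \<le> \<eta>" using L0 by (simp add: \<tau>0_def pos_le_divide_eq)
    then have \<tau>L: "\<tau> * L \<le> \<eta> / 2" using \<tau>p by (simp add: algebra_simps)
    have "\<eta> * \<tau> / 2 > 0" using \<eta> \<tau>p by simp
    then obtain w where w: "cf.adm w" "\<forall>\<rho>\<ge>0. \<forall>K. cf.ctrl w \<rho> K"
      "\<And>x k. x\<in>Ix \<Longrightarrow> k\<in>{1..K} \<Longrightarrow> norm (cf.ev x w (\<phi> (fst x) k) - cis (- \<tau> * lam (fst x) k) *\<^sub>C \<phi> (fst x) k) \<le> \<eta> * \<tau> / 2"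
      using phase_word[of "\<eta> * \<tau> / 2" 0 K "\<lambda>i k. - \<tau> * lam i k"] by blast
    have "norm (cf.ev x w (\<phi> (fst x) k) - \<phi> (fst x) k - \<tau> *\<^sub>R - Aop x (\<phi> (fst x) k)) \<le> \<eta> * \<tau>"
      if x: "x \<in> Ix" and k: "k \<in> {1..K}" for x k
    proof -
      let ?e = "\<phi> (fst x) k" and ?l = "lam (fst x) k"
      have k1: "k \<ge> 1" using k by simp
      have "cf.ev x w ?e - ?e - \<tau> *\<^sub>R - Aop x ?e = (cf.ev x w ?e - cis (- \<tau> * ?l) *\<^sub>C ?e)
        + (cis (- \<tau> * ?l) - 1 - \<i> * complex_of_real (- \<tau> * ?l)) *\<^sub>C ?e"
        by (simp add: A_basis[OF x k1] mu_lam[OF x k1] scaleC_diff_left scaleR_scaleC scaleC_scaleC mult_ac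
            scaleC_add_left)
      moreover have "norm ((cis (- \<tau> * ?l) - 1 - \<i> * complex_of_real (- \<tau> * ?l)) *\<^sub>C ?e) \<le> \<eta> * \<tau> / 2"
      proof -
        have "norm ((cis (- \<tau> * ?l) - 1 - \<i> * complex_of_real (- \<tau> * ?l)) *\<^sub>C ?e) \<le> (- \<tau> * ?l)\<^sup>2"
          unfolding norm_scaleC cf.e_norm[OF x k1] using cmod_cis_minus_linear_le[of "- \<tau> * ?l"] by simp
        also have "\<dots> = \<tau> * \<tau> * ?l\<^sup>2" by (simp add: power2_eq_square)
        also have "\<dots> \<le> \<tau> * \<tau> * L" using L[OF x k] \<tau>p by (intro mult_left_mono) auto
        also have "\<dots> \<le> \<tau> * (\<eta> / 2)" using \<tau>L \<tau>p by simp
        finally show ?thesis by (simp add: mult.commute)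
      qed
      ultimately have "norm (cf.ev x w ?e - ?e - \<tau> *\<^sub>R - Aop x ?e) \<le> \<eta> * \<tau> / 2 + \<eta> * \<tau> / 2"
        by (simp only:) (intro norm_triangle_mono w(3)[OF x k])
      then show ?thesis by simp
    qed
    then show ?thesis using w(1,2) \<eta> by (intro exI[of _ w]) auto
  qed
  then show "\<exists>\<tau>0>0. \<forall>\<tau>\<in>{0<..\<tau>0}. \<exists>w. cf.adm w \<and> cf.ctrl w (0 + \<eta>) K \<and> (\<forall>x\<in>Ix. \<forall>k\<in>{1..K}.
    norm (cf.ev x w (\<phi> (fst x) k) - \<phi> (fst x) k - \<tau> *\<^sub>R - Aop x (\<phi> (fst x) k)) \<le> \<eta> * \<tau>)"
    using \<tau>0 by blast
qed simp

text \<open>A single pulse suffices: differentiability at 0 gives the first-order estimate and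
  continuity the small excursion, with one radius for finitely many basis vectors.\<close>

lemma ach_A_plus_B:
  assumes u: "u \<in> U"
  shows "cf.ach (\<lambda>x \<psi>. Aop x \<psi> + u *\<^sub>R Bop x \<psi>) 0"
  unfolding cf.ach_def
proof (intro conjI ballI allI impI)
  show "lin_into (cf.F x) (H (fst x)) (\<lambda>\<psi>. Aop x \<psi> + u *\<^sub>R Bop x \<psi>)" if "x \<in> Ix" for x
    using Aop_lin[OF that] Bop_lin[OF that] cf.H_sub[OF that] by (intro lin_into_plus lin_into_smult)
  fix K and \<eta> :: real assume \<eta>: "\<eta> > 0"
  let ?W = "\<lambda>x k t. W (fst x) (snd x) u t (\<phi> (fst x) k)"
  let ?D = "\<lambda>x k. Aop x (\<phi> (fst x) k) + u *\<^sub>R Bop x (\<phi> (fst x) k)"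
  have "\<forall>\<^sub>F t in nhds 0. \<forall>x\<in>Ix. \<forall>k\<in>{1..K}. norm (?W x k t - \<phi> (fst x) k - t *\<^sub>R ?D x k) \<le> \<eta> * \<bar>t\<bar> \<and>
    norm (?W x k t - \<phi> (fst x) k) \<le> \<eta>"
  proof (rule eventually_ball_finite[OF cf.finite_I, OF ballI], rule eventually_ball_finite[OF finite_atLeastAtMost, OF ballI])
    fix x k assume x: "x \<in> Ix" and k: "k \<in> {1..K}"
    then have k1: "k \<ge> 1" by simp
    note d = W_deriv[OF x k1 u]
    have W0: "?W x k 0 = \<phi> (fst x) k" by (rule W_zero_basis[OF x k1 u])
    have "\<exists>d>0. \<forall>t. norm (t - 0) < d \<longrightarrow> norm (?W x k t - ?W x k 0 - (t - 0) *\<^sub>R ?D x k) \<le> \<eta> * norm (t - 0)"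
      using d \<eta> unfolding has_vector_derivative_def has_derivative_at_alt by blast
    then have 1: "\<forall>\<^sub>F t in nhds 0. norm (?W x k t - \<phi> (fst x) k - t *\<^sub>R ?D x k) \<le> \<eta> * \<bar>t\<bar>"
      unfolding eventually_nhds_metric by (simp add: W0 dist_norm)
    have "isCont (?W x k) 0" by (rule has_vector_derivative_continuous[OF d])
    then have "\<exists>d>0. \<forall>t. dist t 0 < d \<longrightarrow> dist (?W x k t) (?W x k 0) < \<eta>"
      using \<eta> unfolding continuous_at_eps_delta by blast
    then have 2: "\<forall>\<^sub>F t in nhds 0. norm (?W x k t - \<phi> (fst x) k) \<le> \<eta>"
      unfolding eventually_nhds_metric W0 dist_norm by (meson less_imp_le)
    show "\<forall>\<^sub>F t in nhds 0. norm (?W x k t - \<phi> (fst x) k - t *\<^sub>R ?D x k) \<le> \<eta> * \<bar>t\<bar> \<and>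
      norm (?W x k t - \<phi> (fst x) k) \<le> \<eta>"
      using 1 2 by (rule eventually_conj)
  qed
  then obtain d where d: "d > 0" and "\<forall>t. dist t 0 < d \<longrightarrow> (\<forall>x\<in>Ix. \<forall>k\<in>{1..K}.
    norm (?W x k t - \<phi> (fst x) k - t *\<^sub>R ?D x k) \<le> \<eta> * \<bar>t\<bar> \<and> norm (?W x k t - \<phi> (fst x) k) \<le> \<eta>)"
    unfolding eventually_nhds_metric by (elim exE conjE) (rule that)
  then have est: "norm (?W x k t - \<phi> (fst x) k - t *\<^sub>R ?D x k) \<le> \<eta> * \<bar>t\<bar> \<and> norm (?W x k t - \<phi> (fst x) k) \<le> \<eta>"
    if "\<bar>t\<bar> < d" "x \<in> Ix" "k \<in> {1..K}" for t x k
    using that by (simp add: dist_norm)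
  have "\<exists>w. cf.adm w \<and> cf.ctrl w (0 + \<eta>) K \<and> (\<forall>x\<in>Ix. \<forall>k\<in>{1..K}.
    norm (cf.ev x w (\<phi> (fst x) k) - \<phi> (fst x) k - \<tau> *\<^sub>R ?D x k) \<le> \<eta> * \<tau>)" if \<tau>: "\<tau> \<in> {0<..d/2}" for \<tau>
  proof -
    have \<tau>d: "\<tau> > 0" "\<tau> < d" using \<tau> d by auto
    have adm: "cf.adm [(\<tau>, u)]" and dur: "cf.dur [(\<tau>, u)] = \<tau>" using \<tau>d u by (auto simp: cf.adm_def cf.dur_def)
    have "cf.ctrl [(\<tau>, u)] (0 + \<eta>) K"
      unfolding cf.ctrl_def dur
    proof (intro ballI)
      fix t x k assume t: "t \<in> {0..\<tau>}" and x: "x \<in> Ix" and k: "k \<in> {1..K}"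
      have "\<bar>t\<bar> < d" using t \<tau>d by auto
      then have "norm (?W x k t - \<phi> (fst x) k) \<le> \<eta>" using est x k by blast
      then show "cf.near_diag (0 + \<eta>) x k (propagator (W (fst x) (snd x)) [(\<tau>, u)] t (\<phi> (fst x) k))"
        using t by (intro cf.near_diagI) simp
    qed
    moreover have "norm (cf.ev x [(\<tau>, u)] (\<phi> (fst x) k) - \<phi> (fst x) k - \<tau> *\<^sub>R ?D x k) \<le> \<eta> * \<tau>"
      if "x \<in> Ix" "k \<in> {1..K}" for x k
      using est[of \<tau> x k] \<tau>d that by (simp add: cf.ev_def dur)
    ultimately show ?thesis using adm by blast
  qed
  then show "\<exists>\<tau>0>0. \<forall>\<tau>\<in>{0<..\<tau>0}. \<exists>w. cf.adm w \<and> cf.ctrl w (0 + \<eta>) K \<and> (\<forall>x\<in>Ix. \<forall>k\<in>{1..K}.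
    norm (cf.ev x w (\<phi> (fst x) k) - \<phi> (fst x) k - \<tau> *\<^sub>R ?D x k) \<le> \<eta> * \<tau>)"
    using d by (intro exI[of _ "d/2"]) auto
qed simp

text \<open>Adding the reversed drift to a pulse leaves \<open>u\<close> times the coupling. A
  neighbourhood of 0 contains some \<open>u > 0\<close> together with \<open>- u\<close>, which
  gives both signs.\<close>

lemma lie_Bop: "cf.lie Bop"
proof -
  obtain d where d: "d > 0" "ball 0 d \<subseteq> U" using U_nhd mem_interior by blast
  define u where "u = d / 2"
  have u: "u > 0" "u \<in> U" "- u \<in> U" using d by (auto simp: u_def subset_iff dist_norm)
  have uB: "cf.ach (\<lambda>x \<psi>. v *\<^sub>R Bop x \<psi>) 0" if "v \<in> U" for v
  proof (rule cf.ach_cong)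
    show "cf.ach (\<lambda>x \<psi>. (Aop x \<psi> + v *\<^sub>R Bop x \<psi>) + - Aop x \<psi>) 0"
      using cf.ach_add[OF ach_A_plus_B[OF that] ach_minus_A] by simp
  qed (use Bop_lin cf.H_sub in \<open>auto intro: lin_into_smult\<close>)
  have "cf.ach (\<lambda>x \<psi>. (1/u) *\<^sub>R (u *\<^sub>R Bop x \<psi>)) 0" "cf.ach (\<lambda>x \<psi>. (1/u) *\<^sub>R ((- u) *\<^sub>R Bop x \<psi>)) 0"
    using u by (auto intro!: cf.ach_scale_pos uB simp del: scaleR_scaleR scaleR_minus_left)
  then show ?thesis using u(1) by (simp add: cf.lie_def)
qed

sublocale pf: phased_family Ix "\<lambda>x. H (fst x)" "\<lambda>x. \<phi> (fst x)" "\<lambda>x. W (fst x) (snd x)" U fst Bop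
proof
  show "cf.reach (\<lambda>x. ph (if fst x = i then \<phi> (fst x) m else 0) z) 0" if "m \<ge> 1" "cmod z = 1" for i m z
    using reach_phase1 that by blast
  show "\<exists>w. cf.adm w \<and> cf.dur w > T \<and> cf.ctrl w \<eta> K \<and>
      (\<forall>x\<in>Ix. \<forall>k\<in>{1..K}. norm (cf.ev x w (\<phi> (fst x) k) - \<phi> (fst x) k) \<le> \<eta>)" if "\<eta> > 0" for K \<eta> T
    using phase_word[OF that, of T K "\<lambda>_ _. 0"] that by auto
  show "cf.lie Bop" by (rule lie_Bop)
  show "cinner (Bop x (\<phi> (fst x) l)) (\<phi> (fst x) k) = - cnj (cinner (Bop x (\<phi> (fst x) k)) (\<phi> (fst x) l))"
    if x: "x \<in> Ix" and k: "k \<ge> 1" and l: "l \<ge> 1" for x k l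
  proof -
    have ij: "fst x \<in> {1..p}" "snd x \<in> {1..n (fst x)}" using x by (auto simp: Ix_iff)
    obtain b b' where b: "B (fst x) (snd x) (\<phi> (fst x) l) = Some b" "B (fst x) (snd x) (\<phi> (fst x) k) = Some b'"
      using basis_in_dom_B[OF ij] k l by blast
    have "cinner b (\<phi> (fst x) k) = - cinner (\<phi> (fst x) l) b'"
      by (rule skew_adjoint_cinner[OF B_skew_adjoint[OF ij] b])
    then show ?thesis using b by (simp add: Bop_def cinner_commute[of "\<phi> (fst x) l"])
  qed
  show "\<exists>S. connectedness_chain (\<lambda>(k, l). cinner (Bop x (\<phi> (fst x) k)) (\<phi> (fst x) l)) S \<and>
      (\<forall>(k, l)\<in>S. \<forall>y\<in>Ix. fst y = fst x \<longrightarrow> y \<noteq> x \<longrightarrow>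
        cmod (cinner (Bop x (\<phi> (fst x) k)) (\<phi> (fst x) l)) \<noteq> cmod (cinner (Bop y (\<phi> (fst y) k)) (\<phi> (fst y) l)))"
    if x: "x \<in> Ix" for x
  proof -
    have ij: "fst x \<in> {1..p}" "snd x \<in> {1..n (fst x)}" using x by (auto simp: Ix_iff)
    have m: "mcoeff (B (fst y) (snd y)) (\<phi> (fst y)) = (\<lambda>(k, l). cinner (Bop y (\<phi> (fst y) k)) (\<phi> (fst y) l))" for y
      by (simp add: mcoeff_def Bop_def)
    obtain S where S: "connectedness_chain (mcoeff (B (fst x) (snd x)) (\<phi> (fst x))) S"
      "\<And>s j. s \<in> S \<Longrightarrow> j \<in> {1..n (fst x)} - {snd x} \<Longrightarrow>
        cmod (mcoeff (B (fst x) (snd x)) (\<phi> (fst x)) s) \<noteq> cmod (mcoeff (B (fst x) j) (\<phi> (fst x)) s)"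
      using chains[OF ij] by blast
    have "cmod (cinner (Bop x (\<phi> (fst x) k)) (\<phi> (fst x) l)) \<noteq> cmod (cinner (Bop y (\<phi> (fst y) k)) (\<phi> (fst y) l))"
      if "(k, l) \<in> S" "y \<in> Ix" "fst y = fst x" "y \<noteq> x" for k l y
    proof -
      have "snd y \<in> {1..n (fst x)} - {snd x}" using that by (auto simp: Ix_iff prod_eq_iff)
      from S(2)[OF that(1) this] show ?thesis using that(3) m[of x] m[of y] by simp
    qed
    then show ?thesis using S(1) unfolding m by blast
  qed
qed

end

section \<open>From the tracked curve of frames back to the controls and propagators of the
  theorem\<close>

theorem theorem1p1:
  fixes p :: nat
    and n :: "nat \<Rightarrow> nat"
    and H :: "nat \<Rightarrow> 'h::complex_inner set"
    and A :: "nat \<Rightarrow> 'h \<rightharpoonup> 'h"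
    and B :: "nat \<Rightarrow> nat \<Rightarrow> 'h \<rightharpoonup> 'h"
    and U :: "real set"
    and \<phi> :: "nat \<Rightarrow> nat \<Rightarrow> 'h"
    and \<mu> :: "nat \<Rightarrow> nat \<Rightarrow> complex"
    and C :: "nat \<Rightarrow> nat \<Rightarrow> real \<Rightarrow> 'h \<rightharpoonup> 'h"
    and W :: "nat \<Rightarrow> nat \<Rightarrow> real \<Rightarrow> real \<Rightarrow> 'h \<Rightarrow> 'h"
    and T :: real
    and c :: "nat \<Rightarrow> nat \<Rightarrow> real \<Rightarrow> 'h \<Rightarrow> 'h"
    and N :: nat
  assumes system: "control_system_family p n H A B U \<phi> \<mu> C W"
    and spectra: "rat_independent_family ({1..p} \<times> {1..}) (\<lambda>(i, k). \<mu> i k)"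
    and chains: "\<And>i\<^sub>0 j\<^sub>0. \<lbrakk>i\<^sub>0 \<in> {1..p}; j\<^sub>0 \<in> {1..n i\<^sub>0}\<rbrakk> \<Longrightarrow>
      \<exists>S. connectedness_chain (mcoeff (B i\<^sub>0 j\<^sub>0) (\<phi> i\<^sub>0)) S \<and>
          (\<forall>s\<in>S. \<forall>j\<in>{1..n i\<^sub>0} - {j\<^sub>0}.
             cmod (mcoeff (B i\<^sub>0 j\<^sub>0) (\<phi> i\<^sub>0) s) \<noteq> cmod (mcoeff (B i\<^sub>0 j) (\<phi> i\<^sub>0) s))"
    and U_nhd: "0 \<in> interior U"
    and T_pos: "T > 0"
    and c_cont: "\<And>i j. \<lbrakk>i \<in> {1..p}; j \<in> {1..n i}\<rbrakk> \<Longrightarrow>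
      opnorm_continuous_on (H i) {0..T} (c i j)"
    and c_0: "\<And>i j x. \<lbrakk>i \<in> {1..p}; j \<in> {1..n i}; x \<in> H i\<rbrakk> \<Longrightarrow> c i j 0 x = x"
    and c_unitary: "\<And>i j t. \<lbrakk>i \<in> {1..p}; j \<in> {1..n i}; t \<in> {0..T}\<rbrakk> \<Longrightarrow>
      unitary_on (H i) (c i j t)"
    and N_pos: "N \<ge> 1"
  shows "\<forall>\<epsilon>>0. \<exists>Tu>T. \<exists>u pieces.
    piecewise_constant_control U Tu u pieces \<and>
    (\<forall>t\<in>{0..Tu}. \<exists>s\<in>{0..T}. \<forall>k\<ge>1. \<forall>i\<in>{1..p}. \<forall>j\<in>{1..n i}. \<forall>l\<in>{1..N}.
       \<bar>cmod (cinner (propagator (W i j) pieces t (\<phi> i l)) (\<phi> i k))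
         - cmod (cinner (c i j s (\<phi> i l)) (\<phi> i k))\<bar> < \<epsilon>) \<and>
    (\<forall>i\<in>{1..p}. \<forall>j\<in>{1..n i}. \<forall>l\<in>{1..N}.
       norm (propagator (W i j) pieces Tu (\<phi> i l) - c i j T (\<phi> i l)) < \<epsilon>)"
proof (intro allI impI)
  fix \<epsilon> :: real assume \<epsilon>: "\<epsilon> > 0"
  interpret control_system_family p n H A B U \<phi> \<mu> C W by (rule system)
  interpret tracked_system p n H A B U \<phi> \<mu> C W
    by unfold_locales (use spectra chains U_nhd in auto)
  \<comment> \<open>The images of the first \<open>N\<close> basis vectors under the given curve;
    unitarity makes them an orthonormal frame at every time.\<close>
  define \<gamma> where "\<gamma> x l t = c (fst x) (snd x) t (\<phi> (fst x) l)" for x :: "nat \<times> nat" and l t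
  have cu: "unitary_on (H (fst x)) (c (fst x) (snd x) t)" if "x \<in> Ix" "t \<in> {0..T}" for x t
    using c_unitary that by (simp add: Ix_iff)
  have "\<exists>w. cf.adm w \<and> cf.dur w > T \<and> (\<forall>x\<in>Ix. \<forall>l\<in>{1..N}. norm (cf.ev x w (\<phi> (fst x) l) - \<gamma> x l T) < \<epsilon>) \<and>
    (\<forall>t\<in>{0..cf.dur w}. \<exists>s\<in>{0..T}. \<forall>x\<in>Ix. \<forall>l\<in>{1..N}. \<forall>k\<ge>1.
      \<bar>cmod (cinner (propagator (W (fst x) (snd x)) w t (\<phi> (fst x) l)) (\<phi> (fst x) k)) - cmod (cinner (\<gamma> x l s) (\<phi> (fst x) k))\<bar> < \<epsilon>)"
  proof (rule pf.track_curve[OF T_pos \<epsilon>])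
    show "pf.frame N x (\<lambda>l. \<gamma> x l t)" if x: "x \<in> Ix" and t: "t \<in> {0..T}" for x t
      unfolding pf.frame_def
    proof (intro conjI ballI)
      fix l assume l: "l \<in> {1..N}"
      show "\<gamma> x l t \<in> H (fst x)"
        unfolding \<gamma>_def using l by (intro isom_mem[OF unitary_imp_isom[OF cu[OF x t]]] cf.e_H x) auto
      fix m assume m: "m \<in> {1..N}"
      have "cinner (\<gamma> x l t) (\<gamma> x m t) = cinner (\<phi> (fst x) l) (\<phi> (fst x) m)"
        unfolding \<gamma>_def using cu[OF x t] cf.e_H[OF x, of l] cf.e_H[OF x, of m] l m by (simp add: unitary_on_def)
      then show "cinner (\<gamma> x l t) (\<gamma> x m t) = (if l = m then 1 else 0)"
        using cf.e_cinner[OF x] l m by simp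
    qed
    fix x l assume x: "x \<in> Ix" and l: "l \<in> {1..N}"
    then have e: "\<phi> (fst x) l \<in> H (fst x)" using cf.e_H[OF x] by auto
    show "continuous_on {0..T} (\<gamma> x l)"
      unfolding \<gamma>_def[abs_def]
      using c_cont x e unitary_imp_isom[OF cu[OF x]]
      by (intro opnorm_continuous_imp[where H = "H (fst x)"]) (auto simp: Ix_iff)
    show "\<gamma> x l 0 = \<phi> (fst x) l" using c_0 x e by (simp add: \<gamma>_def Ix_iff)
  qed
  then obtain w where w: "cf.adm w" "cf.dur w > T"
    "\<And>x l. x\<in>Ix \<Longrightarrow> l\<in>{1..N} \<Longrightarrow> norm (cf.ev x w (\<phi> (fst x) l) - \<gamma> x l T) < \<epsilon>"
    "\<And>t. t\<in>{0..cf.dur w} \<Longrightarrow> \<exists>s\<in>{0..T}. \<forall>x\<in>Ix. \<forall>l\<in>{1..N}. \<forall>k\<ge>1.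
      \<bar>cmod (cinner (propagator (W (fst x) (snd x)) w t (\<phi> (fst x) l)) (\<phi> (fst x) k)) - cmod (cinner (\<gamma> x l s) (\<phi> (fst x) k))\<bar> < \<epsilon>"
    by blast
  obtain u where u: "piecewise_constant_control U (cf.dur w) u w"
    using piecewise_constant_control_exists[of w U] w(1) zero_U unfolding cf.adm_def cf.dur_def by blast
  have Ixp: "(i, j) \<in> Ix" if "i \<in> {1..p}" "j \<in> {1..n i}" for i j using that by (simp add: Ix_def)
  have a: "\<exists>s\<in>{0..T}. \<forall>k\<ge>1. \<forall>i\<in>{1..p}. \<forall>j\<in>{1..n i}. \<forall>l\<in>{1..N}.
       \<bar>cmod (cinner (propagator (W i j) w t (\<phi> i l)) (\<phi> i k))
         - cmod (cinner (c i j s (\<phi> i l)) (\<phi> i k))\<bar> < \<epsilon>" if t: "t \<in> {0..cf.dur w}" for t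
  proof -
    obtain s where s: "s \<in> {0..T}" and est: "\<And>x l k. x\<in>Ix \<Longrightarrow> l\<in>{1..N} \<Longrightarrow> k\<ge>1 \<Longrightarrow>
      \<bar>cmod (cinner (propagator (W (fst x) (snd x)) w t (\<phi> (fst x) l)) (\<phi> (fst x) k)) - cmod (cinner (\<gamma> x l s) (\<phi> (fst x) k))\<bar> < \<epsilon>"
      using w(4)[OF t] by blast
    have "\<bar>cmod (cinner (propagator (W i j) w t (\<phi> i l)) (\<phi> i k))
         - cmod (cinner (c i j s (\<phi> i l)) (\<phi> i k))\<bar> < \<epsilon>"
      if "k \<ge> 1" "i \<in> {1..p}" "j \<in> {1..n i}" "l \<in> {1..N}" for i j k l
      using est[OF Ixp[OF that(2,3)] that(4,1)] by (simp add: \<gamma>_def)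
    then show ?thesis using s by blast
  qed
  have b: "norm (propagator (W i j) w (cf.dur w) (\<phi> i l) - c i j T (\<phi> i l)) < \<epsilon>"
    if "i \<in> {1..p}" "j \<in> {1..n i}" "l \<in> {1..N}" for i j l
    using w(3)[OF Ixp[OF that(1,2)] that(3)] by (simp add: \<gamma>_def cf.ev_def)
  show "\<exists>Tu>T. \<exists>u pieces. piecewise_constant_control U Tu u pieces \<and>
    (\<forall>t\<in>{0..Tu}. \<exists>s\<in>{0..T}. \<forall>k\<ge>1. \<forall>i\<in>{1..p}. \<forall>j\<in>{1..n i}. \<forall>l\<in>{1..N}.
       \<bar>cmod (cinner (propagator (W i j) pieces t (\<phi> i l)) (\<phi> i k))
         - cmod (cinner (c i j s (\<phi> i l)) (\<phi> i k))\<bar> < \<epsilon>) \<and>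
    (\<forall>i\<in>{1..p}. \<forall>j\<in>{1..n i}. \<forall>l\<in>{1..N}.
       norm (propagator (W i j) pieces Tu (\<phi> i l) - c i j T (\<phi> i l)) < \<epsilon>)"
    using w(2) u a b by (intro exI[of _ "cf.dur w"] exI[of _ u] exI[of _ w] conjI ballI) blast+
qed

end
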